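(* Let $E(t)$, $t\in(0,T]$, be the solution operator of the homogeneous time-fractional Oldroyd-B problem (see context), and let $E^{(m)}(t)$ denote its $m$-th derivative in $t$. For every integer $m\ge 0$ there is a constant $C$, depending on $\alpha,\beta,\mu,a,b,T$ (and on $m$), such that for all $t\in(0,T]$ and $\nu\in\{0,1\}$: $$\|A^\nu E^{(m)}(t)v\|\le C\,t^{-m-\nu(\alpha-\beta+1)}\|v\|\qquad\text{for all } v\in L^2(\Omega),\ m\ge 0,$$ $$\|A^\nu E^{(m)}(t)v\|\le C\,t^{-m+(1-\nu)(\alpha-\beta+1)}\|Av\|\qquad\text{for all } v\in \dot H^2(\Omega),\ \text{provided } \nu+m\ge 1.$$
   Context: $\Omega\subset\mathbb R^2$ is a bounded convex polygonal domain, $T>0$, $\alpha,\beta\in(0,1)$, and $\mu,a,b>0$ are constants. $\|\cdot\|$ is the norm of $L^2(\Omega)$. $A=-\Delta$ with homogeneous Dirichlet boundary condition; $\{\lambda_j\},\{\phi_j\}$ are its eigenvalues and $L^2(\Omega)$-orthonormal eigenfunctions; for $r\ge 0$, $\dot H^r(\Omega)$ is the Hilbert space with norm $\|v\|_{\dot H^r(\Omega)}^2=\|A^{r/2}v\|^2=\sum_j\lambda_j^r(v,\phi_j)^2$ (so $\dot H^2(\Omega)=H^2(\Omega)\cap H^1_0(\Omega)$). The homogeneous problem is $(1+a\partial_t^\alpha)u_t=\mu(1+b\partial_t^\beta)\Delta u$ in $\Omega\times(0,T]$, $u=0$ on $\partial\Omega\times(0,T]$, $u(0)=v$, $(I^{1-\alpha}u_t)(0)=0$,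 where $I^{\gamma}\varphi(t)=\int_0^t\frac{(t-s)^{\gamma-1}}{\Gamma(\gamma)}\varphi(s)\,ds$ and $\partial_t^\alpha\varphi=\frac{d}{dt}I^{1-\alpha}\varphi$ (Riemann-Liouville derivative). Its solution is $u(t)=E(t)v$ with $$E(t)=\frac1{2\pi i}\int_{\Gamma_{\theta,\delta}}e^{zt}\hat E(z)\,dz,\qquad \hat E(z)=\frac{g(z)}{z}(g(z)I+A)^{-1},\qquad g(z)=\frac{z+az^{\alpha+1}}{\mu(1+bz^\beta)},$$ where powers are principal, $\theta\in(\pi/2,\pi/(1+\alpha))$, $\delta>0$, and $\Gamma_{\theta,\delta}=\{\rho e^{\pm i\theta}:\rho\ge\delta\}\cup\{\delta e^{i\psi}:|\psi|\le\theta\}$ is oriented with increasing imaginary part (the value of $E(t)$ does not depend on $\theta,\delta$). *)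

theory Defs
  imports "HOL-Analysis.Analysis"
begin

section \<open>Complex-valued square-integrable functions on the plane\<close>

definition sqint :: "(real^2 \<Rightarrow> complex) \<Rightarrow> bool" where
  "sqint f \<longleftrightarrow> f \<in> borel_measurable lborel \<and> integrable lborel (\<lambda>x. (cmod (f x))\<^sup>2)"

lemma cnj_measurable [measurable]: "cnj \<in> borel_measurable borel"
  by (intro borel_measurable_continuous_onI continuous_intros)

lemma sqint_zero: "sqint (\<lambda>_. 0)"
  by (simp add: sqint_def)

lemma sqint_add:
  assumes "sqint f" "sqint g"
  shows "sqint (\<lambda>x. f x + g x)"
proof -
  have [measurable]: "f \<in> borel_measurable lborel" "g \<in> borel_measurable lborel"
    using assms by (auto simp: sqint_def)
  have "(cmod (f x + g x))\<^sup>2 \<le> 2 * (cmod (f x))\<^sup>2 + 2 * (cmod (g x))\<^sup>2" for x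
  proof -
    have "(cmod (f x + g x))\<^sup>2 \<le> (cmod (f x) + cmod (g x))\<^sup>2"
      by (intro power_mono norm_triangle_ineq) auto
    also have "\<dots> \<le> 2 * (cmod (f x))\<^sup>2 + 2 * (cmod (g x))\<^sup>2"
      using sum_squares_bound[of "cmod (f x)" "cmod (g x)"] by (simp add: power2_sum)
    finally show ?thesis .
  qed
  then have le: "norm ((cmod (f x + g x))\<^sup>2)
      \<le> norm (2 * (cmod (f x))\<^sup>2 + 2 * (cmod (g x))\<^sup>2)" for x
    by (smt (verit) real_norm_def zero_le_power2)
  have int: "integrable lborel (\<lambda>x. 2 * (cmod (f x))\<^sup>2 + 2 * (cmod (g x))\<^sup>2)"
    using assms by (auto simp: sqint_def)
  have "integrable lborel (\<lambda>x. (cmod (f x + g x))\<^sup>2)"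
    by (rule Bochner_Integration.integrable_bound[OF int])
       (measurable, rule AE_I2, rule le)
  moreover have "(\<lambda>x. f x + g x) \<in> borel_measurable lborel" by measurable
  ultimately show ?thesis unfolding sqint_def by blast
qed

lemma sqint_cmult: "sqint f \<Longrightarrow> sqint (\<lambda>x. c * f x)"
  by (auto simp: sqint_def norm_mult power_mult_distrib)

lemma sqint_mult_cnj:
  assumes "sqint f" "sqint g"
  shows "integrable lborel (\<lambda>x. f x * cnj (g x))"
proof -
  have [measurable]: "f \<in> borel_measurable lborel" "g \<in> borel_measurable lborel"
    using assms by (auto simp: sqint_def)
  have int: "integrable lborel (\<lambda>x. (cmod (f x))\<^sup>2 + (cmod (g x))\<^sup>2)"
    using assms by (auto simp: sqint_def)
  have le: "norm (f x * cnj (g x)) \<le> norm ((cmod (f x))\<^sup>2 + (cmod (g x))\<^sup>2)" for x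
  proof -
    have "2 * (cmod (f x) * cmod (g x)) \<le> (cmod (f x))\<^sup>2 + (cmod (g x))\<^sup>2"
      using sum_squares_bound[of "cmod (f x)" "cmod (g x)"] by simp
    moreover have "0 \<le> cmod (f x) * cmod (g x)" by simp
    ultimately have "cmod (f x) * cmod (g x) \<le> (cmod (f x))\<^sup>2 + (cmod (g x))\<^sup>2" by linarith
    then show ?thesis by (simp add: norm_mult)
  qed
  show ?thesis
    by (rule Bochner_Integration.integrable_bound[OF int])
       (measurable, rule AE_I2, rule le)
qed

quotient_type L2 = "real^2 \<Rightarrow> complex" / partial:
  "\<lambda>f g. sqint f \<and> sqint g \<and> (AE x in lborel. f x = g x)"
proof (rule part_equivpI)
  show "\<exists>f. sqint f \<and> sqint f \<and> (AE x in lborel. f x = f x)"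
    using sqint_zero by auto
  show "symp (\<lambda>f g. sqint f \<and> sqint g \<and> (AE x in lborel. f x = g x))"
    by (auto simp: symp_def elim: eventually_mono)
  show "transp (\<lambda>f g. sqint f \<and> sqint g \<and> (AE x in lborel. f x = g x))"
    by (auto simp: transp_def elim: eventually_elim2)
qed

lift_definition cscale :: "complex \<Rightarrow> L2 \<Rightarrow> L2" (infixr "*\<^sub>C" 75) is "\<lambda>c f x. c * f x"
  by (auto intro: sqint_cmult elim: eventually_mono)

lift_definition cinner :: "L2 \<Rightarrow> L2 \<Rightarrow> complex" is "\<lambda>f g. (LINT x|lborel. f x * cnj (g x))"
proof -
  fix f f' g g' :: "real^2 \<Rightarrow> complex"
  assume A: "sqint f \<and> sqint f' \<and> (AE x in lborel. f x = f' x)"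
    and B: "sqint g \<and> sqint g' \<and> (AE x in lborel. g x = g' x)"
  have [measurable]: "f \<in> borel_measurable borel" "g \<in> borel_measurable borel"
      "f' \<in> borel_measurable borel" "g' \<in> borel_measurable borel"
    using A B by (auto simp: sqint_def)
  have "AE x in lborel. f x * cnj (g x) = f' x * cnj (g' x)"
    using conjunct2[OF conjunct2[OF A]] conjunct2[OF conjunct2[OF B]] by eventually_elim simp
  then show "(LINT x|lborel. f x * cnj (g x)) = (LINT x|lborel. f' x * cnj (g' x))"
    by (intro integral_cong_AE) auto
qed

instantiation L2 :: real_vector
begin

lift_definition zero_L2 :: L2 is "\<lambda>_. 0"
  by (simp add: sqint_zero)

lift_definition plus_L2 :: "L2 \<Rightarrow> L2 \<Rightarrow> L2" is "\<lambda>f g x. f x + g x"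
  by (auto intro: sqint_add elim: eventually_elim2)

definition uminus_L2 :: "L2 \<Rightarrow> L2" where "uminus_L2 u = (-1) *\<^sub>C u"

definition minus_L2 :: "L2 \<Rightarrow> L2 \<Rightarrow> L2" where "minus_L2 u v = u + (-1) *\<^sub>C v"

definition scaleR_L2 :: "real \<Rightarrow> L2 \<Rightarrow> L2" where "scaleR_L2 r u = complex_of_real r *\<^sub>C u"

instance
proof
  fix u v w :: L2 and a b :: real
  show "u + v + w = u + (v + w)"
    by transfer (auto intro!: sqint_add simp: add.assoc)
  show "u + v = v + u"
    by transfer (auto intro!: sqint_add simp: add.commute)
  show "0 + u = u"
    by transfer auto
  show "- u + u = 0"
    unfolding uminus_L2_def by transfer (use sqint_zero in auto)
  show "u - v = u + - v"
    by (simp add: uminus_L2_def minus_L2_def)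
  show "a *\<^sub>R (u + v) = a *\<^sub>R u + a *\<^sub>R v"
    unfolding scaleR_L2_def
    by transfer (auto intro!: sqint_add sqint_cmult
        simp: distrib_left)
  show "(a + b) *\<^sub>R u = a *\<^sub>R u + b *\<^sub>R u"
    unfolding scaleR_L2_def
    by transfer (auto intro!: sqint_add sqint_cmult simp: distrib_right)
  show "a *\<^sub>R b *\<^sub>R u = (a * b) *\<^sub>R u"
    unfolding scaleR_L2_def
    by transfer (auto intro!: sqint_cmult simp: mult.assoc)
  show "1 *\<^sub>R u = u"
    unfolding scaleR_L2_def by transfer auto
qed

end

instantiation L2 :: real_inner
begin

definition inner_L2 :: "L2 \<Rightarrow> L2 \<Rightarrow> real" where "inner_L2 u v = Re (cinner u v)"

definition norm_L2 :: "L2 \<Rightarrow> real" where "norm_L2 u = sqrt (inner u u)"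

definition sgn_L2 :: "L2 \<Rightarrow> L2" where "sgn_L2 u = u /\<^sub>R norm u"

definition dist_L2 :: "L2 \<Rightarrow> L2 \<Rightarrow> real" where "dist_L2 u v = norm (u - v)"

definition uniformity_L2 :: "(L2 \<times> L2) filter" where
  "uniformity_L2 = (INF e\<in>{0<..}. principal {(x, y). dist x y < e})"

definition open_L2 :: "L2 set \<Rightarrow> bool" where
  "open_L2 U = (\<forall>x\<in>U. \<forall>\<^sub>F (x', y) in uniformity. x' = x \<longrightarrow> y \<in> U)"

instance
proof
  fix u v w :: L2 and a :: real
  show "dist u v = norm (u - v)" by (simp add: dist_L2_def)
  show "sgn u = u /\<^sub>R norm u" by (simp add: sgn_L2_def)
  show "inner u v = inner v u"
    unfolding inner_L2_def
  proof transfer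
    fix f g :: "real^2 \<Rightarrow> complex"
    have "(LINT x|lborel. g x * cnj (f x)) = (LINT x|lborel. cnj (f x * cnj (g x)))"
      by (simp add: mult.commute)
    also have "\<dots> = cnj (LINT x|lborel. f x * cnj (g x))"
      by (rule Bochner_Integration.integral_cnj)
    finally show "Re (LINT x|lborel. f x * cnj (g x)) = Re (LINT x|lborel. g x * cnj (f x))"
      by simp
  qed
  show "inner (u + v) w = inner u w + inner v w"
    unfolding inner_L2_def
    by transfer (simp add: distrib_right sqint_mult_cnj)
  show "inner (a *\<^sub>R u) v = a * inner u v"
    unfolding inner_L2_def scaleR_L2_def
    by transfer (simp add: mult.assoc)
  have ii: "Re (LINT x|lborel. f x * cnj (f x)) = (LINT x|lborel. (cmod (f x))\<^sup>2)"
    for f :: "real^2 \<Rightarrow> complex"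
  proof -
    have "(\<lambda>x. f x * cnj (f x)) = (\<lambda>x. complex_of_real ((cmod (f x))\<^sup>2))"
      by (simp only: complex_norm_square)
    then show ?thesis by (simp only: integral_complex_of_real Re_complex_of_real)
  qed
  show "0 \<le> inner u u"
    unfolding inner_L2_def by transfer (simp only: ii, simp)
  show "inner u u = 0 \<longleftrightarrow> u = 0"
    unfolding inner_L2_def
  proof transfer
    fix f :: "real^2 \<Rightarrow> complex"
    assume *: "sqint f \<and> sqint f \<and> (AE x in lborel. f x = f x)"
    then have "integrable lborel (\<lambda>x. (cmod (f x))\<^sup>2)" by (simp add: sqint_def)
    then have "((LINT x|lborel. (cmod (f x))\<^sup>2) = 0) = (AE x in lborel. (cmod (f x))\<^sup>2 = 0)"
      by (intro integral_nonneg_eq_0_iff_AE) auto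
    then show "(Re (LINT x|lborel. f x * cnj (f x)) = 0) =
        (sqint f \<and> sqint (\<lambda>_. 0) \<and> (AE x in lborel. f x = 0))"
      using * sqint_zero by (simp add: ii)
  qed
  show "norm u = sqrt (inner u u)" by (simp add: norm_L2_def)
qed (rule uniformity_L2_def open_L2_def)+

end

text \<open>
  \<open>L\<^sup>2(\<Omega>)\<close> is represented by the elements of \<open>L\<^sup>2(\<real>\<^sup>2)\<close> that vanish almost everywhere outside
  \<open>\<Omega>\<close> (extension by zero), so that the norm of the type \<open>L2\<close> is the norm of \<open>L\<^sup>2(\<Omega>)\<close> on them.
\<close>

lift_definition vanishes_outside :: "(real^2) set \<Rightarrow> L2 \<Rightarrow> bool" is
  "\<lambda>\<Omega> f. AE x in lborel. x \<notin> \<Omega> \<longrightarrow> f x = 0"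
  by (auto elim: eventually_elim2)

definition L2_on :: "(real^2) set \<Rightarrow> L2 set" where
  "L2_on \<Omega> = {u. vanishes_outside \<Omega> u}"


section \<open>Sobolev spaces and the Dirichlet Laplacian\<close>

definition convex_polygonal_domain :: "(real^2) set \<Rightarrow> bool" where
  "convex_polygonal_domain \<Omega> \<longleftrightarrow> \<Omega> \<noteq> {} \<and> (\<exists>P. polytope P \<and> \<Omega> = interior P)"

definition pdiff :: "2 \<Rightarrow> (real^2 \<Rightarrow> complex) \<Rightarrow> real^2 \<Rightarrow> complex" where
  "pdiff i f x = frechet_derivative f (at x) (axis i 1)"

text \<open>
  A function is smooth iff all its iterated partial derivatives exist and are (totally)
  differentiable everywhere; this forces them all to be continuous.
\<close>

definition smooth :: "(real^2 \<Rightarrow> complex) \<Rightarrow> bool" where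
  "smooth f \<longleftrightarrow> (\<forall>is x. foldr pdiff is f differentiable (at x))"

definition test_functions :: "(real^2) set \<Rightarrow> (real^2 \<Rightarrow> complex) set" where
  "test_functions \<Omega> =
     {\<psi>. smooth \<psi> \<and> compact (closure {x. \<psi> x \<noteq> 0}) \<and> closure {x. \<psi> x \<noteq> 0} \<subseteq> \<Omega>}"

definition has_weak_deriv :: "(real^2) set \<Rightarrow> 2 \<Rightarrow> L2 \<Rightarrow> L2 \<Rightarrow> bool" where
  "has_weak_deriv \<Omega> i u g \<longleftrightarrow> g \<in> L2_on \<Omega> \<and>
     (\<forall>\<psi>\<in>test_functions \<Omega>. cinner u (abs_L2 (pdiff i \<psi>)) = - cinner g (abs_L2 \<psi>))"

definition weak_deriv :: "(real^2) set \<Rightarrow> 2 \<Rightarrow> L2 \<Rightarrow> L2" where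
  "weak_deriv \<Omega> i u = (THE g. has_weak_deriv \<Omega> i u g)"

definition H1 :: "(real^2) set \<Rightarrow> L2 set" where
  "H1 \<Omega> = {u \<in> L2_on \<Omega>. \<forall>i. \<exists>g. has_weak_deriv \<Omega> i u g}"

definition H1_norm :: "(real^2) set \<Rightarrow> L2 \<Rightarrow> real" where
  "H1_norm \<Omega> u = sqrt ((norm u)\<^sup>2 + (\<Sum>i\<in>UNIV. (norm (weak_deriv \<Omega> i u))\<^sup>2))"

definition H10 :: "(real^2) set \<Rightarrow> L2 set" where
  "H10 \<Omega> = {u \<in> H1 \<Omega>. \<exists>\<psi>. (\<forall>n::nat. \<psi> n \<in> test_functions \<Omega>) \<and>
                        (\<lambda>n. H1_norm \<Omega> (u - abs_L2 (\<psi> n))) \<longlonglongrightarrow> 0}"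

text \<open>\<open>u \<in> H\<^sup>1\<^sub>0(\<Omega>)\<close> and \<open>-\<Delta>u = f \<in> L\<^sup>2(\<Omega>)\<close>, in the weak sense.\<close>

definition weak_poisson :: "(real^2) set \<Rightarrow> L2 \<Rightarrow> L2 \<Rightarrow> bool" where
  "weak_poisson \<Omega> u f \<longleftrightarrow> u \<in> H10 \<Omega> \<and> f \<in> L2_on \<Omega> \<and>
     (\<forall>w\<in>H10 \<Omega>. (\<Sum>i\<in>UNIV. cinner (weak_deriv \<Omega> i u) (weak_deriv \<Omega> i w)) = cinner f w)"

definition dom_A :: "(real^2) set \<Rightarrow> L2 set" where
  "dom_A \<Omega> = {u. \<exists>f. weak_poisson \<Omega> u f}"

definition op_A :: "(real^2) set \<Rightarrow> L2 \<Rightarrow> L2" where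
  "op_A \<Omega> u = (THE f. weak_poisson \<Omega> u f)"

definition eigensystem :: "(real^2) set \<Rightarrow> (nat \<Rightarrow> real) \<Rightarrow> (nat \<Rightarrow> L2) \<Rightarrow> bool" where
  "eigensystem \<Omega> lam \<phi> \<longleftrightarrow>
     (\<forall>j. \<phi> j \<in> dom_A \<Omega> \<and> op_A \<Omega> (\<phi> j) = lam j *\<^sub>R \<phi> j) \<and>
     (\<forall>i j. cinner (\<phi> i) (\<phi> j) = (if i = j then 1 else 0)) \<and>
     (\<forall>v\<in>L2_on \<Omega>. (\<forall>j. cinner v (\<phi> j) = 0) \<longrightarrow> v = 0)"

definition Hdot :: "(real^2) set \<Rightarrow> (nat \<Rightarrow> real) \<Rightarrow> (nat \<Rightarrow> L2) \<Rightarrow> real \<Rightarrow> L2 set" where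
  "Hdot \<Omega> lam \<phi> r =
     {v \<in> L2_on \<Omega>. summable (\<lambda>j. lam j powr r * (cmod (cinner v (\<phi> j)))\<^sup>2)}"


section \<open>The solution operator\<close>

definition oldroyd_g :: "real \<Rightarrow> real \<Rightarrow> real \<Rightarrow> real \<Rightarrow> real \<Rightarrow> complex \<Rightarrow> complex" where
  "oldroyd_g \<alpha> \<beta> \<mu> a b z =
     (z + of_real a * z powr of_real (\<alpha> + 1)) / (of_real \<mu> * (1 + of_real b * z powr of_real \<beta>))"

text \<open>\<open>resolvent \<Omega> s v\<close> is \<open>(s I + A)\<^sup>-\<^sup>1 v\<close>.\<close>

definition resolvent :: "(real^2) set \<Rightarrow> complex \<Rightarrow> L2 \<Rightarrow> L2" where
  "resolvent \<Omega> s v = (THE u. u \<in> dom_A \<Omega> \<and> s *\<^sub>C u + op_A \<Omega> u = v)"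

definition E_hat :: "(real^2) set \<Rightarrow> (complex \<Rightarrow> complex) \<Rightarrow> complex \<Rightarrow> L2 \<Rightarrow> L2" where
  "E_hat \<Omega> g z v = (g z / z) *\<^sub>C resolvent \<Omega> (g z) v"

text \<open>
  Integral over \<open>\<Gamma>\<^bsub>\<theta>,\<delta>\<^esub>\<close>, oriented with increasing imaginary part. The summands are the lower ray
  (traversed towards the origin, hence the sign), the arc, and the upper ray.
\<close>

definition hankel_integral :: "real \<Rightarrow> real \<Rightarrow> (complex \<Rightarrow> L2) \<Rightarrow> L2" where
  "hankel_integral \<theta> \<delta> F =
     - integral {\<delta>..} (\<lambda>\<rho>. cis (- \<theta>) *\<^sub>C F (of_real \<rho> * cis (- \<theta>)))
     + integral {- \<theta>..\<theta>} (\<lambda>\<psi>. (\<i> * of_real \<delta> * cis \<psi>) *\<^sub>C F (of_real \<delta> * cis \<psi>))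
     + integral {\<delta>..} (\<lambda>\<rho>. cis \<theta> *\<^sub>C F (of_real \<rho> * cis \<theta>))"

definition sol_op ::
    "(real^2) set \<Rightarrow> (complex \<Rightarrow> complex) \<Rightarrow> real \<Rightarrow> real \<Rightarrow> real \<Rightarrow> L2 \<Rightarrow> L2" where
  "sol_op \<Omega> g \<theta> \<delta> t v =
     (1 / (2 * of_real pi * \<i>)) *\<^sub>C
       hankel_integral \<theta> \<delta> (\<lambda>z. exp (z * of_real t) *\<^sub>C E_hat \<Omega> g z v)"

text \<open>
  \<open>sol_op_deriv \<Omega> g \<theta> \<delta> m t v\<close> is \<open>E\<^sup>(\<^sup>m\<^sup>)(t) v\<close>; the derivative in \<open>t\<close> is taken in the norm of
  \<open>L\<^sup>2(\<Omega>)\<close> for each fixed \<open>v\<close>.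
\<close>

definition sol_op_deriv ::
    "(real^2) set \<Rightarrow> (complex \<Rightarrow> complex) \<Rightarrow> real \<Rightarrow> real \<Rightarrow> nat \<Rightarrow> real \<Rightarrow> L2 \<Rightarrow> L2" where
  "sol_op_deriv \<Omega> g \<theta> \<delta> m t v =
     ((\<lambda>f s. vector_derivative f (at s)) ^^ m) (\<lambda>s. sol_op \<Omega> g \<theta> \<delta> s v) t"

end

theory Submission
  imports Defs "HOL-Complex_Analysis.Complex_Analysis"
begin

text \<open>
  In the eigenbasis the operator \<open>E(t)\<close> is multiplication by scalar functions \<open>e\<^sub>\<lambda>(t)\<close>, the Hankel
  integrals of \<open>exp (z t) g(z) / (z (g(z) + \<lambda>))\<close>, so by Parseval everything reduces to bounds for
  \<open>e\<^sub>\<lambda>\<close> and its derivatives that are uniform in \<open>\<lambda> \<ge> 0\<close>. Since \<open>g\<close> maps the sector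
  \<open>\<bar>arg z\<bar> \<le> \<theta>\<close> into the sector \<open>\<bar>arg z\<bar> \<le> (1 + \<alpha>) \<theta>\<close>, which avoids the negative axis, both
  \<open>\<bar>g / (g + \<lambda>)\<bar>\<close> and \<open>\<lambda> / \<bar>g + \<lambda>\<bar>\<close> are bounded, while \<open>\<bar>g(z)\<bar>\<close> is comparable to
  \<open>\<bar>z\<bar>\<close> raised to \<open>1 + \<alpha> - \<beta>\<close> for \<open>\<bar>z\<bar> \<ge> 1 / T\<close>. The constant may not depend on \<open>\<theta>\<close> and \<open>\<delta>\<close>; therefore
  the contour is deformed to a fixed angle and to the radius \<open>1 / t\<close>, which also produces the
  powers of \<open>t\<close>. For the bound in terms of \<open>A v\<close>, the term \<open>1 / z\<close> is split off from the
  symbol: after differentiation its Hankel integral vanishes.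
\<close>

section \<open>Hankel integrals of scalar functions\<close>

text \<open>The function g is comparable to a single power of |z| only away from the origin; near 0
  it behaves like z / \<mu>. On the contour of radius 1 / t with t \<le> T one has |z| \<ge> 1 / T,
  so the second regime is never met; this is where T enters the constants. All scalar bounds are
  uniform over l \<ge> 0, hence the constant can be chosen before the domain and its eigenvalues.

  Two obstacles shape the rest. The m-th derivative of E is an iterated derivative in the norm of
  L^2, so differentiating each coefficient is not enough: the second-order Taylor remainder of the
  scalar functions must be bounded with one constant for all l. And \<open>weak_deriv\<close>,
  \<open>op_A\<close> and \<open>resolvent\<close> are definite descriptions: uniqueness is drawn
  each time from the completeness of the eigenfunctions, while existence of the resolvent comes from
  expanding in eigenfunctions and from the closedness of the graph of A, which in turn rests on the
  completeness of L^2.\<close>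

definition powr_exp_const :: "real \<Rightarrow> real \<Rightarrow> real" where
  "powr_exp_const p c = exp (\<bar>p\<bar> * (- 1 - ln (c / (\<bar>p\<bar> + 1))))"

text \<open>The logarithm lies below its tangents: ln x \<le> x - 1 is used at x = \<epsilon> r.
  Because r \<ge> 1 makes ln r nonnegative, p may be replaced by |p|, so one bound serves exponents
  of either sign.\<close>

lemma powr_le_exp:
  assumes "0 < c" "1 \<le> r"
  shows "r powr p \<le> powr_exp_const p c * exp (c * r)"
proof -
  \<comment> \<open>This slope satisfies |p| \<epsilon> \<le> c, and the + 1 keeps it defined for p
    = 0. It is the quantity inside the logarithm of \<open>powr_exp_const\<close>.\<close>
  define \<epsilon> where "\<epsilon> = c / (\<bar>p\<bar> + 1)"
  have \<epsilon>: "0 < \<epsilon>" "\<bar>p\<bar> * \<epsilon> \<le> c"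
    using assms by (auto simp: \<epsilon>_def field_simps)
  have "ln \<epsilon> + ln r \<le> \<epsilon> * r - 1"
    using ln_le_minus_one[of "\<epsilon> * r"] \<epsilon> assms by (simp add: ln_mult)
  then have "ln r \<le> \<epsilon> * r + (- 1 - ln \<epsilon>)" by linarith
  then have "\<bar>p\<bar> * ln r \<le> \<bar>p\<bar> * (\<epsilon> * r + (- 1 - ln \<epsilon>))"
    by (rule mult_left_mono) simp
  also have "\<dots> = (\<bar>p\<bar> * \<epsilon>) * r + \<bar>p\<bar> * (- 1 - ln \<epsilon>)" by (simp add: algebra_simps)
  also have "\<dots> \<le> c * r + \<bar>p\<bar> * (- 1 - ln \<epsilon>)"
    using \<epsilon> assms by (intro add_right_mono mult_right_mono) auto
  finally have "p * ln r \<le> \<bar>p\<bar> * (- 1 - ln \<epsilon>) + c * r"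
    using assms abs_ge_self[of p] by (smt (verit) mult_right_mono ln_ge_zero)
  then show ?thesis
    using assms by (simp add: powr_def exp_add[symmetric] powr_exp_const_def \<epsilon>_def)
qed

text \<open>A single term of the exponential series of c r is at most the whole sum.\<close>

lemma power_le_exp:
  fixes c r :: real
  assumes "0 < c" "0 \<le> r"
  shows "r ^ n \<le> fact n / c ^ n * exp (c * r)"
proof -
  have "(\<Sum>k\<in>{n}. (c * r) ^ k /\<^sub>R fact k) \<le> exp (c * r)"
    unfolding exp_def using assms by (intro sum_le_suminf summable_exp_generic) auto
  then show ?thesis using assms by (simp add: field_simps power_mult_distrib)
qed

lemma exp_neg_tendsto_0: "0 < c \<Longrightarrow> ((\<lambda>R. exp (- c * R)) \<longlongrightarrow> (0 :: real)) at_top"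
  by (rule filterlim_compose[OF exp_at_bot])
     (rule filterlim_tendsto_neg_mult_at_bot[OF tendsto_const _ filterlim_ident], simp)

text \<open>Existence on the half line comes from continuity on bounded pieces together with an
  integrable majorant. Values in an arbitrary Banach space let the lemma serve scalar and
  \<open>L2\<close>-valued integrands alike.\<close>

lemma exp_dominated_integral:
  fixes f :: "real \<Rightarrow> 'a::banach"
  assumes "continuous_on {d..} f" and c: "0 < c"
    and bound: "\<And>x. d \<le> x \<Longrightarrow> norm (f x) \<le> B * exp (- c * x)"
  shows "f integrable_on {d..}"
    and "norm (integral {d..} f) \<le> B * (exp (- c * d) / c)"
proof -
  have g: "((\<lambda>x. B * exp (- c * x)) has_integral B * (exp (- c * d) / c)) {d..}"
    by (rule has_integral_mult_right) (rule has_integral_exp_minus_to_infinity[OF c])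
  show int: "f integrable_on {d..}"
  proof (rule integrable_on_all_intervals_integrable_bound)
    fix u v :: real
    have "{d..} \<inter> cbox u v = {max d u..v}" by auto
    moreover have "f integrable_on {max d u..v}"
      by (rule integrable_continuous_real) (rule continuous_on_subset[OF assms(1)], auto)
    ultimately show "(\<lambda>x. if x \<in> {d..} then f x else 0) integrable_on cbox u v"
      using integrable_restrict_Int[of "{d..}" f "cbox u v"] by simp
    show "(\<lambda>x. B * exp (- c * x)) integrable_on {d..}"
      using g by blast
  qed (use bound in auto)
  have "norm (integral {d..} f) \<le> integral {d..} (\<lambda>x. B * exp (- c * x))"
    using g bound int by (intro integral_norm_bound_integral) auto
  then show "norm (integral {d..} f) \<le> B * (exp (- c * d) / c)"
    using integral_unique[OF g] by simp
qed

text \<open>The error is the integral over the tail {R..}, to which the preceding bound applies with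
  R as lower end.\<close>

lemma exp_dominated_integral_tendsto:
  fixes f :: "real \<Rightarrow> 'a::banach"
  assumes cont: "continuous_on {d..} f" and c: "0 < c"
    and bound: "\<And>x. d \<le> x \<Longrightarrow> norm (f x) \<le> B * exp (- c * x)"
  shows "((\<lambda>R. integral {d..R} f) \<longlongrightarrow> integral {d..} f) at_top"
proof -
  have "((\<lambda>R. integral {d..} f - integral {d..R} f) \<longlongrightarrow> 0) at_top"
  proof (rule Lim_null_comparison)
    show "((\<lambda>R. B * (exp (- c * R) / c)) \<longlongrightarrow> 0) at_top"
      using tendsto_mult[OF tendsto_const[of B] tendsto_divide[OF exp_neg_tendsto_0[OF c] tendsto_const[of c]]] c by simp
    show "\<forall>\<^sub>F R in at_top. norm (integral {d..} f - integral {d..R} f) \<le> B * (exp (- c * R) / c)"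
      using eventually_ge_at_top[of d]
    proof eventually_elim
      case (elim R)
      have cR: "continuous_on {R..} f" by (rule continuous_on_subset[OF cont]) (use elim in auto)
      have bR: "norm (f x) \<le> B * exp (- c * x)" if "R \<le> x" for x
        using bound that elim by auto
      note R = exp_dominated_integral[OF cR c bR]
      have "f integrable_on {d..R}"
        by (rule integrable_continuous_real) (rule continuous_on_subset[OF cont], auto)
      then have "(f has_integral integral {d..R} f + integral {R..} f) ({d..R} \<union> {R..})"
        using R(1) by (intro has_integral_Un) (auto simp: has_integral_integral[symmetric]
            intro!: negligible_subset[OF negligible_sing[of R]])
      moreover have "{d..R} \<union> {R..} = {d..}" using elim by auto
      ultimately have "integral {d..} f = integral {d..R} f + integral {R..} f"
        by (simp add: integral_unique)
      then show ?case using R(2) by simp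
    qed
  qed
  then show ?thesis
    using tendsto_diff[OF tendsto_const[of "integral {d..} f"]] by fastforce
qed

section \<open>The contour and scalar Hankel integrals\<close>

definition hankel_contour :: "real \<Rightarrow> real \<Rightarrow> complex set" where
  "hankel_contour \<theta> \<delta> = {of_real r * cis \<psi> |r \<psi>. \<delta> \<le> r \<and> \<bar>\<psi>\<bar> = \<theta> \<or> r = \<delta> \<and> \<bar>\<psi>\<bar> \<le> \<theta>}"

text \<open>What \<open>hankel_integral\<close> becomes after pairing its \<open>L2\<close>-valued
  integrand with a fixed vector.\<close>

definition hankel :: "real \<Rightarrow> real \<Rightarrow> (complex \<Rightarrow> complex) \<Rightarrow> complex" where
  "hankel \<theta> \<delta> h =
     - integral {\<delta>..} (\<lambda>\<rho>. cis (- \<theta>) * h (of_real \<rho> * cis (- \<theta>)))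
     + integral {- \<theta>..\<theta>} (\<lambda>\<psi>. (\<i> * of_real \<delta> * cis \<psi>) * h (of_real \<delta> * cis \<psi>))
     + integral {\<delta>..} (\<lambda>\<rho>. cis \<theta> * h (of_real \<rho> * cis \<theta>))"

text \<open>One decay condition on the whole contour, arc included, controls all three pieces of the
  integral at once. The codomain is polymorphic because the same notion is applied to scalar
  integrands and to those with values in \<open>L2\<close>.\<close>

definition hankel_dominated ::
    "real \<Rightarrow> real \<Rightarrow> real \<Rightarrow> real \<Rightarrow> (complex \<Rightarrow> 'a::real_normed_vector) \<Rightarrow> bool" where
  "hankel_dominated \<theta> \<delta> c B h \<longleftrightarrow> continuous_on (hankel_contour \<theta> \<delta>) h \<and>
     (\<forall>z\<in>hankel_contour \<theta> \<delta>. norm (h z) \<le> B * exp (- c * cmod z))"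

lemma hankel_contour_ray [simp]:
  "0 \<le> \<theta> \<Longrightarrow> \<delta> \<le> \<rho> \<Longrightarrow> of_real \<rho> * cis \<theta> \<in> hankel_contour \<theta> \<delta>"
  "0 \<le> \<theta> \<Longrightarrow> \<delta> \<le> \<rho> \<Longrightarrow> of_real \<rho> * cis (- \<theta>) \<in> hankel_contour \<theta> \<delta>"
  unfolding hankel_contour_def by (blast intro: abs_of_nonneg abs_minus_cancel[THEN trans])+

lemma hankel_contour_arc [simp]:
  "- \<theta> \<le> \<psi> \<Longrightarrow> \<psi> \<le> \<theta> \<Longrightarrow> of_real \<delta> * cis \<psi> \<in> hankel_contour \<theta> \<delta>"
  unfolding hankel_contour_def by (auto simp: abs_le_iff) (metis minus_le_iff)

lemma hankel_dominated_rays: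
  fixes h :: "complex \<Rightarrow> 'a::banach"
  assumes h: "hankel_dominated \<theta> \<delta> c B h" and "0 \<le> \<theta>" "0 < \<delta>" "0 < c" "\<bar>\<psi>\<bar> = \<theta>"
  shows "continuous_on {\<delta>..} (\<lambda>\<rho>. h (of_real \<rho> * cis \<psi>))"
    and "\<And>\<rho>. \<delta> \<le> \<rho> \<Longrightarrow> norm (h (of_real \<rho> * cis \<psi>)) \<le> B * exp (- c * \<rho>)"
proof -
  have *: "\<delta> \<le> \<rho> \<Longrightarrow> of_real \<rho> * cis \<psi> \<in> hankel_contour \<theta> \<delta>" for \<rho>
    using assms(5) unfolding hankel_contour_def by blast
  have c: "continuous_on (hankel_contour \<theta> \<delta>) h" using h by (simp add: hankel_dominated_def)
  show "continuous_on {\<delta>..} (\<lambda>\<rho>. h (of_real \<rho> * cis \<psi>))"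
    by (rule continuous_on_compose2[OF c]) (auto intro!: continuous_intros *)
  show "norm (h (of_real \<rho> * cis \<psi>)) \<le> B * exp (- c * \<rho>)" if "\<delta> \<le> \<rho>" for \<rho>
    using *[OF that] h that \<open>0 < \<delta>\<close> by (force simp: hankel_dominated_def norm_mult)
qed

lemma hankel_dominated_arc:
  fixes h :: "complex \<Rightarrow> 'a::banach"
  assumes h: "hankel_dominated \<theta> \<delta> c B h" and "0 \<le> \<theta>" "0 < \<delta>" "0 < c"
  shows "continuous_on {- \<theta>..\<theta>} (\<lambda>\<psi>. h (of_real \<delta> * cis \<psi>))"
    and "\<And>\<psi>. \<bar>\<psi>\<bar> \<le> \<theta> \<Longrightarrow> norm (h (of_real \<delta> * cis \<psi>)) \<le> B"
proof -
  have c: "continuous_on (hankel_contour \<theta> \<delta>) h" using h by (simp add: hankel_dominated_def)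
  show "continuous_on {- \<theta>..\<theta>} (\<lambda>\<psi>. h (of_real \<delta> * cis \<psi>))"
    by (rule continuous_on_compose2[OF c]) (auto intro!: continuous_intros)
  show "norm (h (of_real \<delta> * cis \<psi>)) \<le> B" if "\<bar>\<psi>\<bar> \<le> \<theta>" for \<psi>
  proof -
    have "of_real \<delta> * cis \<psi> \<in> hankel_contour \<theta> \<delta>" using that by (intro hankel_contour_arc) auto
    then have *: "norm (h (of_real \<delta> * cis \<psi>)) \<le> B * exp (- c * \<delta>)"
      using h \<open>0 < \<delta>\<close> by (force simp: hankel_dominated_def norm_mult)
    then have "0 \<le> B * exp (- c * \<delta>)" by (rule order_trans[OF norm_ge_zero])
    then have "0 \<le> B" by (simp add: zero_le_mult_iff)
    then have "B * exp (- c * \<delta>) \<le> B * 1"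
      using assms by (intro mult_left_mono) auto
    then show ?thesis using * by simp
  qed
qed

text \<open>The integral of a non-integrable function is 0 by default, so additivity of
  \<open>hankel\<close> requires this as a side condition.\<close>

definition hankel_integrable :: "real \<Rightarrow> real \<Rightarrow> (complex \<Rightarrow> complex) \<Rightarrow> bool" where
  "hankel_integrable \<theta> \<delta> h \<longleftrightarrow>
     (\<lambda>\<rho>. cis (- \<theta>) * h (of_real \<rho> * cis (- \<theta>))) integrable_on {\<delta>..} \<and>
     (\<lambda>\<psi>. (\<i> * of_real \<delta> * cis \<psi>) * h (of_real \<delta> * cis \<psi>)) integrable_on {- \<theta>..\<theta>} \<and>
     (\<lambda>\<rho>. cis \<theta> * h (of_real \<rho> * cis \<theta>)) integrable_on {\<delta>..}"

lemma hankel_dominated_integrable: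
  fixes h :: "complex \<Rightarrow> complex"
  assumes h: "hankel_dominated \<theta> \<delta> c B h" and "0 \<le> \<theta>" "0 < \<delta>" "0 < c"
  shows "hankel_integrable \<theta> \<delta> h"
  unfolding hankel_integrable_def
proof (intro conjI)
  have c: "continuous_on {\<delta>..} (\<lambda>\<rho>. cis \<psi> * h (of_real \<rho> * cis \<psi>))"
    and b: "\<And>\<rho>. \<delta> \<le> \<rho> \<Longrightarrow> norm (cis \<psi> * h (of_real \<rho> * cis \<psi>)) \<le> B * exp (- c * \<rho>)"
    if "\<bar>\<psi>\<bar> = \<theta>" for \<psi>
    using hankel_dominated_rays[OF assms that] by (auto intro!: continuous_intros simp: norm_mult)
  have "(\<lambda>\<rho>. cis \<psi> * h (of_real \<rho> * cis \<psi>)) integrable_on {\<delta>..}" if "\<bar>\<psi>\<bar> = \<theta>" for \<psi>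
    by (rule exp_dominated_integral(1)[OF c[OF that] \<open>0 < c\<close> b[OF that]])
  then show "(\<lambda>\<rho>. cis (- \<theta>) * h (of_real \<rho> * cis (- \<theta>))) integrable_on {\<delta>..}"
    "(\<lambda>\<rho>. cis \<theta> * h (of_real \<rho> * cis \<theta>)) integrable_on {\<delta>..}"
    using assms(2) by auto
  show "(\<lambda>\<psi>. (\<i> * of_real \<delta> * cis \<psi>) * h (of_real \<delta> * cis \<psi>)) integrable_on {- \<theta>..\<theta>}"
    by (intro integrable_continuous_real continuous_intros hankel_dominated_arc(1)[OF assms])
qed

text \<open>Each ray contributes at most B / c, the factor exp (- c \<delta>) being dropped; the arc
  has length 2 \<theta> \<delta>, and the integrand there is at most B.\<close>

lemma norm_hankel_le:
  fixes h :: "complex \<Rightarrow> complex"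
  assumes h: "hankel_dominated \<theta> \<delta> c B h" and "0 \<le> \<theta>" "0 < \<delta>" "0 < c"
  shows "norm (hankel \<theta> \<delta> h) \<le> B * (2 / c + 2 * \<theta> * \<delta>)"
proof -
  have B: "0 \<le> B"
    using hankel_dominated_arc(2)[OF assms, of 0] assms(2) by (auto intro: order_trans[OF norm_ge_zero])
  have ray: "norm (integral {\<delta>..} (\<lambda>\<rho>. cis \<psi> * h (of_real \<rho> * cis \<psi>))) \<le> B * (1 / c)"
    if "\<bar>\<psi>\<bar> = \<theta>" for \<psi>
  proof -
    have "norm (integral {\<delta>..} (\<lambda>\<rho>. cis \<psi> * h (of_real \<rho> * cis \<psi>))) \<le> B * (exp (- c * \<delta>) / c)"
      using hankel_dominated_rays[OF assms that] \<open>0 < c\<close>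
      by (intro exp_dominated_integral(2)) (auto intro!: continuous_intros simp: norm_mult)
    also have "\<dots> \<le> B * (1 / c)"
      using assms B by (intro mult_left_mono divide_right_mono) auto
    finally show ?thesis .
  qed
  have arc: "norm (integral {- \<theta>..\<theta>} (\<lambda>\<psi>. (\<i> * of_real \<delta> * cis \<psi>) * h (of_real \<delta> * cis \<psi>)))
      \<le> (\<delta> * B) * (\<theta> - (- \<theta>))"
    using assms hankel_dominated_arc[OF assms]
    by (intro integral_bound) (auto intro!: continuous_intros mult_left_mono simp: norm_mult abs_le_iff)
  have "norm (hankel \<theta> \<delta> h) \<le> B * (1 / c) + (\<delta> * B) * (\<theta> - (- \<theta>)) + B * (1 / c)"
    unfolding hankel_def
    by (intro norm_triangle_le add_mono arc)
       (use ray[of \<theta>] ray[of "- \<theta>"] arc assms(2) in \<open>auto simp: norm_minus_cancel\<close>)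
  then show ?thesis by (simp add: algebra_simps add_divide_distrib[symmetric])
qed

lemma hankel_diff:
  assumes "hankel_integrable \<theta> \<delta> h" "hankel_integrable \<theta> \<delta> k"
  shows "hankel \<theta> \<delta> (\<lambda>z. h z - k z) = hankel \<theta> \<delta> h - hankel \<theta> \<delta> k"
    and "hankel_integrable \<theta> \<delta> (\<lambda>z. h z - k z)"
  using assms unfolding hankel_integrable_def hankel_def
  by (simp_all add: right_diff_distrib Henstock_Kurzweil_Integration.integral_diff integrable_diff)

lemma hankel_cmult:
  shows "hankel \<theta> \<delta> (\<lambda>z. c * h z) = c * hankel \<theta> \<delta> h"
    and "hankel_integrable \<theta> \<delta> h \<Longrightarrow> hankel_integrable \<theta> \<delta> (\<lambda>z. c * h z)"
proof -
  have comm: "(\<lambda>x. p x * (c * q x)) = (\<lambda>x. c * (p x * q x))" for p q :: "real \<Rightarrow> complex"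
    by (simp add: mult.left_commute)
  show "hankel \<theta> \<delta> (\<lambda>z. c * h z) = c * hankel \<theta> \<delta> h"
    unfolding hankel_def
    by (simp only: comm integral_mult_right) (simp add: algebra_simps)
  show "hankel_integrable \<theta> \<delta> h \<Longrightarrow> hankel_integrable \<theta> \<delta> (\<lambda>z. c * h z)"
    unfolding hankel_integrable_def
    by (simp only: comm) (intro conjI integrable_on_mult_right, simp_all)
qed

lemma exp_Complex_ln: "0 < r \<Longrightarrow> exp (Complex (ln r) \<psi>) = of_real r * cis \<psi>"
  by (simp add: exp_eq_polar)

text \<open>In the coordinate \<open>w = ln z\<close> the sector becomes a convex strip, where the integrand has a primitive.\<close>

lemma hankel_shift:
  fixes h :: "complex \<Rightarrow> complex"
  assumes hol: "(\<lambda>w. h (exp w)) holomorphic_on {w. \<bar>Im w\<bar> < \<Theta>}"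
    and th: "0 < \<theta>1" "\<theta>1 \<le> \<theta>2" "\<theta>2 < \<Theta>" and del: "0 < \<delta>1" "0 < \<delta>2" and c: "0 < c"
    and decay: "\<And>d. 0 < d \<Longrightarrow> \<exists>B. \<forall>r \<psi>. d \<le> r \<longrightarrow> \<theta>1 \<le> \<bar>\<psi>\<bar> \<longrightarrow> \<bar>\<psi>\<bar> \<le> \<theta>2 \<longrightarrow>
                  norm (h (of_real r * cis \<psi>)) \<le> B * exp (- c * r)"
  shows "hankel \<theta>1 \<delta>1 h = hankel \<theta>2 \<delta>2 h"
proof -
  define S where "S = {w::complex. \<bar>Im w\<bar> < \<Theta>}"
  have S: "S = {w. Im w < \<Theta>} \<inter> {w. - \<Theta> < Im w}" by (auto simp: S_def)
  have "convex S" "open S"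
    unfolding S by (auto intro!: convex_Int open_Int convex_halfspace_Im_lt convex_halfspace_Im_gt
        open_halfspace_Im_lt open_halfspace_Im_gt)
  have "(\<lambda>w. h (exp w) * exp w) holomorphic_on S"
    using hol unfolding S_def by (intro holomorphic_intros)
  then obtain P where P: "\<And>w. w \<in> S \<Longrightarrow> (P has_field_derivative h (exp w) * exp w) (at w within S)"
    using holomorphic_convex_primitive'[OF \<open>convex S\<close> \<open>open S\<close>] by blast
  have P: "(P has_field_derivative h (exp w) * exp w) (at w)" if "w \<in> S" for w
    using P[OF that] at_within_open[OF that \<open>open S\<close>] by simp
  \<comment> \<open>The primitive in polar coordinates: its derivative in r is the integrand of a
    ray, its derivative in \<psi> the integrand of an arc.\<close>
  define Q where "Q r \<psi> = P (Complex (ln r) \<psi>)" for r \<psi>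
  have dr: "((\<lambda>r. Q r \<psi>) has_vector_derivative cis \<psi> * h (of_real r * cis \<psi>)) (at r)"
    if "0 < r" "\<bar>\<psi>\<bar> < \<Theta>" for r \<psi>
  proof -
    have "((\<lambda>r. Complex (ln r) \<psi>) has_vector_derivative of_real (1 / r)) (at r)"
      unfolding Complex_eq using that
      by (auto intro!: derivative_eq_intros has_vector_derivative_real_field
          simp: has_real_derivative_iff_has_vector_derivative[symmetric] divide_inverse)
    from field_vector_diff_chain_at[OF this P] that
    have "((P \<circ> (\<lambda>r. Complex (ln r) \<psi>)) has_vector_derivative
        of_real (1 / r) * (h (of_real r * cis \<psi>) * (of_real r * cis \<psi>))) (at r)"
      by (simp add: S_def exp_Complex_ln)
    then show ?thesis using that by (simp add: Q_def o_def field_simps)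
  qed
  have d\<psi>: "((\<lambda>\<psi>. Q r \<psi>) has_vector_derivative (\<i> * of_real r * cis \<psi>) * h (of_real r * cis \<psi>)) (at \<psi>)"
    if "0 < r" "\<bar>\<psi>\<bar> < \<Theta>" for r \<psi>
  proof -
    have "((\<lambda>\<psi>. Complex (ln r) \<psi>) has_vector_derivative \<i>) (at \<psi>)"
      unfolding Complex_eq
      by (auto intro!: derivative_eq_intros simp: has_vector_derivative_def scaleR_conv_of_real mult_ac)
    from field_vector_diff_chain_at[OF this P] that
    have "((P \<circ> (\<lambda>\<psi>. Complex (ln r) \<psi>)) has_vector_derivative
        \<i> * (h (of_real r * cis \<psi>) * (of_real r * cis \<psi>))) (at \<psi>)"
      by (simp add: S_def exp_Complex_ln)
    then show ?thesis by (simp add: Q_def o_def mult_ac)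
  qed
  have ray: "((\<lambda>\<rho>. cis \<psi> * h (of_real \<rho> * cis \<psi>)) has_integral Q R \<psi> - Q d \<psi>) {d..R}"
    if "0 < d" "d \<le> R" "\<bar>\<psi>\<bar> < \<Theta>" for d R \<psi>
  proof (rule fundamental_theorem_of_calculus[where f = "\<lambda>r. Q r \<psi>", OF that(2)])
    fix r assume "r \<in> {d..R}"
    then show "((\<lambda>r. Q r \<psi>) has_vector_derivative cis \<psi> * h (of_real r * cis \<psi>)) (at r within {d..R})"
      using that by (intro has_vector_derivative_at_within[OF dr]) auto
  qed
  have arc: "((\<lambda>\<psi>. (\<i> * of_real r * cis \<psi>) * h (of_real r * cis \<psi>)) has_integral Q r v - Q r u) {u..v}"
    if "0 < r" "u \<le> v" "- \<Theta> < u" "v < \<Theta>" for r u v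
  proof (rule fundamental_theorem_of_calculus[where f = "\<lambda>\<psi>. Q r \<psi>", OF that(2)])
    fix \<psi> assume "\<psi> \<in> {u..v}"
    then show "((\<lambda>\<psi>. Q r \<psi>) has_vector_derivative (\<i> * of_real r * cis \<psi>) * h (of_real r * cis \<psi>))
        (at \<psi> within {u..v})"
      using that by (intro has_vector_derivative_at_within[OF d\<psi>]) auto
  qed
  have cont: "continuous_on {d..} (\<lambda>\<rho>. cis \<psi> * h (of_real \<rho> * cis \<psi>))"
    if "0 < d" "\<bar>\<psi>\<bar> < \<Theta>" for d \<psi>
  proof -
    have "continuous_on S (\<lambda>w. h (exp w))"
      using hol unfolding S_def by (rule holomorphic_on_imp_continuous_on)
    then have "continuous_on {d..} (\<lambda>\<rho>. h (exp (Complex (ln \<rho>) \<psi>)))"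
      by (rule continuous_on_compose2)
         (use that in \<open>auto simp: S_def Complex_eq intro!: continuous_intros\<close>)
    then have "continuous_on {d..} (\<lambda>\<rho>. cis \<psi> * h (exp (Complex (ln \<rho>) \<psi>)))"
      by (intro continuous_intros)
    then show ?thesis
      by (rule continuous_on_eq) (use that in \<open>auto simp: exp_Complex_ln\<close>)
  qed
  \<comment> \<open>The values of Q at the inner radius cancel between the rays and the arc. What
    remains is the increment of the primitive between the far ends of the two rays, which no longer
    mentions \<delta>.\<close>
  have tend: "((\<lambda>R. Q R \<theta> - Q R (- \<theta>)) \<longlongrightarrow> hankel \<theta> \<delta> h) at_top"
    if \<delta>: "0 < \<delta>" and \<theta>: "\<theta>1 \<le> \<theta>" "\<theta> \<le> \<theta>2" for \<theta> \<delta>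
  proof -
    obtain B where B: "\<And>r \<psi>. \<delta> \<le> r \<Longrightarrow> \<theta>1 \<le> \<bar>\<psi>\<bar> \<Longrightarrow> \<bar>\<psi>\<bar> \<le> \<theta>2 \<Longrightarrow>
        norm (h (of_real r * cis \<psi>)) \<le> B * exp (- c * r)"
      using decay[OF \<delta>] by blast
    have r: "((\<lambda>R. Q R \<psi> - Q \<delta> \<psi>) \<longlongrightarrow> integral {\<delta>..} (\<lambda>\<rho>. cis \<psi> * h (of_real \<rho> * cis \<psi>))) at_top"
      if "\<bar>\<psi>\<bar> = \<theta>" for \<psi>
    proof -
      have psi: "\<bar>\<psi>\<bar> < \<Theta>" "\<theta>1 \<le> \<bar>\<psi>\<bar>" "\<bar>\<psi>\<bar> \<le> \<theta>2"
        using that \<open>\<theta>1 \<le> \<theta>\<close> \<open>\<theta> \<le> \<theta>2\<close> th by auto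
      have "((\<lambda>R. integral {\<delta>..R} (\<lambda>\<rho>. cis \<psi> * h (of_real \<rho> * cis \<psi>))) \<longlongrightarrow>
          integral {\<delta>..} (\<lambda>\<rho>. cis \<psi> * h (of_real \<rho> * cis \<psi>))) at_top"
        by (rule exp_dominated_integral_tendsto[OF cont[OF \<open>0 < \<delta>\<close> psi(1)] c])
           (use B psi in \<open>auto simp: norm_mult\<close>)
      moreover have "\<forall>\<^sub>F R in at_top. integral {\<delta>..R} (\<lambda>\<rho>. cis \<psi> * h (of_real \<rho> * cis \<psi>)) = Q R \<psi> - Q \<delta> \<psi>"
        using eventually_ge_at_top[of \<delta>]
        by eventually_elim (rule integral_unique[OF ray], use \<open>0 < \<delta>\<close> psi in auto)
      ultimately show ?thesis by (rule Lim_transform_eventually)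
    qed
    have "integral {- \<theta>..\<theta>} (\<lambda>\<psi>. (\<i> * of_real \<delta> * cis \<psi>) * h (of_real \<delta> * cis \<psi>)) = Q \<delta> \<theta> - Q \<delta> (- \<theta>)"
      by (rule integral_unique[OF arc]) (use \<theta> \<delta> th in auto)
    moreover have "((\<lambda>R. - (Q R (- \<theta>) - Q \<delta> (- \<theta>)) + (Q \<delta> \<theta> - Q \<delta> (- \<theta>)) + (Q R \<theta> - Q \<delta> \<theta>)) \<longlongrightarrow>
       - integral {\<delta>..} (\<lambda>\<rho>. cis (- \<theta>) * h (of_real \<rho> * cis (- \<theta>))) + (Q \<delta> \<theta> - Q \<delta> (- \<theta>)) +
         integral {\<delta>..} (\<lambda>\<rho>. cis \<theta> * h (of_real \<rho> * cis \<theta>))) at_top"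
      by (intro tendsto_intros r) (use \<theta> \<delta> th in auto)
    ultimately show ?thesis unfolding hankel_def by simp
  qed
  obtain B where B: "\<And>r \<psi>. 1 \<le> r \<Longrightarrow> \<theta>1 \<le> \<bar>\<psi>\<bar> \<Longrightarrow> \<bar>\<psi>\<bar> \<le> \<theta>2 \<Longrightarrow>
        norm (h (of_real r * cis \<psi>)) \<le> B * exp (- c * r)"
    using decay[of 1] by auto
  \<comment> \<open>The far arcs joining the two angles: their length grows like R, and half of the
    decay rate absorbs this growth.\<close>
  have arc0: "((\<lambda>R. Q R v - Q R u) \<longlongrightarrow> 0) at_top"
    if uv: "u \<le> v" "- \<Theta> < u" "v < \<Theta>" "\<And>x. x \<in> {u..v} \<Longrightarrow> \<theta>1 \<le> \<bar>x\<bar> \<and> \<bar>x\<bar> \<le> \<theta>2" for u v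
  proof -
    define K where "K = 2 / c"
    have K: "0 < K" "R \<le> K * exp (c / 2 * R)" if "0 \<le> R" for R
      using power_le_exp[of "c / 2" R 1] that c by (simp_all add: K_def)
    have "((\<lambda>R. \<bar>B\<bar> * K * exp (- (c / 2) * R) * (v - u)) \<longlongrightarrow> \<bar>B\<bar> * K * 0 * (v - u)) at_top"
      by (intro tendsto_intros exp_neg_tendsto_0) (use c in simp)
    then have lim: "((\<lambda>R. \<bar>B\<bar> * K * exp (- (c / 2) * R) * (v - u)) \<longlongrightarrow> 0) at_top" by simp
    have "\<forall>\<^sub>F R in at_top. norm (Q R v - Q R u) \<le> \<bar>B\<bar> * K * exp (- (c / 2) * R) * (v - u)"
      using eventually_ge_at_top[of 1]
    proof eventually_elim
      case (elim R)
      have i: "((\<lambda>\<psi>. (\<i> * of_real R * cis \<psi>) * h (of_real R * cis \<psi>)) has_integral Q R v - Q R u) {u..v}"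
        by (rule arc) (use elim uv in auto)
      have "norm (Q R v - Q R u) \<le> (\<bar>B\<bar> * K * exp (- (c / 2) * R)) * Henstock_Kurzweil_Integration.content (cbox u v)"
      proof (rule has_integral_bound[OF _ i[unfolded cbox_interval[symmetric]]])
        show "0 \<le> \<bar>B\<bar> * K * exp (- (c / 2) * R)" using K(1)[of 0] by simp
        fix x assume "x \<in> cbox u v"
        then have "norm (h (of_real R * cis x)) \<le> B * exp (- c * R)"
          using B elim uv(4)[of x] by auto
        also have "\<dots> \<le> \<bar>B\<bar> * exp (- c * R)" by (intro mult_right_mono) auto
        finally have "R * norm (h (of_real R * cis x)) \<le> R * (\<bar>B\<bar> * exp (- c * R))"
          using elim by (intro mult_left_mono) auto
        also have "\<dots> \<le> (K * exp (c / 2 * R)) * (\<bar>B\<bar> * exp (- c * R))"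
          using K(2)[of R] elim by (intro mult_right_mono) auto
        also have "\<dots> = \<bar>B\<bar> * K * (exp (c / 2 * R) * exp (- c * R))" by simp
        also have "exp (c / 2 * R) * exp (- c * R) = exp (- (c / 2) * R)"
          by (simp add: exp_add[symmetric] field_simps)
        finally show "norm (\<i> * of_real R * cis x * h (of_real R * cis x)) \<le> \<bar>B\<bar> * K * exp (- (c / 2) * R)"
          using elim by (simp add: norm_mult)
      qed
      then show ?case using uv by simp
    qed
    then show ?thesis by (rule Lim_null_comparison) (rule lim)
  qed
  have "((\<lambda>R. (Q R \<theta>2 - Q R (- \<theta>2)) - (Q R \<theta>2 - Q R \<theta>1) - (Q R (- \<theta>1) - Q R (- \<theta>2)))
       \<longlongrightarrow> hankel \<theta>2 \<delta>2 h - 0 - 0) at_top"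
    by (intro tendsto_diff tend arc0) (use th del in auto)
  then have "((\<lambda>R. Q R \<theta>1 - Q R (- \<theta>1)) \<longlongrightarrow> hankel \<theta>2 \<delta>2 h) at_top" by simp
  moreover have "((\<lambda>R. Q R \<theta>1 - Q R (- \<theta>1)) \<longlongrightarrow> hankel \<theta>1 \<delta>1 h) at_top"
    by (rule tend) (use th del in auto)
  ultimately show ?thesis by (rule tendsto_unique[OF trivial_limit_at_top_linorder, rotated])
qed

section \<open>Decay along the rays and entire integrands\<close>

lemma cos_neg: "pi / 2 < \<theta> \<Longrightarrow> \<theta> \<le> pi \<Longrightarrow> cos \<theta> < 0"
  using cos_monotone_0_pi[of "pi / 2" \<theta>] by simp

lemma cos_mono_abs:
  assumes "\<theta> \<le> \<bar>\<psi>\<bar>" "\<bar>\<psi>\<bar> \<le> pi" "0 \<le> \<theta>"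
  shows "cos \<psi> \<le> cos \<theta>"
  using cos_monotone_0_pi_le[of \<theta> "\<bar>\<psi>\<bar>"] assms by simp

lemma norm_exp_ray:
  assumes "0 \<le> r" "0 \<le> t" "\<theta> \<le> \<bar>\<psi>\<bar>" "\<bar>\<psi>\<bar> \<le> pi" "0 \<le> \<theta>"
  shows "norm (exp (of_real r * cis \<psi> * of_real t)) \<le> exp (cos \<theta> * t * r)"
proof -
  have "norm (exp (of_real r * cis \<psi> * of_real t)) = exp (r * t * cos \<psi>)"
    by (simp add: mult_ac)
  also have "\<dots> \<le> exp (r * t * cos \<theta>)"
    using cos_mono_abs[OF assms(3-5)] assms by (simp add: mult_left_mono)
  finally show ?thesis by (simp add: mult_ac)
qed

text \<open>At the angle \<open>\<pi>\<close> the two rays cancel, and the remaining circle shrinks to a point.\<close>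

lemma hankel_power_exp_eq_0:
  assumes "pi / 2 < \<theta>" "\<theta> \<le> pi" "0 < \<delta>" "0 < t"
  shows "hankel \<theta> \<delta> (\<lambda>z. z ^ n * exp (z * of_real t)) = 0" (is "hankel \<theta> \<delta> ?h = 0")
proof -
  have c: "0 < - cos \<theta>" using cos_neg[OF assms(1,2)] by simp
  have c': "0 < - cos \<theta> * t / 2" using c assms by (simp add: mult_neg_pos)
  \<comment> \<open>Half of the decay rate - cos \<theta> * t is given up to absorb the power of
    r.\<close>
  define K where "K = fact n / (- cos \<theta> * t / 2) ^ n"
  have K: "0 < K" "\<And>r. 0 \<le> r \<Longrightarrow> r ^ n \<le> K * exp (- cos \<theta> * t / 2 * r)"
    using c' power_le_exp[OF c'] by (simp_all add: K_def)
  have bound: "norm (?h (of_real r * cis \<psi>)) \<le> K * exp (- (- cos \<theta> * t / 2) * r)"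
    if "0 < r" "\<theta> \<le> \<bar>\<psi>\<bar>" "\<bar>\<psi>\<bar> \<le> pi" for r \<psi>
  proof -
    have "norm (?h (of_real r * cis \<psi>)) = r ^ n * norm (exp (of_real r * cis \<psi> * of_real t))"
      using that by (simp add: norm_mult norm_power)
    also have "\<dots> \<le> (K * exp (- cos \<theta> * t / 2 * r)) * exp (cos \<theta> * t * r)"
      using that assms K(1) K(2)[of r] by (intro mult_mono norm_exp_ray) auto
    also have "\<dots> = K * exp (- (- cos \<theta> * t / 2) * r)"
      by (simp add: exp_add[symmetric] mult.assoc)
    finally show ?thesis .
  qed
  have shift: "hankel \<theta> \<delta> ?h = hankel pi \<epsilon> ?h" if "0 < \<epsilon>" for \<epsilon>
  \<comment> \<open>The integrand is entire, so every strip containing the angle pi is admissible; 4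
    is just a number above pi.\<close>
  proof (rule hankel_shift[where \<Theta> = 4 and c = "- cos \<theta> * t / 2"])
    show "(\<lambda>w. exp w ^ n * exp (exp w * of_real t)) holomorphic_on {w. \<bar>Im w\<bar> < 4}"
      by (intro holomorphic_intros)
    show "0 < \<theta>" using assms pi_gt_zero by linarith
    show "0 < - cos \<theta> * t / 2" by (rule c')
    show "\<exists>B. \<forall>r \<psi>. d \<le> r \<longrightarrow> \<theta> \<le> \<bar>\<psi>\<bar> \<longrightarrow> \<bar>\<psi>\<bar> \<le> pi \<longrightarrow>
        norm (?h (of_real r * cis \<psi>)) \<le> B * exp (- (- cos \<theta> * t / 2) * r)" if "0 < d" for d
      using bound that by (intro exI[of _ K] allI impI) auto
  qed (use assms that pi_less_4 in auto)
  have le: "norm (hankel \<theta> \<delta> ?h) \<le> \<epsilon> * (exp t * (2 * pi))" if "0 < \<epsilon>" "\<epsilon> \<le> 1" for \<epsilon>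
  proof -
    have "hankel pi \<epsilon> ?h =
        integral {- pi..pi} (\<lambda>\<psi>. (\<i> * of_real \<epsilon> * cis \<psi>) * ?h (of_real \<epsilon> * cis \<psi>))"
      by (simp add: hankel_def cis.ctr)
    also have "norm \<dots> \<le> (\<epsilon> * exp t) * (pi - (- pi))"
    proof (rule integral_bound)
      show "continuous_on {- pi..pi} (\<lambda>\<psi>. (\<i> * of_real \<epsilon> * cis \<psi>) * ?h (of_real \<epsilon> * cis \<psi>))"
        by (intro continuous_intros)
      fix \<psi> :: real
      have "norm (?h (of_real \<epsilon> * cis \<psi>)) \<le> 1 * exp (\<epsilon> * t)"
        unfolding norm_mult norm_power using that assms
        by (intro mult_mono) (auto simp: power_le_one norm_mult mult_le_cancel_left1)
      also have "\<dots> \<le> exp t" using that assms by simp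
      finally show "norm ((\<i> * of_real \<epsilon> * cis \<psi>) * ?h (of_real \<epsilon> * cis \<psi>)) \<le> \<epsilon> * exp t"
        using that by (simp add: norm_mult)
    qed auto
    finally show ?thesis using shift[OF that(1)] by (simp add: algebra_simps)
  qed
  have "((\<lambda>\<epsilon>. \<epsilon> * (exp t * (2 * pi))) \<longlongrightarrow> 0 * (exp t * (2 * pi))) (at_right 0)"
    by (intro tendsto_intros)
  then have "norm (hankel \<theta> \<delta> ?h) \<le> 0 * (exp t * (2 * pi))"
    by (rule tendsto_lowerbound)
       (use le in \<open>auto intro!: eventually_at_rightI[of 0 1]\<close>)
  then show ?thesis by simp
qed

text \<open>The sum lies in the cone spanned by 1 and \<open>cis \<psi>\<close>, so its argument is
  between 0 and \<psi>.\<close>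

lemma one_plus_polar:
  assumes "0 \<le> \<psi>" "\<psi> < pi" "0 \<le> r"
  obtains R \<eta> where "0 < R" "0 \<le> \<eta>" "\<eta> \<le> \<psi>" "1 + of_real r * cis \<psi> = of_real R * cis \<eta>"
proof -
  define w where "w = 1 + of_real r * cis \<psi>"
  have im: "Im w = r * sin \<psi>" "Re w = 1 + r * cos \<psi>" by (simp_all add: w_def)
  have sin: "0 \<le> sin \<psi>" using assms by (simp add: sin_ge_zero)
  have w0: "w \<noteq> 0"
  proof
    assume "w = 0"
    then have *: "r * sin \<psi> = 0" "1 + r * cos \<psi> = 0" using im by auto
    then have "sin \<psi> = 0" by auto
    then have "\<psi> = 0" using assms sin_gt_zero[of \<psi>] by force
    then show False using * assms by simp
  qed
  have Arg: "w = of_real (cmod w) * cis (Arg2pi w)"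
    using Arg2pi_eq[of w] by (simp add: cis_conv_exp)
  have "0 \<le> Im w" using im sin assms by simp
  then have A0: "0 \<le> Arg2pi w" "Arg2pi w \<le> pi" using Arg2pi_ge_0 Arg2pi_le_pi by auto
  have "Arg2pi w \<le> \<psi>"
  proof (rule ccontr)
    assume "\<not> ?thesis"
    then have lt: "\<psi> < Arg2pi w" by simp
    \<comment> \<open>After rotation by - \<psi> an argument beyond \<psi> would give a nonnegative
      imaginary part, but that part is - sin \<psi>. Only sin \<psi> = 0 survives, and there w is a
      positive real with argument 0.\<close>
    have "Im (w * cis (- \<psi>)) = - sin \<psi>"
      by (simp add: w_def algebra_simps)
    moreover have "w * cis (- \<psi>) = of_real (cmod w) * cis (Arg2pi w - \<psi>)"
      by (subst Arg) (simp add: cis_mult mult.assoc)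
    ultimately have *: "cmod w * sin (Arg2pi w - \<psi>) = - sin \<psi>" by simp
    have "0 \<le> cmod w * sin (Arg2pi w - \<psi>)"
      using lt A0 assms by (intro mult_nonneg_nonneg sin_ge_zero) auto
    then have "sin \<psi> = 0" using * sin by simp
    then have psi: "\<psi> = 0" using assms sin_gt_zero[of \<psi>] by force
    then have "w = of_real (1 + r)" by (simp add: w_def)
    then have "Arg2pi w = 0" using assms by (simp only: Arg2pi_of_real) auto
    then show False using lt psi by simp
  qed
  with A0 w0 show ?thesis
    by (intro that[of "cmod w" "Arg2pi w"], unfold w_def[symmetric]) (simp_all add: Arg[symmetric])
qed

text \<open>The squared norm is R^2 + l^2 + 2 R l cos \<eta>. Writing cos \<omega> through the half
  angle, its excess over the square of the left side is at least sin^2 (\<omega> / 2) (R - l)^2.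
  Equality occurs for R = l and \<eta> = \<omega>, so the constant is sharp.\<close>

lemma sector_add_norm_ge:
  assumes "\<bar>\<eta>\<bar> \<le> \<omega>" "\<omega> \<le> pi" "0 \<le> R" "0 \<le> l"
  shows "cos (\<omega> / 2) * (R + l) \<le> norm (of_real R * cis \<eta> + of_real l)"
proof (rule power2_le_imp_le)
  have c: "cos \<omega> \<le> cos \<eta>" using cos_monotone_0_pi_le[of "\<bar>\<eta>\<bar>" \<omega>] assms by simp
  have d: "cos \<omega> = 2 * (cos (\<omega> / 2))\<^sup>2 - 1" using cos_double_cos[of "\<omega> / 2"] by simp
  have "(cos (\<omega> / 2))\<^sup>2 \<le> 1" by (simp add: abs_square_le_1)
  then have "0 \<le> (1 - (cos (\<omega> / 2))\<^sup>2) * (R - l)\<^sup>2" by simp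
  then have "(cos (\<omega> / 2) * (R + l))\<^sup>2 \<le> R\<^sup>2 + l\<^sup>2 + 2 * R * l * cos \<omega>"
    unfolding d by (simp add: power2_eq_square algebra_simps)
  also have "\<dots> \<le> R\<^sup>2 + l\<^sup>2 + 2 * R * l * cos \<eta>"
    using c assms by (simp add: mult_left_mono)
  also have "\<dots> = (norm (of_real R * cis \<eta> + of_real l))\<^sup>2"
  proof -
    have "(norm (of_real R * cis \<eta> + of_real l))\<^sup>2 = (R * cos \<eta> + l)\<^sup>2 + (R * sin \<eta>)\<^sup>2"
      by (simp add: cmod_power2)
    also have "\<dots> = R\<^sup>2 * ((sin \<eta>)\<^sup>2 + (cos \<eta>)\<^sup>2) + l\<^sup>2 + 2 * R * l * cos \<eta>"
      by algebra
    finally show ?thesis by (simp only: sin_cos_squared_add mult_1_right)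
  qed
  finally show "(cos (\<omega> / 2) * (R + l))\<^sup>2 \<le> (norm (of_real R * cis \<eta> + of_real l))\<^sup>2" .
qed auto

section \<open>The symbol of the solution operator\<close>

definition sector :: "real \<Rightarrow> complex set" where
  "sector \<theta> = {of_real r * cis \<psi> |r \<psi>. 0 < r \<and> \<bar>\<psi>\<bar> \<le> \<theta>}"

lemma sectorE:
  assumes "z \<in> sector \<theta>"
  obtains r \<psi> where "z = of_real r * cis \<psi>" "0 < r" "\<bar>\<psi>\<bar> \<le> \<theta>" "cmod z = r"
  using assms unfolding sector_def by (auto simp: norm_mult)

lemma hankel_contourE:
  assumes "z \<in> hankel_contour \<theta> \<delta>" "0 \<le> \<theta>"
  obtains r \<psi> where "z = of_real r * cis \<psi>" "\<delta> \<le> r" "\<bar>\<psi>\<bar> \<le> \<theta>" "\<bar>\<psi>\<bar> = \<theta> \<or> r = \<delta>"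
  using assms unfolding hankel_contour_def by auto

lemma hankel_contour_sector:
  assumes "z \<in> hankel_contour \<theta> \<delta>" "0 \<le> \<theta>" "0 < \<delta>"
  shows "z \<in> sector \<theta>" "\<delta> \<le> cmod z"
  using assms(3) by (force intro: hankel_contourE[OF assms(1,2)] simp: sector_def norm_mult)+

text \<open>On the arc the real part of z may be positive, so the decay valid on the rays fails
  there. The factor exp (2 t \<delta>) repairs this, since cos \<psi> \<le> 1 \<le> 2 + cos
  \<theta>; for \<delta> = 1 / t it is the harmless constant exp 2.\<close>

lemma norm_exp_hankel_contour:
  assumes z: "z \<in> hankel_contour \<theta> \<delta>" and "0 \<le> \<theta>" "\<theta> \<le> pi" "0 < \<delta>" "0 \<le> t"
  shows "norm (exp (z * of_real t)) \<le> exp (2 * t * \<delta>) * exp (cos \<theta> * t * cmod z)"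
proof -
  obtain r \<psi> where r: "z = of_real r * cis \<psi>" "\<delta> \<le> r" "\<bar>\<psi>\<bar> = \<theta> \<or> r = \<delta>"
    using z \<open>0 \<le> \<theta>\<close> by (rule hankel_contourE)
  have nz: "cmod z = r" using r assms by (simp add: norm_mult)
  show ?thesis
  proof (cases "\<bar>\<psi>\<bar> = \<theta>")
    case True
    have "norm (exp (z * of_real t)) \<le> 1 * exp (cos \<theta> * t * r)"
      unfolding r(1) using norm_exp_ray[of r t \<theta> \<psi>] True assms r by simp
    also have "\<dots> \<le> exp (2 * t * \<delta>) * exp (cos \<theta> * t * r)"
      using assms by (intro mult_right_mono) auto
    finally show ?thesis by (simp add: nz)
  next
    case False
    then have "r = \<delta>" using r by simp
    have "norm (exp (z * of_real t)) = exp (\<delta> * t * cos \<psi>)"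
      using r \<open>r = \<delta>\<close> by (simp add: mult_ac)
    also have "\<delta> * t * cos \<psi> \<le> \<delta> * t * (2 + cos \<theta>)"
      using assms cos_le_one[of \<psi>] cos_ge_minus_one[of \<theta>]
      by (intro mult_left_mono) (linarith, simp)
    also have "exp (\<delta> * t * (2 + cos \<theta>)) = exp (2 * t * \<delta>) * exp (cos \<theta> * t * cmod z)"
      by (simp add: exp_add[symmetric] nz \<open>r = \<delta>\<close> algebra_simps)
    finally show ?thesis by simp
  qed
qed

text \<open>The factor exp 2 pays for the arc at radius 1 / t, and \<open>powr_exp_const\<close> for
  trading |z|^p against half of the decay. The last factor is t times 2 / c + 2 \<theta> \<delta>
  from \<open>norm_hankel_le\<close>, taken at c = - cos \<theta> * t / 2 and \<delta> = 1 /
  t.\<close>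

definition hankel_const :: "real \<Rightarrow> real \<Rightarrow> real" where
  "hankel_const \<theta> p = exp 2 * powr_exp_const p (- cos \<theta> / 2) * (4 / (- cos \<theta>) + 2 * \<theta>)"

lemma hankel_const_pos:
  assumes "pi / 2 < \<theta>" "\<theta> \<le> pi"
  shows "0 < hankel_const \<theta> p"
proof -
  have "0 < \<theta>" using assms pi_gt_zero by linarith
  moreover have "cos \<theta> < 0" using cos_neg assms by simp
  ultimately show ?thesis
    unfolding hankel_const_def powr_exp_const_def
    by (intro mult_pos_pos add_pos_pos divide_pos_pos) auto
qed

text \<open>This is the substitution z = w / t, done through inequalities. With radius 1 / t one has
  |z| t \<ge> 1, and |z|^p equals t^(-p) times (|z| t)^p, whose bound is free of t; the line element
  yields one more factor 1 / t.\<close>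

lemma hankel_scaling_bound:
  assumes th: "pi / 2 < \<theta>" "\<theta> \<le> pi" and t: "0 < t" and B: "0 \<le> B"
    and cont: "continuous_on (hankel_contour \<theta> (1 / t)) h"
    and bound: "\<And>z. z \<in> hankel_contour \<theta> (1 / t) \<Longrightarrow> norm (h z) \<le> B * cmod z powr p"
  shows "norm (hankel \<theta> (1 / t) (\<lambda>z. exp (z * of_real t) * h z)) \<le> hankel_const \<theta> p * B * t powr (- p - 1)"
proof -
  have th0: "0 < \<theta>" using th pi_gt_zero by linarith
  have cos: "0 < - cos \<theta>" using cos_neg[OF th] by simp
  define K where "K = powr_exp_const p (- cos \<theta> / 2)"
  define B' where "B' = B * exp 2 * K * t powr (- p)"
  define c where "c = - cos \<theta> * t / 2"
  have c: "0 < c" using cos t by (simp add: c_def mult_neg_pos)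
  have "hankel_dominated \<theta> (1 / t) c B' (\<lambda>z. exp (z * of_real t) * h z)"
    unfolding hankel_dominated_def
  proof (intro conjI ballI)
    show "continuous_on (hankel_contour \<theta> (1 / t)) (\<lambda>z. exp (z * of_real t) * h z)"
      by (intro continuous_intros cont)
    fix z assume z: "z \<in> hankel_contour \<theta> (1 / t)"
    define r where "r = cmod z"
    have r: "1 / t \<le> r" using hankel_contour_sector(2)[OF z] th0 t by (simp add: r_def)
    then have rt: "1 \<le> r * t" using t by (simp add: field_simps)
    have "0 < r" using r t by (smt (verit) divide_pos_pos)
    have "r powr p = t powr (- p) * (r * t) powr p"
      using \<open>0 < r\<close> t by (simp add: powr_mult powr_add[symmetric] mult.left_commute)
    also have "\<dots> \<le> t powr (- p) * (K * exp (- cos \<theta> / 2 * (r * t)))"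
      unfolding K_def using cos by (intro mult_left_mono powr_le_exp rt) auto
    also have "\<dots> = t powr (- p) * K * exp (c * r)" by (simp add: c_def mult_ac)
    finally have rp: "r powr p \<le> t powr (- p) * K * exp (c * r)" .
    have "norm (exp (z * of_real t) * h z) \<le> (exp 2 * exp (- 2 * c * r)) * (B * (t powr (- p) * K * exp (c * r)))"
      unfolding norm_mult
    proof (intro mult_mono)
      show "norm (exp (z * of_real t)) \<le> exp 2 * exp (- 2 * c * r)"
        using norm_exp_hankel_contour[OF z, of t] th0 th t by (simp add: r_def c_def)
      show "norm (h z) \<le> B * (t powr (- p) * K * exp (c * r))"
        using bound[OF z] rp B unfolding r_def[symmetric] by (meson mult_left_mono order_trans)
    qed auto
    also have "\<dots> = B' * (exp (- 2 * c * r) * exp (c * r))" by (simp add: B'_def)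
    also have "exp (- 2 * c * r) * exp (c * r) = exp (- c * cmod z)"
      by (simp add: exp_add[symmetric] r_def)
    finally show "norm (exp (z * of_real t) * h z) \<le> B' * exp (- c * cmod z)" .
  qed
  then have "norm (hankel \<theta> (1 / t) (\<lambda>z. exp (z * of_real t) * h z)) \<le> B' * (2 / c + 2 * \<theta> * (1 / t))"
    by (rule norm_hankel_le) (use th0 t c in auto)
  also have "\<dots> = hankel_const \<theta> p * B * (t powr (- p) * (1 / t))"
    using t cos by (simp add: B'_def hankel_const_def K_def c_def field_simps)
  also have "t powr (- p) * (1 / t) = t powr (- p - 1)"
    using t by (simp add: powr_diff)
  finally show ?thesis .
qed

text \<open>Holomorphy is established in the coordinate w = ln z. It is carried back by the
  principal logarithm, which is continuous on the sector because \<theta> < \<Theta> \<le> pi keeps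
  the sector off the negative axis.\<close>

lemma continuous_on_sector:
  fixes h :: "complex \<Rightarrow> 'a::topological_space"
  assumes "continuous_on {w. \<bar>Im w\<bar> < \<Theta>} (\<lambda>w. h (exp w))" "\<theta> < \<Theta>" "\<Theta> \<le> pi"
  shows "continuous_on (sector \<theta>) h"
proof -
  have Ln: "z \<notin> \<real>\<^sub>\<le>\<^sub>0 \<and> \<bar>Im (Ln z)\<bar> < \<Theta> \<and> exp (Ln z) = z" if z: "z \<in> sector \<theta>" for z
  proof -
    obtain r \<psi> where r: "z = of_real r * cis \<psi>" "0 < r" "\<bar>\<psi>\<bar> \<le> \<theta>" using z by (rule sectorE)
    have "Ln z = Complex (ln r) \<psi>"
      unfolding r(1) exp_Complex_ln[OF r(2), symmetric] using r assms(2,3) by (intro Ln_exp) auto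
    moreover have "sin \<psi> = 0 \<Longrightarrow> \<psi> = 0" using r assms(2,3) sin_eq_0_pi[of \<psi>] by linarith
    then have "z \<notin> \<real>\<^sub>\<le>\<^sub>0"
      using r by (auto simp: complex_nonpos_Reals_iff)
    ultimately show ?thesis
      using r assms(2) by (simp add: exp_Complex_ln)
  qed
  have "continuous_on (sector \<theta>) (\<lambda>z. h (exp (Ln z)))"
    by (rule continuous_on_compose2[OF assms(1)])
       (use Ln in \<open>auto intro!: continuous_on_Ln\<close>)
  then show ?thesis by (rule continuous_on_eq) (use Ln in auto)
qed

section \<open>The function g on sectors\<close>

locale oldroyd =
  fixes \<alpha> \<beta> \<mu> a b :: real
  assumes params: "0 < \<alpha>" "\<alpha> < 1" "0 < \<beta>" "\<beta> < 1" "0 < \<mu>" "0 < a" "0 < b"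
begin

abbreviation g :: "complex \<Rightarrow> complex" where "g \<equiv> oldroyd_g \<alpha> \<beta> \<mu> a b"

text \<open>The angle at which (1 + \<alpha>) \<theta> reaches pi; sectors of smaller angle have
  images under g that miss the negative axis.\<close>

definition \<Theta> :: real where "\<Theta> = pi / (1 + \<alpha>)"

lemma \<Theta>_bounds: "pi / 2 < \<Theta>" "\<Theta> < pi"
  using params by (auto simp: \<Theta>_def field_simps)

lemma less_\<Theta>_iff: "\<theta> < \<Theta> \<longleftrightarrow> (1 + \<alpha>) * \<theta> < pi"
  using params by (simp add: \<Theta>_def field_simps)

text \<open>In the strip |Im w| < pi the principal powers of exp w become exponentials, which
  removes the branch cut and makes holomorphy visible.\<close>

lemma g_exp:
  assumes "\<bar>Im w\<bar> < pi"
  shows "g (exp w) = exp w * (1 + of_real a * exp (of_real \<alpha> * w)) / (of_real \<mu> * (1 + of_real b * exp (of_real \<beta> * w)))"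
proof -
  have "exp w powr of_real p = exp (of_real p * w)" for p
    using assms by (simp add: powr_def Ln_exp)
  then show ?thesis
    unfolding oldroyd_g_def by (simp only:) (simp add: exp_add algebra_simps)
qed

lemma g_cnj:
  assumes "\<bar>Im w\<bar> < pi"
  shows "g (exp (cnj w)) = cnj (g (exp w))"
  using assms by (simp add: g_exp exp_cnj)

lemma exp_scaled_Complex_ln:
  "0 < r \<Longrightarrow> exp (of_real p * Complex (ln r) \<psi>) = of_real (r powr p) * cis (p * \<psi>)"
  by (simp add: exp_eq_polar powr_def)

text \<open>For \<psi> \<ge> 0 the factor z contributes the angle \<psi>, the bracket in the
  numerator an angle in [0, \<alpha> \<psi>], and the denominator subtracts one in
  [0, \<beta> \<psi>]. Since \<beta> < 1 the total stays between 0 and (1 + \<alpha>) \<psi>.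
  Negative angles follow by conjugation.\<close>

lemma g_polar:
  assumes "0 < r" "\<bar>\<psi>\<bar> < \<Theta>"
  obtains R \<eta> where "0 < R" "\<bar>\<eta>\<bar> \<le> (1 + \<alpha>) * \<bar>\<psi>\<bar>" "g (of_real r * cis \<psi>) = of_real R * cis \<eta>"
proof -
  have nonneg: "\<exists>R \<eta>. 0 < R \<and> \<bar>\<eta>\<bar> \<le> (1 + \<alpha>) * \<bar>\<psi>\<bar> \<and> g (of_real r * cis \<psi>) = of_real R * cis \<eta>"
    if psi: "0 \<le> \<psi>" "\<psi> < \<Theta>" for \<psi>
  proof -
    have le: "p * \<psi> < pi" "p * \<psi> \<le> \<psi>" if "0 < p" "p < 1" for p
      using that psi \<Theta>_bounds mult_left_le_one_le[of \<psi> p] by auto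
    obtain R1 \<eta>1 where 1: "0 < R1" "0 \<le> \<eta>1" "\<eta>1 \<le> \<alpha> * \<psi>"
        "1 + of_real (a * r powr \<alpha>) * cis (\<alpha> * \<psi>) = of_real R1 * cis \<eta>1"
      using one_plus_polar[of "\<alpha> * \<psi>" "a * r powr \<alpha>"] params psi le[of \<alpha>] by auto
    obtain R2 \<eta>2 where 2: "0 < R2" "0 \<le> \<eta>2" "\<eta>2 \<le> \<beta> * \<psi>"
        "1 + of_real (b * r powr \<beta>) * cis (\<beta> * \<psi>) = of_real R2 * cis \<eta>2"
      using one_plus_polar[of "\<beta> * \<psi>" "b * r powr \<beta>"] params psi le[of \<beta>] by auto
    have "g (of_real r * cis \<psi>) = of_real r * cis \<psi> * (of_real R1 * cis \<eta>1) / (of_real \<mu> * (of_real R2 * cis \<eta>2))"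
      unfolding 1(4)[symmetric] 2(4)[symmetric] exp_Complex_ln[OF assms(1), symmetric]
      using psi \<Theta>_bounds assms
      by (simp add: g_exp exp_scaled_Complex_ln mult.assoc)
    also have "\<dots> = of_real (r * R1 / (\<mu> * R2)) * (cis \<psi> * cis \<eta>1 / cis \<eta>2)"
      using 2 params by (simp add: field_simps)
    also have "cis \<psi> * cis \<eta>1 / cis \<eta>2 = cis (\<psi> + \<eta>1 - \<eta>2)"
      by (simp add: cis_mult cis_divide)
    finally have "g (of_real r * cis \<psi>) = of_real (r * R1 / (\<mu> * R2)) * cis (\<psi> + \<eta>1 - \<eta>2)" .
    moreover have "0 < r * R1 / (\<mu> * R2)" using 1 2 params assms by simp
    moreover have "\<bar>\<psi> + \<eta>1 - \<eta>2\<bar> \<le> (1 + \<alpha>) * \<bar>\<psi>\<bar>"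
      using 1 2 le[of \<beta>] params psi by (auto simp: algebra_simps)
    ultimately show ?thesis by blast
  qed
  show ?thesis
  proof (cases "0 \<le> \<psi>")
    case True
    then show ?thesis using nonneg[of \<psi>] assms that by auto
  next
    case False
    then obtain R \<eta> where *: "0 < R" "\<bar>\<eta>\<bar> \<le> (1 + \<alpha>) * \<bar>\<psi>\<bar>"
        "g (of_real r * cis (- \<psi>)) = of_real R * cis \<eta>"
      using nonneg[of "- \<psi>"] assms by auto
    have "g (of_real r * cis \<psi>) = g (exp (cnj (Complex (ln r) (- \<psi>))))"
      using exp_Complex_ln[OF assms(1), of \<psi>] by (simp add: complex_cnj)
    also have "\<dots> = cnj (g (of_real r * cis (- \<psi>)))"
      using exp_Complex_ln[OF assms(1), of "- \<psi>"] assms \<Theta>_bounds by (subst g_cnj) auto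
    also have "\<dots> = of_real R * cis (- \<eta>)" by (simp add: * cis_cnj)
    finally show ?thesis using * that[of R "- \<eta>"] by simp
  qed
qed

text \<open>The inverse of the constant in \<open>sector_add_norm_ge\<close> for \<omega> = (1 +
  \<alpha>) \<theta>, the angle of the image sector.\<close>

definition sector_const :: "real \<Rightarrow> real" where
  "sector_const \<theta> = 1 / cos ((1 + \<alpha>) * \<theta> / 2)"

lemma sector_const_pos:
  assumes "0 \<le> \<theta>" "\<theta> < \<Theta>"
  shows "0 < cos ((1 + \<alpha>) * \<theta> / 2)" "0 < sector_const \<theta>"
proof -
  have "0 \<le> (1 + \<alpha>) * \<theta>" using params assms by simp
  then show "0 < cos ((1 + \<alpha>) * \<theta> / 2)"
    using assms params pi_gt_zero unfolding less_\<Theta>_iff by (intro cos_gt_zero_pi) linarith+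
  then show "0 < sector_const \<theta>" by (simp add: sector_const_def)
qed

text \<open>A point of the image sector and a nonnegative real cannot cancel. Keeping the sum of
  both sizes on the left allows |g| / |g + l| and l / |g + l| to be bounded from the same
  inequality.\<close>

lemma norm_g_add_ge:
  assumes "z \<in> sector \<theta>" "\<theta> < \<Theta>" "0 \<le> l"
  shows "norm (g z) + l \<le> sector_const \<theta> * norm (g z + of_real l)"
    and "0 < norm (g z)" and "g z + of_real l \<noteq> 0"
proof -
  obtain r \<psi> where r: "z = of_real r * cis \<psi>" "0 < r" "\<bar>\<psi>\<bar> \<le> \<theta>" using assms(1) by (rule sectorE)
  obtain R \<eta> where *: "0 < R" "\<bar>\<eta>\<bar> \<le> (1 + \<alpha>) * \<bar>\<psi>\<bar>" "g z = of_real R * cis \<eta>"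
    using g_polar[of r \<psi>] r assms by auto
  have "0 \<le> \<theta>" using r by linarith
  note c = sector_const_pos[OF this assms(2)]
  have "(1 + \<alpha>) * \<bar>\<psi>\<bar> \<le> (1 + \<alpha>) * \<theta>" using params r by (intro mult_left_mono) auto
  then have "cos ((1 + \<alpha>) * \<theta> / 2) * (R + l) \<le> norm (of_real R * cis \<eta> + of_real l)"
    using * assms by (intro sector_add_norm_ge) (auto simp: less_\<Theta>_iff)
  then show 1: "norm (g z) + l \<le> sector_const \<theta> * norm (g z + of_real l)"
    using c * by (simp add: sector_const_def norm_mult field_simps)
  show 2: "0 < norm (g z)" using * by (simp add: norm_mult)
  show "g z + of_real l \<noteq> 0"
    using 1 2 assms(3) by (metis add_pos_nonneg mult_zero_right norm_zero not_le)
qed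

text \<open>The exponent p < 1 keeps the argument of the power below pi, hence the power away from
  -1. This guards the denominator of g.\<close>

lemma one_plus_power_ne_0:
  assumes "\<bar>Im w\<bar> < pi" "0 < p" "p < 1" "0 < k"
  shows "1 + of_real k * exp (of_real p * w) \<noteq> 0"
proof -
  define y where "y = p * \<bar>Im w\<bar>"
  have y: "y < pi" "0 \<le> y"
    unfolding y_def using assms mult_left_le_one_le[of "\<bar>Im w\<bar>" p] by auto
  have e: "of_real k * exp (of_real p * w) = of_real (k * exp (p * Re w)) * cis (p * Im w)"
    by (simp add: exp_eq_polar)
  have "0 < cos (y / 2) * (k * exp (p * Re w) + 1)"
    using y assms by (intro mult_pos_pos cos_gt_zero_pi add_pos_pos) auto
  also have "\<dots> \<le> norm (of_real (k * exp (p * Re w)) * cis (p * Im w) + of_real 1)"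
    using y assms by (intro sector_add_norm_ge) (auto simp: y_def abs_mult)
  finally show ?thesis unfolding e by (auto simp: add.commute)
qed

text \<open>The factor by which \<open>E_hat\<close> acts on an eigenfunction with eigenvalue
  l.\<close>

definition symb :: "real \<Rightarrow> complex \<Rightarrow> complex" where
  "symb l z = g z / (z * (g z + of_real l))"

lemma symb_holomorphic:
  assumes "0 \<le> l"
  shows "(\<lambda>w. symb l (exp w)) holomorphic_on {w. \<bar>Im w\<bar> < \<Theta>}"
proof -
  have pi: "\<bar>Im w\<bar> < pi" if "\<bar>Im w\<bar> < \<Theta>" for w using that \<Theta>_bounds by simp
  have "(\<lambda>w. exp w * (1 + of_real a * exp (of_real \<alpha> * w)) / (of_real \<mu> * (1 + of_real b * exp (of_real \<beta> * w))))
      holomorphic_on {w. \<bar>Im w\<bar> < \<Theta>}"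
    using params one_plus_power_ne_0[OF pi, of _ \<beta> b] by (intro holomorphic_intros) auto
  then have g: "(\<lambda>w. g (exp w)) holomorphic_on {w. \<bar>Im w\<bar> < \<Theta>}"
    by (rule holomorphic_transform) (use pi in \<open>auto simp: g_exp\<close>)
  have "g (exp w) + of_real l \<noteq> 0" if "\<bar>Im w\<bar> < \<Theta>" for w
  proof (rule norm_g_add_ge(3)[OF _ that assms])
    show "exp w \<in> sector \<bar>Im w\<bar>" unfolding exp_eq_polar[of w] sector_def by force
  qed
  then show ?thesis
    unfolding symb_def by (intro holomorphic_intros g) auto
qed

lemma symb_continuous:
  assumes "0 \<le> l" "0 < \<delta>" "0 \<le> \<theta>" "\<theta> < \<Theta>"
  shows "continuous_on (hankel_contour \<theta> \<delta>) (symb l)"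
proof (rule continuous_on_subset)
  show "continuous_on (sector \<theta>) (symb l)"
    by (rule continuous_on_sector[OF holomorphic_on_imp_continuous_on[OF symb_holomorphic]])
       (use assms \<Theta>_bounds in auto)
qed (use hankel_contour_sector assms in auto)

text \<open>One bound for each kind of estimate: plain boundedness, the gain of a factor l, and the
  distance to 1 / z. The first two drop different summands of |g| + l. The third rests on 1 / z -
  \<open>symb l z\<close> = l / (z (g + l)), whose numerator l is what later turns into A v.\<close>

lemma norm_symb_le:
  assumes "z \<in> sector \<theta>" "\<theta> < \<Theta>" "0 \<le> l"
  shows "norm (symb l z) \<le> sector_const \<theta> / cmod z"
    and "l * norm (symb l z) \<le> sector_const \<theta> * norm (g z) / cmod z"
    and "norm (1 / z - symb l z) \<le> sector_const \<theta> * l / (cmod z * norm (g z))"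
proof -
  obtain r \<psi> where r: "z = of_real r * cis \<psi>" "0 < r" "\<bar>\<psi>\<bar> \<le> \<theta>" "cmod z = r" using assms(1) by (rule sectorE)
  have z: "z \<noteq> 0" using r by auto
  note n = norm_g_add_ge[OF assms]
  define M where "M = sector_const \<theta>"
  have M: "0 < M" unfolding M_def by (rule sector_const_pos) (use r assms in auto)
  have pos: "0 < norm (g z + of_real l)" using n(3) by simp
  have "norm (g z) / norm (g z + of_real l) \<le> M"
    using n(1) pos assms by (simp add: divide_le_eq M_def)
  then have "norm (g z) / norm (g z + of_real l) / r \<le> M / r"
    using r by (intro divide_right_mono) auto
  then show "norm (symb l z) \<le> sector_const \<theta> / cmod z"
    unfolding symb_def M_def[symmetric] by (simp add: norm_divide norm_mult r(4) mult.commute)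
  have le: "l / norm (g z + of_real l) \<le> M"
  proof -
    have "l \<le> M * norm (g z + of_real l)" using n(1) norm_ge_zero[of "g z"] unfolding M_def by linarith
    then show ?thesis using pos by (simp add: divide_le_eq)
  qed
  then have "l / norm (g z + of_real l) * (norm (g z) / r) \<le> M * (norm (g z) / r)"
    using r by (intro mult_right_mono) auto
  then show "l * norm (symb l z) \<le> sector_const \<theta> * norm (g z) / cmod z"
    unfolding symb_def M_def[symmetric] by (simp add: norm_divide norm_mult r(4) mult_ac)
  have "1 / z - symb l z = of_real l / (z * (g z + of_real l))"
  proof -
    have "1 / z = (g z + of_real l) / (z * (g z + of_real l))" using n(3) z by simp
    then show ?thesis unfolding symb_def
      by (simp only: diff_divide_distrib[symmetric] add_diff_cancel_left')
  qed
  then have "norm (1 / z - symb l z) = l * (1 / norm (g z + of_real l)) / r"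
    using assms by (simp add: norm_divide norm_mult r(4))
  also have "1 / norm (g z + of_real l) \<le> M / norm (g z)"
    using n(1,2) pos assms(3) by (simp add: M_def field_simps)
  then have "l * (1 / norm (g z + of_real l)) / r \<le> l * (M / norm (g z)) / r"
    using assms r by (intro divide_right_mono mult_left_mono) auto
  finally show "norm (1 / z - symb l z) \<le> sector_const \<theta> * l / (cmod z * norm (g z))"
    unfolding M_def[symmetric] by (simp add: mult_ac r(4))
qed

text \<open>For |z| \<ge> 1 / T the summand 1 is at most (T |z|)^p and can be absorbed into the
  power; for the lower bound it is simply dropped.\<close>

lemma norm_power_factor_bounds:
  assumes T: "0 < T" and r: "1 / T \<le> r" and "\<bar>\<psi>\<bar> \<le> \<theta>" "\<theta> < pi" "0 < p" "p < 1" "0 < k"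
  shows "norm (1 + of_real k * exp (of_real p * Complex (ln r) \<psi>)) \<le> (T powr p + k) * r powr p"
    and "cos (\<theta> / 2) * k * r powr p \<le> norm (1 + of_real k * exp (of_real p * Complex (ln r) \<psi>))"
proof -
  have r0: "0 < r" using T r by (smt (verit) divide_pos_pos)
  have e: "1 + of_real k * exp (of_real p * Complex (ln r) \<psi>) = of_real (k * r powr p) * cis (p * \<psi>) + of_real 1"
    using r0 by (simp add: exp_scaled_Complex_ln)
  have "1 \<le> (T * r) powr p" using T r assms by (intro ge_one_powr_ge_zero) (auto simp: field_simps)
  then have "1 \<le> T powr p * r powr p" using T r0 by (simp add: powr_mult)
  moreover have "norm (of_real (k * r powr p) * cis (p * \<psi>) + of_real 1) \<le> k * r powr p + 1"
    by (rule order_trans[OF norm_triangle_ineq]) (use assms in \<open>simp add: norm_mult\<close>)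
  ultimately show "norm (1 + of_real k * exp (of_real p * Complex (ln r) \<psi>)) \<le> (T powr p + k) * r powr p"
    unfolding e by (simp add: algebra_simps)
  have "\<bar>p * \<psi>\<bar> \<le> \<bar>\<psi>\<bar>" using assms mult_left_le_one_le[of "\<bar>\<psi>\<bar>" p] by (simp add: abs_mult)
  then have "cos (\<theta> / 2) * (k * r powr p + 1) \<le> norm (of_real (k * r powr p) * cis (p * \<psi>) + of_real 1)"
    using assms by (intro sector_add_norm_ge) auto
  moreover have "0 \<le> cos (\<theta> / 2)" using assms by (intro cos_ge_zero) auto
  ultimately show "cos (\<theta> / 2) * k * r powr p \<le> norm (1 + of_real k * exp (of_real p * Complex (ln r) \<psi>))"
    unfolding e by (simp add: algebra_simps)
qed

lemma norm_g_bounds: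
  assumes T: "0 < T" and th: "0 \<le> \<theta>" "\<theta> < \<Theta>"
  obtains C where "0 < C"
    "\<And>z. z \<in> sector \<theta> \<Longrightarrow> 1 / T \<le> cmod z \<Longrightarrow> norm (g z) \<le> C * cmod z powr (1 + \<alpha> - \<beta>)"
    "\<And>z. z \<in> sector \<theta> \<Longrightarrow> 1 / T \<le> cmod z \<Longrightarrow> cmod z powr (1 + \<alpha> - \<beta>) \<le> C * norm (g z)"
proof -
  define k where "k = cos (\<theta> / 2)"
  have k: "0 < k" unfolding k_def using th \<Theta>_bounds by (intro cos_gt_zero_pi) auto
  \<comment> \<open>C1 is the upper constant of the numerator of g over the lower constant of its
    denominator; C2 is the inverse of the quotient with the roles exchanged.\<close>
  define C1 where "C1 = (T powr \<alpha> + a) / (\<mu> * (k * b))"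
  define C2 where "C2 = \<mu> * (T powr \<beta> + b) / (k * a)"
  have C: "0 < C1" "0 < C2" using params k by (auto simp: C1_def C2_def intro!: divide_pos_pos mult_pos_pos add_nonneg_pos)
  have main: "norm (g z) \<le> C1 * cmod z powr (1 + \<alpha> - \<beta>) \<and> cmod z powr (1 + \<alpha> - \<beta>) \<le> C2 * norm (g z)"
    if zs: "z \<in> sector \<theta>" and z: "1 / T \<le> cmod z" for z
  proof -
    obtain r \<psi> where zr: "z = of_real r * cis \<psi>" and r0: "0 < r" and psi: "\<bar>\<psi>\<bar> \<le> \<theta>" and nz: "cmod z = r"
      using zs by (rule sectorE)
    have r: "1 / T \<le> r" using z nz by simp
    have pi: "\<theta> < pi" using th \<Theta>_bounds by simp
    define u where "u = norm (1 + of_real a * exp (of_real \<alpha> * Complex (ln r) \<psi>))"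
    define v where "v = norm (1 + of_real b * exp (of_real \<beta> * Complex (ln r) \<psi>))"
    note u = norm_power_factor_bounds[OF T r psi pi params(1,2,6), folded u_def k_def]
    note v = norm_power_factor_bounds[OF T r psi pi params(3,4,7), folded v_def k_def]
    have v0: "0 < v" using v(2) k params r0 by (smt (verit) mult_pos_pos powr_gt_zero)
    have u0: "0 \<le> u" by (simp add: u_def)
    have g: "norm (g z) = r * u / (\<mu> * v)"
      unfolding zr exp_Complex_ln[OF r0, symmetric] u_def v_def
      using psi pi params r0 by (simp add: g_exp norm_mult norm_divide norm_exp_eq_Re)
    have p: "r powr (1 + \<alpha> - \<beta>) = r * r powr \<alpha> / r powr \<beta>"
      using r0 by (simp add: powr_diff powr_add)
    have "r * u / (\<mu> * v) \<le> r * ((T powr \<alpha> + a) * r powr \<alpha>) / (\<mu> * (k * b * r powr \<beta>))"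
      using u u0 v v0 k params r0 by (intro frac_le mult_left_mono mult_nonneg_nonneg mult_pos_pos) auto
    also have "\<dots> = C1 * (r * r powr \<alpha> / r powr \<beta>)" by (simp add: C1_def field_simps)
    finally have 1: "norm (g z) \<le> C1 * r powr (1 + \<alpha> - \<beta>)" by (simp add: g p)
    have "C2 * (r * u / (\<mu> * v)) \<ge> C2 * (r * (k * a * r powr \<alpha>) / (\<mu> * ((T powr \<beta> + b) * r powr \<beta>)))"
      using u u0 v v0 k params r0 C by (intro frac_le mult_left_mono mult_nonneg_nonneg mult_pos_pos) auto
    moreover have "C2 * (r * (k * a * r powr \<alpha>) / (\<mu> * ((T powr \<beta> + b) * r powr \<beta>))) = r * r powr \<alpha> / r powr \<beta>"
    proof -
      define q where "q = T powr \<beta> + b"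
      have "q > 0" using params by (simp add: q_def add_nonneg_pos)
      then show ?thesis unfolding C2_def q_def[symmetric] using k params r0 by (simp add: field_simps)
    qed
    ultimately show ?thesis using 1 by (simp add: g p nz)
  qed
  show ?thesis
  proof (rule that[of "C1 + C2"])
    fix z assume z: "z \<in> sector \<theta>" "1 / T \<le> cmod z"
    show "norm (g z) \<le> (C1 + C2) * cmod z powr (1 + \<alpha> - \<beta>)"
      using main[OF z] C by (smt (verit) mult_right_mono powr_ge_zero)
    show "cmod z powr (1 + \<alpha> - \<beta>) \<le> (C1 + C2) * norm (g z)"
      using main[OF z] C by (smt (verit) mult_right_mono norm_ge_zero)
  qed (use C in auto)
qed

end

text \<open>With c = - cos \<theta> * t / 4 the exponential decays at rate 4 c. Of this, 2 c is
  spent on the permitted growth of h, c on the power |z|^n, and c is left over. The permitted growth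
  is what the Taylor remainder in time will need.\<close>

lemma hankel_dominated_exp_mult:
  fixes h :: "complex \<Rightarrow> complex"
  assumes th: "pi / 2 < \<theta>" "\<theta> \<le> pi" and "0 < \<delta>" "0 < t" and B: "0 \<le> B"
    and cont: "continuous_on (hankel_contour \<theta> \<delta>) h"
    and bound: "\<And>z. z \<in> hankel_contour \<theta> \<delta> \<Longrightarrow> norm (h z) \<le> B * cmod z ^ n * exp (- cos \<theta> * t / 2 * cmod z)"
  shows "hankel_dominated \<theta> \<delta> (- cos \<theta> * t / 4) (exp (2 * t * \<delta>) * (fact n / (- cos \<theta> * t / 4) ^ n) * B)
    (\<lambda>z. exp (z * of_real t) * h z)"
proof -
  have th0: "0 < \<theta>" using th pi_gt_zero by linarith
  define c where "c = - cos \<theta> * t / 4"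
  have c: "0 < c" using cos_neg[OF th] \<open>0 < t\<close> by (simp add: c_def mult_neg_pos)
  define K where "K = fact n / c ^ n"
  show ?thesis
    unfolding hankel_dominated_def c_def[symmetric] K_def[symmetric]
  proof (intro conjI ballI)
    show "continuous_on (hankel_contour \<theta> \<delta>) (\<lambda>z. exp (z * of_real t) * h z)"
      by (intro continuous_intros cont)
    fix z assume z: "z \<in> hankel_contour \<theta> \<delta>"
    have e: "norm (exp (z * of_real t)) \<le> exp (2 * t * \<delta>) * exp (- (4 * c * cmod z))"
      using norm_exp_hankel_contour[OF z, of t] assms th0 by (simp add: c_def)
    have "norm (h z) \<le> B * cmod z ^ n * exp (2 * c * cmod z)"
      using bound[OF z] by (simp add: c_def mult_ac)
    also have "\<dots> \<le> B * (K * exp (c * cmod z)) * exp (2 * c * cmod z)"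
      using power_le_exp[OF c, of "cmod z" n] B by (intro mult_right_mono mult_left_mono) (auto simp: K_def)
    finally have "norm (exp (z * of_real t) * h z) \<le>
        (exp (2 * t * \<delta>) * exp (- (4 * c * cmod z))) * (B * (K * exp (c * cmod z)) * exp (2 * c * cmod z))"
      unfolding norm_mult by (intro mult_mono e) auto
    also have "\<dots> = exp (2 * t * \<delta>) * K * B * exp (- (4 * c * cmod z) + c * cmod z + 2 * c * cmod z)"
      by (simp only: exp_add) (simp add: mult_ac)
    also have "- (4 * c * cmod z) + c * cmod z + 2 * c * cmod z = - c * cmod z" by simp
    finally show "norm (exp (z * of_real t) * h z) \<le> exp (2 * t * \<delta>) * K * B * exp (- c * cmod z)" .
  qed
qed

lemma norm_exp_minus_linear_le: "norm (exp w - 1 - w) \<le> exp (norm w) * (norm w)\<^sup>2" for w :: complex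
  using Taylor_exp_field[of w 1] by (simp add: power2_eq_square diff_diff_eq)

section \<open>Scalar evolution functions and their bounds\<close>

context oldroyd
begin

abbreviation integrand :: "nat \<Rightarrow> real \<Rightarrow> real \<Rightarrow> complex \<Rightarrow> complex" where
  "integrand k l t \<equiv> \<lambda>z. exp (z * of_real t) * (z ^ k * symb l z)"

text \<open>The k-th time derivative of the scalar solution for the eigenvalue l, since each
  differentiation of exp (z t) brings down a factor z. That it really is the derivative is the
  content of \<open>evol_taylor\<close>.\<close>

definition evol :: "real \<Rightarrow> real \<Rightarrow> nat \<Rightarrow> real \<Rightarrow> real \<Rightarrow> complex" where
  "evol \<theta> \<delta> k l t =
     1 / (2 * of_real pi * \<i>) * hankel \<theta> \<delta> (integrand k l t)"

lemma norm_evol: "norm (evol \<theta> \<delta> k l t) =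
    norm (hankel \<theta> \<delta> (integrand k l t)) / (2 * pi)"
  by (simp add: evol_def norm_mult norm_divide)

lemma evol_shift_le:
  assumes "pi / 2 < \<theta>" "\<theta> \<le> \<theta>'" "\<theta>' < \<Theta>" "0 < \<delta>" "0 < \<delta>'" "0 < t" "0 \<le> l"
  shows "evol \<theta> \<delta> k l t = evol \<theta>' \<delta>' k l t"
proof -
  have c: "0 < - cos \<theta>" using cos_neg[of \<theta>] assms \<Theta>_bounds by simp
  define c where "c = - cos \<theta> * t / 2"
  have c0: "0 < c" using c \<open>0 < t\<close> by (simp add: c_def mult_neg_pos)
  \<comment> \<open>Half of the decay rate absorbs the factor z^k; the symbol itself is bounded by M
    / d beyond radius d.\<close>
  define K where "K = fact k / c ^ k"
  have K: "0 < K" using c0 by (simp add: K_def)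
  define M where "M = sector_const \<theta>'"
  have M: "0 < M" unfolding M_def by (rule sector_const_pos) (use assms pi_gt_zero in linarith)+
  have "hankel \<theta> \<delta> (integrand k l t) =
      hankel \<theta>' \<delta>' (integrand k l t)"
  proof (rule hankel_shift[where \<Theta> = \<Theta> and c = c])
    show "(\<lambda>w. exp (exp w * of_real t) * (exp w ^ k * symb l (exp w))) holomorphic_on {w. \<bar>Im w\<bar> < \<Theta>}"
      by (intro holomorphic_intros symb_holomorphic assms)
    show "0 < \<theta>" using assms pi_gt_zero by linarith
    fix d :: real assume d: "0 < d"
    have "norm (integrand k l t (of_real r * cis \<psi>))
        \<le> K * (M / d) * exp (- c * r)" if "d \<le> r" "\<theta> \<le> \<bar>\<psi>\<bar>" "\<bar>\<psi>\<bar> \<le> \<theta>'" for r \<psi>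
    proof -
      have r: "0 < r" using d that by simp
      have "norm (exp (of_real r * cis \<psi> * of_real t)) \<le> exp (cos \<theta> * t * r)"
        by (rule norm_exp_ray) (use that assms \<Theta>_bounds r pi_gt_zero in linarith)+
      moreover have "norm ((of_real r * cis \<psi>) ^ k) \<le> K * exp (c * r)"
        using power_le_exp[OF c0, of r k] r by (simp add: norm_power norm_mult K_def)
      moreover have "norm (symb l (of_real r * cis \<psi>)) \<le> M / d"
      proof -
        have "of_real r * cis \<psi> \<in> sector \<theta>'" using r that unfolding sector_def by blast
        from norm_symb_le(1)[OF this assms(3,7)] show ?thesis
          using that r d M frac_le[of M M d r] by (simp add: M_def norm_mult)
      qed
      ultimately have "norm (integrand k l t (of_real r * cis \<psi>))
          \<le> exp (cos \<theta> * t * r) * ((K * exp (c * r)) * (M / d))"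
        unfolding norm_mult[of "exp _"] norm_mult[of "_ ^ k"] using K M d by (intro mult_mono) auto
      also have "\<dots> = K * (M / d) * exp (cos \<theta> * t * r + c * r)" by (simp add: exp_add)
      also have "cos \<theta> * t * r + c * r = - c * r" by (simp add: c_def)
      finally show ?thesis .
    qed
    then show "\<exists>B. \<forall>r \<psi>. d \<le> r \<longrightarrow> \<theta> \<le> \<bar>\<psi>\<bar> \<longrightarrow> \<bar>\<psi>\<bar> \<le> \<theta>' \<longrightarrow>
        norm (integrand k l t (of_real r * cis \<psi>))
        \<le> B * exp (- c * r)"
      by blast
  qed (use assms c0 in auto)
  then show ?thesis by (simp add: evol_def)
qed

lemma evol_shift:
  assumes "pi / 2 < \<theta>" "\<theta> < \<Theta>" "pi / 2 < \<theta>'" "\<theta>' < \<Theta>" "0 < \<delta>" "0 < \<delta>'" "0 < t" "0 \<le> l"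
  shows "evol \<theta> \<delta> k l t = evol \<theta>' \<delta>' k l t"
  using evol_shift_le[of \<theta> \<theta>' \<delta> \<delta>' t l k] evol_shift_le[of \<theta>' \<theta> \<delta>' \<delta> t l k] assms
  by (cases "\<theta> \<le> \<theta>'") auto

text \<open>A reference angle inside the admissible range, depending on \<alpha> alone. Evaluating
  every bound at it frees the constants from \<theta>.\<close>

definition \<kappa> :: real where "\<kappa> = (pi / 2 + \<Theta>) / 2"

lemma \<kappa>_bounds: "pi / 2 < \<kappa>" "\<kappa> < \<Theta>" "0 < \<kappa>" "\<kappa> \<le> pi"
  using \<Theta>_bounds pi_gt_zero unfolding \<kappa>_def by (auto simp: field_simps)

lemma power_divide_powr: "0 < r \<Longrightarrow> r ^ k / r = r powr (real k - 1)"
  by (simp add: powr_diff powr_realpow)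

text \<open>The factor \<open>x\<close> carries the power of \<open>\<lambda>\<close> in the smoothing estimate.\<close>

lemma evol_le:
  assumes "pi / 2 < \<theta>" "\<theta> < \<Theta>" "0 < \<delta>" "0 \<le> l" "0 < t" "0 \<le> B"
    and eq: "x * hankel \<kappa> (1 / t) (integrand k l t) =
      hankel \<kappa> (1 / t) (\<lambda>z. exp (z * of_real t) * h z)"
    and h: "continuous_on (hankel_contour \<kappa> (1 / t)) h"
      "\<And>z. z \<in> hankel_contour \<kappa> (1 / t) \<Longrightarrow> z \<in> sector \<kappa> \<Longrightarrow> 1 / t \<le> cmod z \<Longrightarrow> norm (h z) \<le> B * cmod z powr p"
  shows "cmod x * norm (evol \<theta> \<delta> k l t) \<le> hankel_const \<kappa> p * B * t powr (- p - 1)"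
proof -
  have "cmod x * norm (evol \<theta> \<delta> k l t) = cmod x * norm (evol \<kappa> (1 / t) k l t)"
    using evol_shift[of \<theta> \<kappa> \<delta> "1 / t" t l k] assms \<kappa>_bounds by simp
  also have "\<dots> = norm (hankel \<kappa> (1 / t) (\<lambda>z. exp (z * of_real t) * h z)) / (2 * pi)"
    unfolding norm_evol eq[symmetric] norm_mult by simp
  also have "\<dots> \<le> norm (hankel \<kappa> (1 / t) (\<lambda>z. exp (z * of_real t) * h z)) / 1"
    using pi_ge_two by (intro divide_left_mono) auto
  also have "\<dots> \<le> hankel_const \<kappa> p * B * t powr (- p - 1)"
    using hankel_scaling_bound[OF \<kappa>_bounds(1,4) assms(5,6) h(1), of p] h(2)
      hankel_contour_sector[of _ \<kappa> "1 / t"] \<kappa>_bounds assms(5) by simp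
  finally show ?thesis .
qed

definition M0 :: real where "M0 = sector_const \<kappa>"

lemma M0_pos: "0 < M0"
  unfolding M0_def by (rule sector_const_pos) (use \<kappa>_bounds in auto)

text \<open>The symbol is at most M0 / |z|, so the scaling bound is applied with p = k - 1 and
  returns the exponent - p - 1 = - k. As g is not compared with a power of |z|, T does not
  enter.\<close>

lemma evol_bound:
  obtains C where "0 < C"
    "\<And>\<theta> \<delta> l t. pi / 2 < \<theta> \<Longrightarrow> \<theta> < \<Theta> \<Longrightarrow> 0 < \<delta> \<Longrightarrow> 0 \<le> l \<Longrightarrow> 0 < t \<Longrightarrow>
       norm (evol \<theta> \<delta> k l t) \<le> C * t powr (- real k)"
proof
  show "0 < hankel_const \<kappa> (real k - 1) * M0"
    using hankel_const_pos \<kappa>_bounds M0_pos by simp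
  fix \<theta> \<delta> l t :: real assume *: "pi / 2 < \<theta>" "\<theta> < \<Theta>" "0 < \<delta>" "0 \<le> l" "0 < t"
  have "cmod 1 * norm (evol \<theta> \<delta> k l t) \<le> hankel_const \<kappa> (real k - 1) * M0 * t powr (- (real k - 1) - 1)"
  proof (rule evol_le[OF * less_imp_le[OF M0_pos] mult_1_left])
    show "continuous_on (hankel_contour \<kappa> (1 / t)) (\<lambda>z. z ^ k * symb l z)"
      by (intro continuous_intros symb_continuous) (use * \<kappa>_bounds in auto)
    fix z assume z: "z \<in> sector \<kappa>" "1 / t \<le> cmod z"
    have r: "0 < cmod z" using z(1) by (auto elim: sectorE)
    have "norm (z ^ k * symb l z) \<le> cmod z ^ k * (M0 / cmod z)"
      unfolding norm_mult norm_power M0_def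
      by (intro mult_left_mono norm_symb_le(1)[OF z(1) \<kappa>_bounds(2) *(4)]) auto
    also have "\<dots> = M0 * (cmod z ^ k / cmod z)" by simp
    finally show "norm (z ^ k * symb l z) \<le> M0 * cmod z powr (real k - 1)"
      unfolding power_divide_powr[OF r] .
  qed
  then show "norm (evol \<theta> \<delta> k l t) \<le> hankel_const \<kappa> (real k - 1) * M0 * t powr (- real k)" by simp
qed

text \<open>The factor l is traded for |g|, and |g| for a multiple of |z| to the power 1 + \<alpha>
  - \<beta>. This raises the exponent p by that amount and costs the same power of t.\<close>

lemma evol_smoothing_bound:
  assumes T: "0 < T"
  obtains C where "0 < C"
    "\<And>\<theta> \<delta> l t. pi / 2 < \<theta> \<Longrightarrow> \<theta> < \<Theta> \<Longrightarrow> 0 < \<delta> \<Longrightarrow> 0 \<le> l \<Longrightarrow> 0 < t \<Longrightarrow> t \<le> T \<Longrightarrow>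
       l * norm (evol \<theta> \<delta> k l t) \<le> C * t powr (- real k - (\<alpha> - \<beta> + 1))"
proof -
  obtain D where D: "0 < D"
    "\<And>z. z \<in> sector \<kappa> \<Longrightarrow> 1 / T \<le> cmod z \<Longrightarrow> norm (g z) \<le> D * cmod z powr (1 + \<alpha> - \<beta>)"
    using norm_g_bounds[OF T less_imp_le \<kappa>_bounds(2), OF \<kappa>_bounds(3)] by metis
  define p where "p = real k - 1 + (1 + \<alpha> - \<beta>)"
  show ?thesis
  proof (rule that[of "hankel_const \<kappa> p * (M0 * D)"])
    show "0 < hankel_const \<kappa> p * (M0 * D)"
      using hankel_const_pos \<kappa>_bounds M0_pos D by simp
    fix \<theta> \<delta> l t :: real assume *: "pi / 2 < \<theta>" "\<theta> < \<Theta>" "0 < \<delta>" "0 \<le> l" "0 < t" and "t \<le> T"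
    have "cmod (of_real l) * norm (evol \<theta> \<delta> k l t) \<le> hankel_const \<kappa> p * (M0 * D) * t powr (- p - 1)"
    proof (rule evol_le[OF *])
      show "0 \<le> M0 * D" using M0_pos D by simp
      show "of_real l * hankel \<kappa> (1 / t) (integrand k l t) =
          hankel \<kappa> (1 / t) (\<lambda>z. exp (z * of_real t) * (of_real l * (z ^ k * symb l z)))"
        unfolding hankel_cmult(1)[symmetric] by (simp add: mult_ac)
      show "continuous_on (hankel_contour \<kappa> (1 / t)) (\<lambda>z. of_real l * (z ^ k * symb l z))"
        by (intro continuous_intros symb_continuous) (use * \<kappa>_bounds in auto)
      fix z assume z: "z \<in> sector \<kappa>" "1 / t \<le> cmod z"
      define r where "r = cmod z"
      have r: "0 < r" using z(1) by (auto elim: sectorE simp: r_def)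
      have "1 / T \<le> 1 / t" using * \<open>t \<le> T\<close> T by (simp add: frac_le)
      then have g: "norm (g z) \<le> D * r powr (1 + \<alpha> - \<beta>)" using D(2)[OF z(1)] z(2) by (simp add: r_def)
      have "l * norm (symb l z) \<le> M0 * norm (g z) / r"
        unfolding M0_def r_def by (rule norm_symb_le(2)[OF z(1) \<kappa>_bounds(2) *(4)])
      also have "\<dots> \<le> M0 * (D * r powr (1 + \<alpha> - \<beta>)) / r"
        using g M0_pos r by (intro divide_right_mono mult_left_mono) auto
      finally have "r ^ k * (l * norm (symb l z)) \<le> r ^ k * (M0 * (D * r powr (1 + \<alpha> - \<beta>)) / r)"
        using r by (intro mult_left_mono) auto
      also have "\<dots> = (M0 * D) * (r ^ k / r * r powr (1 + \<alpha> - \<beta>))" by simp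
      also have "r ^ k / r * r powr (1 + \<alpha> - \<beta>) = r powr p"
        unfolding power_divide_powr[OF r] p_def by (simp only: powr_add)
      finally show "norm (of_real l * (z ^ k * symb l z)) \<le> M0 * D * cmod z powr p"
        using * by (simp add: norm_mult norm_power r_def mult_ac)
    qed
    moreover have "- p - 1 = - real k - (\<alpha> - \<beta> + 1)" by (simp add: p_def)
    ultimately show "l * norm (evol \<theta> \<delta> k l t) \<le> hankel_const \<kappa> p * (M0 * D) * t powr (- real k - (\<alpha> - \<beta> + 1))"
      using * by simp
  qed
qed

lemma evol_integrand_integrable:
  assumes "pi / 2 < \<theta>" "\<theta> < \<Theta>" "0 < \<delta>" "0 < t" "0 \<le> l"
  shows "hankel_integrable \<theta> \<delta> (integrand k l t)"
proof -
  have th: "0 \<le> \<theta>" "\<theta> \<le> pi" using assms \<Theta>_bounds pi_gt_zero by linarith+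
  have cosn: "cos \<theta> < 0" using cos_neg assms(1) th(2) by simp
  define M where "M = sector_const \<theta>"
  have M: "0 < M" unfolding M_def by (rule sector_const_pos) (use assms th in auto)
  note dominated = hankel_dominated_exp_mult[OF assms(1) th(2) assms(3,4), of "M / \<delta>" "\<lambda>z. z ^ k * symb l z" k]
  show ?thesis
  proof (rule hankel_dominated_integrable[OF dominated])
    show "continuous_on (hankel_contour \<theta> \<delta>) (\<lambda>z. z ^ k * symb l z)"
      by (intro continuous_intros symb_continuous assms th)
    fix z assume "z \<in> hankel_contour \<theta> \<delta>"
    note z = hankel_contour_sector[OF this th(1) assms(3)]
    have "norm (symb l z) \<le> M / cmod z" unfolding M_def by (rule norm_symb_le(1)[OF z(1) assms(2,5)])
    also have "\<dots> \<le> M / \<delta>" using z M assms by (intro frac_le) auto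
    finally have "norm (z ^ k * symb l z) \<le> cmod z ^ k * (M / \<delta>)"
      unfolding norm_mult norm_power by (intro mult_left_mono) auto
    also have "\<dots> = M / \<delta> * cmod z ^ k * 1" by simp
    also have "\<dots> \<le> M / \<delta> * cmod z ^ k * exp (- cos \<theta> * t / 2 * cmod z)"
      using M assms cosn by (intro mult_left_mono) (auto simp: mult_nonpos_nonneg)
    finally show "norm (z ^ k * symb l z) \<le> M / \<delta> * cmod z ^ k * exp (- cos \<theta> * t / 2 * cmod z)" .
  qed (use M assms th cosn in \<open>auto simp: mult_neg_pos\<close>)
qed

text \<open>Subtracting z^k / z changes nothing as long as this is a polynomial, that is for k \<ge>
  1; for k = 0 the pole of 1 / z would contribute the identity operator. The difference carries the
  factor l / |g|, and dividing by g lowers p by 1 + \<alpha> - \<beta>, which is gained as a power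
  of t.\<close>

lemma evol_decay_bound:
  assumes T: "0 < T" and k: "1 \<le> k"
  obtains C where "0 < C"
    "\<And>\<theta> \<delta> l t. pi / 2 < \<theta> \<Longrightarrow> \<theta> < \<Theta> \<Longrightarrow> 0 < \<delta> \<Longrightarrow> 0 \<le> l \<Longrightarrow> 0 < t \<Longrightarrow> t \<le> T \<Longrightarrow>
       norm (evol \<theta> \<delta> k l t) \<le> C * l * t powr (- real k + (\<alpha> - \<beta> + 1))"
proof -
  obtain D where D: "0 < D"
    "\<And>z. z \<in> sector \<kappa> \<Longrightarrow> 1 / T \<le> cmod z \<Longrightarrow> cmod z powr (1 + \<alpha> - \<beta>) \<le> D * norm (g z)"
    using norm_g_bounds[OF T less_imp_le \<kappa>_bounds(2), OF \<kappa>_bounds(3)] by metis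
  define q where "q = 1 + \<alpha> - \<beta>"
  define p where "p = real k - 1 - q"
  show ?thesis
  proof (rule that[of "hankel_const \<kappa> p * (M0 * D)"])
    show "0 < hankel_const \<kappa> p * (M0 * D)"
      using hankel_const_pos \<kappa>_bounds M0_pos D by simp
    fix \<theta> \<delta> l t :: real assume *: "pi / 2 < \<theta>" "\<theta> < \<Theta>" "0 < \<delta>" "0 \<le> l" "0 < t" and "t \<le> T"
    have t1: "0 < 1 / t" using * by simp
    let ?h2 = "\<lambda>z::complex. exp (z * of_real t) * z ^ (k - 1)"
    have "cmod 1 * norm (evol \<theta> \<delta> k l t) \<le> hankel_const \<kappa> p * (M0 * D * l) * t powr (- p - 1)"
    proof (rule evol_le[OF *])
      have cosn: "cos \<kappa> < 0" using cos_neg \<kappa>_bounds by simp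
      have "hankel_integrable \<kappa> (1 / t) ?h2"
      proof (rule hankel_dominated_integrable[OF hankel_dominated_exp_mult[OF \<kappa>_bounds(1,4) t1 *(5), of 1]])
        fix z :: complex
        have "cmod z ^ (k - 1) * 1 \<le> cmod z ^ (k - 1) * exp (- cos \<kappa> * t / 2 * cmod z)"
          using * cosn by (intro mult_left_mono) (auto simp: mult_nonpos_nonneg)
        then show "norm (z ^ (k - 1)) \<le> 1 * cmod z ^ (k - 1) * exp (- cos \<kappa> * t / 2 * cmod z)"
          by (simp add: norm_power)
      qed (use * \<kappa>_bounds cosn in \<open>auto intro!: continuous_intros simp: mult_neg_pos\<close>)
      moreover have "hankel \<kappa> (1 / t) ?h2 = 0"
        using hankel_power_exp_eq_0[OF \<kappa>_bounds(1,4) t1 *(5), of "k - 1"] by (simp add: mult.commute)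
      ultimately have "hankel \<kappa> (1 / t) (integrand k l t) = hankel \<kappa> (1 / t) (\<lambda>z. integrand k l t z - ?h2 z)"
        using hankel_diff(1)[OF evol_integrand_integrable[OF \<kappa>_bounds(1,2) t1 *(5,4)]] by simp
      then show "1 * hankel \<kappa> (1 / t) (integrand k l t) =
          hankel \<kappa> (1 / t) (\<lambda>z. exp (z * of_real t) * (z ^ k * symb l z - z ^ (k - 1)))"
        by (simp add: right_diff_distrib)
      show "0 \<le> M0 * D * l" using M0_pos D * by simp
      show "continuous_on (hankel_contour \<kappa> (1 / t)) (\<lambda>z. z ^ k * symb l z - z ^ (k - 1))"
        by (intro continuous_intros symb_continuous) (use * \<kappa>_bounds in auto)
      fix z assume z: "z \<in> sector \<kappa>" "1 / t \<le> cmod z"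
      define r where "r = cmod z"
      have r: "0 < r" using z(1) by (auto elim: sectorE simp: r_def)
      have z0: "z \<noteq> 0" using r by (auto simp: r_def)
      have "1 / T \<le> 1 / t" using * \<open>t \<le> T\<close> T by (simp add: frac_le)
      then have gg: "r powr q \<le> D * norm (g z)" using D(2)[OF z(1)] z(2) by (simp add: q_def r_def)
      have g0: "0 < norm (g z)" by (rule norm_g_add_ge(2)[OF z(1) \<kappa>_bounds(2) *(4)])
      have "z ^ k * symb l z - z ^ (k - 1) = - (z ^ k * (1 / z - symb l z))"
        using z0 k by (cases k) (auto simp: algebra_simps)
      then have "norm (z ^ k * symb l z - z ^ (k - 1)) = r ^ k * norm (1 / z - symb l z)"
        by (simp add: norm_mult norm_power r_def)
      also have "\<dots> \<le> r ^ k * (M0 * l / (r * norm (g z)))"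
        unfolding M0_def r_def
        by (intro mult_left_mono norm_symb_le(3)[OF z(1) \<kappa>_bounds(2) *(4)]) simp
      also have "\<dots> = M0 * l * (r ^ k / r) * (1 / norm (g z))" by simp
      also have "1 / norm (g z) \<le> D * r powr (- q)"
        using gg g0 r by (simp add: powr_minus field_simps)
      then have "M0 * l * (r ^ k / r) * (1 / norm (g z)) \<le> M0 * l * (r ^ k / r) * (D * r powr (- q))"
        using M0_pos * r by (intro mult_left_mono) auto
      also have "\<dots> = M0 * D * l * (r ^ k / r * r powr (- q))" by simp
      also have "r ^ k / r * r powr (- q) = r powr p"
        unfolding power_divide_powr[OF r] p_def by (simp only: powr_add[symmetric] diff_conv_add_uminus)
      finally show "norm (z ^ k * symb l z - z ^ (k - 1)) \<le> M0 * D * l * cmod z powr p"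
        by (simp add: r_def)
    qed
    moreover have "- p - 1 = - real k + (\<alpha> - \<beta> + 1)" by (simp add: p_def q_def)
    ultimately show "norm (evol \<theta> \<delta> k l t) \<le> hankel_const \<kappa> p * (M0 * D) * l * t powr (- real k + (\<alpha> - \<beta> + 1))"
      by (simp add: mult_ac)
  qed
qed

text \<open>The constants C and \<epsilon> are the same for all l, so the remainder estimate can be
  summed over the eigenbasis. The whole difference is one Hankel integral whose integrand contains
  exp w - 1 - w at w = z (s - t).\<close>

lemma evol_taylor:
  assumes "pi / 2 < \<theta>" "\<theta> < \<Theta>" "0 < \<delta>" "0 < t"
  obtains C \<epsilon> where "0 \<le> C" "0 < \<epsilon>" "\<epsilon> < t"
    "\<And>l s. 0 \<le> l \<Longrightarrow> \<bar>s - t\<bar> \<le> \<epsilon> \<Longrightarrow>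
       norm (evol \<theta> \<delta> k l s - evol \<theta> \<delta> k l t - of_real (s - t) * evol \<theta> \<delta> (Suc k) l t) \<le> C * (s - t)\<^sup>2"
proof -
  have th: "0 \<le> \<theta>" "\<theta> \<le> pi" using assms \<Theta>_bounds pi_gt_zero by linarith+
  have cosn: "cos \<theta> < 0" using cos_neg assms(1) th(2) by simp
  \<comment> \<open>For |s - t| \<le> \<epsilon> the growth exp (|z| |s - t|) uses at most half of
    the decay rate - cos \<theta> * t, exactly what \<open>hankel_dominated_exp_mult\<close>
    permits. In addition \<epsilon> < t keeps s positive.\<close>
  define \<epsilon> where "\<epsilon> = - cos \<theta> * t / 2"
  have eps: "0 < \<epsilon>" "\<epsilon> < t"
  proof -
    show "0 < \<epsilon>" using cosn assms by (simp add: \<epsilon>_def mult_neg_pos)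
    have "- cos \<theta> * t \<le> 1 * t" using cos_ge_minus_one[of \<theta>] assms by (intro mult_right_mono) auto
    then show "\<epsilon> < t" using assms by (simp add: \<epsilon>_def)
  qed
  define c where "c = - cos \<theta> * t / 4"
  have c: "0 < c" using eps by (simp add: c_def \<epsilon>_def)
  \<comment> \<open>The power k + 2 consists of k factors z from the integrand and two from the
    quadratic remainder of the exponential.\<close>
  define K where "K = exp (2 * t * \<delta>) * (fact (k + 2) / c ^ (k + 2))"
  define M where "M = sector_const \<theta>"
  have M: "0 < M" unfolding M_def by (rule sector_const_pos) (use assms th in auto)
  define C where "C = K * (M / \<delta>) * (2 / c + 2 * \<theta> * \<delta>) / (2 * pi)"
  have C: "0 \<le> C" using c M assms th by (simp add: C_def K_def)
  show ?thesis
  proof (rule that[OF C eps])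
    fix l s :: real assume l: "0 \<le> l" and s: "\<bar>s - t\<bar> \<le> \<epsilon>"
    have s0: "0 < s" using s eps by linarith
    let ?r = "\<lambda>z. (exp (z * of_real (s - t)) - 1 - z * of_real (s - t)) * (z ^ k * symb l z)"
    have rdom: "hankel_dominated \<theta> \<delta> c (K * (M / \<delta> * (s - t)\<^sup>2)) (\<lambda>z. exp (z * of_real t) * ?r z)"
      unfolding c_def K_def
    proof (rule hankel_dominated_exp_mult[OF assms(1) th(2) assms(3,4)])
      show "continuous_on (hankel_contour \<theta> \<delta>) ?r"
        by (intro continuous_intros symb_continuous assms th l)
      fix z assume "z \<in> hankel_contour \<theta> \<delta>"
      note z = hankel_contour_sector[OF this th(1) assms(3)]
      define w where "w = z * of_real (s - t)"
      have nw: "norm w = cmod z * \<bar>s - t\<bar>" by (simp add: w_def norm_mult del: of_real_diff)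
      have w: "norm w \<le> - cos \<theta> * t / 2 * cmod z"
        unfolding nw using s mult_left_mono[of "\<bar>s - t\<bar>" \<epsilon> "cmod z"] by (simp add: \<epsilon>_def mult.commute)
      have "norm (symb l z) \<le> M / cmod z"
        unfolding M_def by (rule norm_symb_le(1)[OF z(1) assms(2) l])
      also have "\<dots> \<le> M / \<delta>" using z M assms by (intro frac_le) auto
      finally have sy: "norm (symb l z) \<le> M / \<delta>" .
      have "norm (exp w - 1 - w) \<le> exp (norm w) * (norm w)\<^sup>2" by (rule norm_exp_minus_linear_le)
      also have "\<dots> \<le> exp (- cos \<theta> * t / 2 * cmod z) * (norm w)\<^sup>2"
        using w by (intro mult_right_mono) auto
      finally have "norm (?r z) \<le> (exp (- cos \<theta> * t / 2 * cmod z) * (norm w)\<^sup>2) * (cmod z ^ k * (M / \<delta>))"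
        unfolding norm_mult norm_power w_def[symmetric] using sy M assms
        by (intro mult_mono) auto
      also have "\<dots> = M / \<delta> * (s - t)\<^sup>2 * cmod z ^ (k + 2) * exp (- cos \<theta> * t / 2 * cmod z)"
        by (simp add: nw power_mult_distrib power_add power2_eq_square mult_ac)
      finally show "norm (?r z) \<le> M / \<delta> * (s - t)\<^sup>2 * cmod z ^ (k + 2) * exp (- cos \<theta> * t / 2 * cmod z)" .
    qed (use M assms in auto)
    have e: "exp (z * of_real s) = exp (z * of_real t) * exp (z * of_real (s - t))" for z :: complex
      by (simp add: exp_add[symmetric] algebra_simps)
    have eq: "integrand k l s z - integrand k l t z - of_real (s - t) * integrand (Suc k) l t z = exp (z * of_real t) * ?r z" for z
      unfolding e by (simp add: algebra_simps)
    note int = evol_integrand_integrable[OF assms(1-3) _ l]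
    have "hankel \<theta> \<delta> (\<lambda>z. exp (z * of_real t) * ?r z) =
        hankel \<theta> \<delta> (integrand k l s) - hankel \<theta> \<delta> (integrand k l t) - of_real (s - t) * hankel \<theta> \<delta> (integrand (Suc k) l t)"
      unfolding eq[symmetric]
      by (simp only: hankel_diff hankel_cmult int[OF s0] int[OF assms(4)])
    then have "evol \<theta> \<delta> k l s - evol \<theta> \<delta> k l t - of_real (s - t) * evol \<theta> \<delta> (Suc k) l t =
        1 / (2 * of_real pi * \<i>) * hankel \<theta> \<delta> (\<lambda>z. exp (z * of_real t) * ?r z)"
      unfolding evol_def by (simp only: right_diff_distrib mult.left_commute[of "of_real (s - t)"])
    then have "norm (evol \<theta> \<delta> k l s - evol \<theta> \<delta> k l t - of_real (s - t) * evol \<theta> \<delta> (Suc k) l t) =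
        norm (hankel \<theta> \<delta> (\<lambda>z. exp (z * of_real t) * ?r z)) / (2 * pi)"
      by (simp add: norm_mult norm_divide)
    also have "\<dots> \<le> (K * (M / \<delta> * (s - t)\<^sup>2)) * (2 / c + 2 * \<theta> * \<delta>) / (2 * pi)"
      by (intro divide_right_mono norm_hankel_le[OF rdom th(1) assms(3) c]) auto
    also have "\<dots> = C * (s - t)\<^sup>2" by (simp add: C_def)
    finally show "norm (evol \<theta> \<delta> k l s - evol \<theta> \<delta> k l t - of_real (s - t) * evol \<theta> \<delta> (Suc k) l t) \<le> C * (s - t)\<^sup>2" .
  qed
qed

end

section \<open>The Hilbert space of square-integrable functions\<close>

lemma rep_L2: "sqint (rep_L2 u)" "abs_L2 (rep_L2 u) = u"
  using Quotient_rep_reflp[OF Quotient_L2, of u] Quotient_abs_rep[OF Quotient_L2, of u] by auto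

lemma abs_L2_add: "sqint f \<Longrightarrow> sqint h \<Longrightarrow> abs_L2 f + abs_L2 h = abs_L2 (\<lambda>x. f x + h x)"
  by (simp add: plus_L2.abs_eq)

lemma abs_L2_cscale: "sqint f \<Longrightarrow> c *\<^sub>C abs_L2 f = abs_L2 (\<lambda>x. c * f x)"
  by (simp add: cscale.abs_eq)

lemma cinner_abs_L2: "sqint f \<Longrightarrow> sqint h \<Longrightarrow> cinner (abs_L2 f) (abs_L2 h) = (LINT x|lborel. f x * cnj (h x))"
  by (simp add: cinner.abs_eq)

lemma sqint_diff: "sqint f \<Longrightarrow> sqint h \<Longrightarrow> sqint (\<lambda>x. f x - h x)"
  using sqint_add[OF _ sqint_cmult[of h "-1"], of f] by simp

lemma abs_L2_diff: "sqint f \<Longrightarrow> sqint h \<Longrightarrow> abs_L2 f - abs_L2 h = abs_L2 (\<lambda>x. f x - h x)"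
  using abs_L2_add[of f "\<lambda>x. - 1 * h x"] sqint_cmult[of h "- 1"]
  by (simp add: minus_L2_def abs_L2_cscale)

lemma norm_abs_L2:
  assumes "sqint f"
  shows "(norm (abs_L2 f))\<^sup>2 = (LINT x|lborel. (cmod (f x))\<^sup>2)"
proof -
  have "(norm (abs_L2 f))\<^sup>2 = Re (LINT x|lborel. f x * cnj (f x))"
    using assms by (simp add: power2_norm_eq_inner inner_L2_def cinner_abs_L2)
  also have "(\<lambda>x. f x * cnj (f x)) = (\<lambda>x. complex_of_real ((cmod (f x))\<^sup>2))"
    by (simp only: complex_norm_square)
  finally show ?thesis by (simp only: integral_complex_of_real Re_complex_of_real)
qed

lemma nn_integral_abs_L2:
  assumes "sqint f"
  shows "(\<integral>\<^sup>+x. ennreal ((cmod (f x))\<^sup>2) \<partial>lborel) = ennreal ((norm (abs_L2 f))\<^sup>2)"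
  unfolding norm_abs_L2[OF assms]
  using assms by (intro nn_integral_eq_integral) (auto simp: sqint_def)

lemma sqint_if_nn_integral_le:
  assumes [measurable]: "f \<in> borel_measurable lborel"
    and le: "(\<integral>\<^sup>+x. ennreal ((cmod (f x))\<^sup>2) \<partial>lborel) \<le> ennreal B"
  shows "sqint f" "0 \<le> B \<Longrightarrow> (norm (abs_L2 f))\<^sup>2 \<le> B"
proof -
  have "integrable lborel (\<lambda>x. (cmod (f x))\<^sup>2)"
    using le by (intro integrableI_nonneg) (auto intro: le_less_trans)
  then show s: "sqint f" unfolding sqint_def by simp
  show "(norm (abs_L2 f))\<^sup>2 \<le> B" if "0 \<le> B"
    using le that unfolding nn_integral_abs_L2[OF s] by simp
qed

text \<open>Riesz--Fischer: along a subsequence with steps below \<open>2\<^sup>-\<^sup>n\<close> the weighted sum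
  \<open>\<Sum>n. 2\<^sup>n \<bar>f\<^sub>n\<^sub>+\<^sub>1 - f\<^sub>n\<bar>\<^sup>2\<close> is integrable, which forces pointwise convergence almost everywhere.\<close>

instance L2 :: complete_space
proof
  fix X :: "nat \<Rightarrow> L2"
  assume X: "Cauchy X"
  have "\<forall>n. \<exists>N. \<forall>m\<ge>N. \<forall>k\<ge>N. norm (X m - X k) < (1 / 2) ^ n"
    using X by (simp add: Cauchy_iff)
  then obtain N where N: "\<And>n m k. N n \<le> m \<Longrightarrow> N n \<le> k \<Longrightarrow> norm (X m - X k) < (1 / 2) ^ n"
    by metis
  \<comment> \<open>Summing the thresholds gives r m \<ge> N n for all n \<le> m, so one subsequence
    serves every tolerance.\<close>
  define r where "r n = (\<Sum>i\<le>n. N i) + n" for n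
  have r: "N n \<le> r m" if "n \<le> m" for n m
    unfolding r_def using that member_le_sum[of n "{..m}" N] by auto
  define f where "f n = rep_L2 (X (r n))" for n
  have f: "sqint (f n)" "abs_L2 (f n) = X (r n)" for n by (simp_all add: f_def rep_L2)
  have [measurable]: "f n \<in> borel_measurable borel" for n using f(1)[of n] by (simp add: sqint_def)
  have step: "(\<integral>\<^sup>+x. ennreal ((cmod (f m x - f n x))\<^sup>2) \<partial>lborel) \<le> ennreal ((1 / 4) ^ n)" if "n \<le> m" for n m
  proof -
    have "norm (X (r m) - X (r n)) < (1 / 2) ^ n" using that by (intro N r) auto
    then have "(norm (X (r m) - X (r n)))\<^sup>2 \<le> ((1 / 2) ^ n)\<^sup>2" by (intro power_mono) auto
    also have "((1 / 2) ^ n)\<^sup>2 = ((1 / 4) ^ n :: real)"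
      by (simp add: power2_eq_square power_mult_distrib[symmetric])
    finally show ?thesis
      using f by (subst nn_integral_abs_L2) (auto intro!: sqint_diff simp flip: abs_L2_diff)
  qed
  have "(\<integral>\<^sup>+x. (\<Sum>n. ennreal (2 ^ n * (cmod (f (Suc n) x - f n x))\<^sup>2)) \<partial>lborel) =
      (\<Sum>n. \<integral>\<^sup>+x. ennreal (2 ^ n * (cmod (f (Suc n) x - f n x))\<^sup>2) \<partial>lborel)"
    by (rule nn_integral_suminf) measurable
  also have "\<dots> \<le> (\<Sum>n. ennreal ((1 / 2) ^ n))"
  proof (intro suminf_le summableI)
    fix n
    have "(\<integral>\<^sup>+x. ennreal (2 ^ n * (cmod (f (Suc n) x - f n x))\<^sup>2) \<partial>lborel) =
        ennreal (2 ^ n) * (\<integral>\<^sup>+x. ennreal ((cmod (f (Suc n) x - f n x))\<^sup>2) \<partial>lborel)"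
      by (subst nn_integral_cmult[symmetric]) (auto simp: ennreal_mult)
    also have "\<dots> \<le> ennreal (2 ^ n) * ennreal ((1 / 4) ^ n)"
      by (intro mult_left_mono step) auto
    also have "\<dots> = ennreal ((1 / 2) ^ n)"
      by (simp add: ennreal_mult[symmetric] power_mult_distrib[symmetric])
    finally show "(\<integral>\<^sup>+x. ennreal (2 ^ n * (cmod (f (Suc n) x - f n x))\<^sup>2) \<partial>lborel) \<le> ennreal ((1 / 2) ^ n)" .
  qed
  also have "\<dots> = ennreal (\<Sum>n. (1 / 2) ^ n)"
    by (rule suminf_ennreal2) (auto intro: summable_geometric)
  finally have "(\<integral>\<^sup>+x. (\<Sum>n. ennreal (2 ^ n * (cmod (f (Suc n) x - f n x))\<^sup>2)) \<partial>lborel) \<noteq> \<infinity>"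
    by (auto simp: top_unique)
  then have "AE x in lborel. (\<Sum>n. ennreal (2 ^ n * (cmod (f (Suc n) x - f n x))\<^sup>2)) \<noteq> \<infinity>"
    by (intro nn_integral_noteq_infinite) measurable
  then have conv: "AE x in lborel. convergent (\<lambda>n. f n x)"
  proof eventually_elim
    case (elim x)
    then have "summable (\<lambda>n. 2 ^ n * (cmod (f (Suc n) x - f n x))\<^sup>2)"
      by (intro summable_suminf_not_top) auto
    then have "summable (\<lambda>n. 2 ^ n * (cmod (f (Suc n) x - f n x))\<^sup>2 + (1 / 2) ^ n)"
      by (intro summable_add summable_geometric) auto
    \<comment> \<open>This is x \<le> x^2 + 1 for x = 2^n h, divided by 2^n. It converts summable
      weighted squares into summable steps.\<close>
    moreover have "norm (f (Suc n) x - f n x) \<le> 2 ^ n * (cmod (f (Suc n) x - f n x))\<^sup>2 + (1 / 2) ^ n" for n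
    proof -
      define h where "h = cmod (f (Suc n) x - f n x)"
      have "(2 ^ n * h)\<^sup>2 - 2 ^ n * h + 1 \<ge> 0"
        using zero_le_power2[of "2 ^ n * h - 1/2"] by (simp add: power2_eq_square algebra_simps)
      then have "2 ^ n * h \<le> 2 ^ n * (2 ^ n * h\<^sup>2 + (1 / 2) ^ n)"
        by (simp add: power2_eq_square algebra_simps power_mult_distrib[symmetric])
      then have "h \<le> 2 ^ n * h\<^sup>2 + (1 / 2) ^ n" by simp
      then show ?thesis by (simp add: h_def)
    qed
    ultimately have "summable (\<lambda>n. f (Suc n) x - f n x)"
      by (rule summable_comparison_test'[where N = 0])
    then have "convergent (\<lambda>n. \<Sum>i<n. f (Suc i) x - f i x)"
      by (simp add: summable_iff_convergent)
    then have "convergent (\<lambda>n. f n x - f 0 x)"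
      using sum_lessThan_telescope[of "\<lambda>n. f n x"] by simp
    then show ?case
      by (simp add: convergent_diff_const_right_iff)
  qed
  define F where "F x = lim (\<lambda>n. f n x)" for x
  have [measurable]: "F \<in> borel_measurable borel"
    unfolding F_def by measurable
  \<comment> \<open>Fatou's lemma carries the step bound to the limit m \<rightarrow> \<infinity>.
    The same inequality yields square integrability of F and the rate of convergence.\<close>
  have le: "(\<integral>\<^sup>+x. ennreal ((cmod (F x - f n x))\<^sup>2) \<partial>lborel) \<le> ennreal ((1 / 4) ^ n)" for n
  proof -
    have "AE x in lborel. ennreal ((cmod (F x - f n x))\<^sup>2) = liminf (\<lambda>m. ennreal ((cmod (f m x - f n x))\<^sup>2))"
      using conv
    proof eventually_elim
      case (elim x)
      then have "(\<lambda>m. f m x) \<longlonglongrightarrow> F x" unfolding F_def by (simp add: convergent_LIMSEQ_iff)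
      then have "(\<lambda>m. ennreal ((cmod (f m x - f n x))\<^sup>2)) \<longlonglongrightarrow> ennreal ((cmod (F x - f n x))\<^sup>2)"
        by (intro tendsto_intros)
      from lim_imp_Liminf[OF trivial_limit_sequentially this] show ?case by simp
    qed
    then have "(\<integral>\<^sup>+x. ennreal ((cmod (F x - f n x))\<^sup>2) \<partial>lborel) =
        (\<integral>\<^sup>+x. liminf (\<lambda>m. ennreal ((cmod (f m x - f n x))\<^sup>2)) \<partial>lborel)"
      by (rule nn_integral_cong_AE)
    also have "\<dots> \<le> liminf (\<lambda>m. \<integral>\<^sup>+x. ennreal ((cmod (f m x - f n x))\<^sup>2) \<partial>lborel)"
      by (rule nn_integral_liminf) measurable
    also have "\<dots> \<le> liminf (\<lambda>m::nat. ennreal ((1 / 4) ^ n))"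
      using step by (intro Liminf_mono) (auto simp: eventually_sequentially)
    finally show ?thesis by (simp add: Liminf_const)
  qed
  have diff: "sqint (\<lambda>x. F x - f n x)" for n
    by (rule sqint_if_nn_integral_le(1)[OF _ le]) measurable
  have F: "sqint F" using sqint_add[OF diff[of 0] f(1)[of 0]] by simp
  have rate: "norm (abs_L2 F - X (r n)) \<le> (1 / 2) ^ n" for n
  proof -
    have "(norm (abs_L2 (\<lambda>x. F x - f n x)))\<^sup>2 \<le> (1 / 4) ^ n"
      by (rule sqint_if_nn_integral_le(2)[OF _ le]) simp_all
    also have "(1 / 4) ^ n = (((1 / 2) ^ n)\<^sup>2 :: real)"
      by (simp add: power2_eq_square power_mult_distrib[symmetric])
    finally have "norm (abs_L2 (\<lambda>x. F x - f n x)) \<le> (1 / 2) ^ n"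
      by (rule power2_le_imp_le) simp
    then show ?thesis using f F by (simp flip: abs_L2_diff)
  qed
  have "X \<longlonglongrightarrow> abs_L2 F"
  proof (rule metric_LIMSEQ_I)
    fix e :: real assume e: "0 < e"
    obtain n where n: "(1 / 2) ^ n < e / 2" using real_arch_pow_inv[of "e / 2" "1 / 2"] e by auto
    have "dist (X m) (abs_L2 F) < e" if "r n \<le> m" for m
    proof -
      have "norm (X m - X (r n)) < (1 / 2) ^ n" using that r[of n n] by (intro N) auto
      then have "norm (X m - X (r n)) + norm (X (r n) - abs_L2 F) < e"
        using n rate[of n] by (simp add: norm_minus_commute)
      then show ?thesis unfolding dist_norm using norm_triangle_ineq[of "X m - X (r n)" "X (r n) - abs_L2 F"] by simp
    qed
    then show "\<exists>n0. \<forall>m\<ge>n0. dist (X m) (abs_L2 F) < e" by blast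
  qed
  then show "convergent X" by (rule convergentI)
qed

instance L2 :: banach ..

section \<open>Complex scalars and the complex inner product\<close>

lemma cscale_add_right: "c *\<^sub>C (u + v) = c *\<^sub>C u + c *\<^sub>C v"
  by transfer (auto intro!: sqint_add sqint_cmult simp: distrib_left)

lemma cscale_add_left: "(c + d) *\<^sub>C u = c *\<^sub>C u + d *\<^sub>C u"
  by transfer (auto intro!: sqint_add sqint_cmult simp: distrib_right)

lemma cscale_cscale [simp]: "c *\<^sub>C d *\<^sub>C u = (c * d) *\<^sub>C u"
  by transfer (auto intro!: sqint_cmult simp: mult.assoc)

lemma cscale_one [simp]: "1 *\<^sub>C u = u"
  by transfer auto

lemma cscale_of_real: "of_real r *\<^sub>C u = r *\<^sub>R u"
  by (simp add: scaleR_L2_def)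

lemma cscale_zero_left [simp]: "0 *\<^sub>C u = 0"
  using cscale_of_real[of 0 u] by simp

lemma cscale_minus_one: "(-1) *\<^sub>C u = - u"
  by (simp add: uminus_L2_def)

lemma cscale_diff_right: "c *\<^sub>C (u - v) = c *\<^sub>C u - c *\<^sub>C v"
  by (simp add: minus_L2_def cscale_add_right mult.commute)

lemma cscale_scaleR_right: "c *\<^sub>C (r *\<^sub>R u) = r *\<^sub>R (c *\<^sub>C u)"
  by (simp add: scaleR_L2_def mult.commute)

lemma cscale_scaleR_left: "(r *\<^sub>R c) *\<^sub>C u = r *\<^sub>R (c *\<^sub>C u)"
  by (simp add: scaleR_L2_def scaleR_conv_of_real)

lemma cinner_add_left: "cinner (u + v) w = cinner u w + cinner v w"
  by transfer (simp add: distrib_right sqint_mult_cnj)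

lemma cinner_cscale_left: "cinner (c *\<^sub>C u) w = c * cinner u w"
  by transfer (simp add: mult.assoc)

lemma cinner_commute: "cinner u v = cnj (cinner v u)"
proof transfer
  fix f h :: "real^2 \<Rightarrow> complex"
  have "(LINT x|lborel. f x * cnj (h x)) = (LINT x|lborel. cnj (h x * cnj (f x)))"
    by (simp add: mult.commute)
  also have "\<dots> = cnj (LINT x|lborel. h x * cnj (f x))"
    by (rule Bochner_Integration.integral_cnj)
  finally show "(LINT x|lborel. f x * cnj (h x)) = cnj (LINT x|lborel. h x * cnj (f x))" .
qed

lemma cinner_add_right: "cinner u (v + w) = cinner u v + cinner u w"
  by (subst (1 2 3) cinner_commute) (simp add: cinner_add_left)

lemma cinner_cscale_right: "cinner u (c *\<^sub>C w) = cnj c * cinner u w"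
  by (subst (1 2) cinner_commute) (simp add: cinner_cscale_left)

lemma cinner_scaleR_left: "cinner (r *\<^sub>R u) w = r *\<^sub>R cinner u w"
  by (simp add: scaleR_L2_def cinner_cscale_left scaleR_conv_of_real)

lemma cinner_scaleR_right: "cinner u (r *\<^sub>R w) = r *\<^sub>R cinner u w"
  by (simp add: scaleR_L2_def cinner_cscale_right scaleR_conv_of_real)

lemma cinner_self: "cinner u u = of_real ((norm u)\<^sup>2)"
proof -
  have "cinner u u = cnj (cinner u u)" by (rule cinner_commute)
  then have "Im (cinner u u) = 0" by (metis Reals_cnj_iff complex_is_Real_iff)
  then show ?thesis by (simp add: complex_eq_iff power2_norm_eq_inner inner_L2_def)
qed

lemma norm_cscale: "norm (c *\<^sub>C u) = cmod c * norm u"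
proof -
  have "complex_of_real ((norm (c *\<^sub>C u))\<^sup>2) = (c * cnj c) * of_real ((norm u)\<^sup>2)"
    unfolding cinner_self[symmetric] by (simp add: cinner_cscale_left cinner_cscale_right mult_ac)
  also have "\<dots> = of_real ((cmod c * norm u)\<^sup>2)"
    by (simp add: complex_norm_square[symmetric] power_mult_distrib)
  finally have "(norm (c *\<^sub>C u))\<^sup>2 = (cmod c * norm u)\<^sup>2" by (simp only: of_real_eq_iff)
  then show ?thesis by (simp add: power2_eq_iff_nonneg)
qed

text \<open>The real Cauchy-Schwarz inequality is applied after rotating u by the unit scalar that
  makes the product real and nonnegative.\<close>

lemma cinner_bound: "cmod (cinner u v) \<le> norm u * norm v"
proof (cases "cinner u v = 0")
  case False
  define c where "c = cnj (sgn (cinner u v))"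
  have "cmod c = 1" using False by (simp add: c_def norm_sgn)
  have "c * cinner u v = of_real (cmod (cinner u v))"
    using False by (simp add: c_def sgn_eq complex_norm_square[symmetric] field_simps power2_eq_square mult.commute[of "cnj _"])
  then have "cmod (cinner u v) = inner (c *\<^sub>C u) v"
    by (simp add: inner_L2_def cinner_cscale_left)
  also have "\<dots> \<le> norm (c *\<^sub>C u) * norm v" by (rule norm_cauchy_schwarz)
  finally show ?thesis using \<open>cmod c = 1\<close> by (simp add: norm_cscale)
qed simp

lemma bounded_bilinear_cinner: "bounded_bilinear cinner"
  by (rule bounded_bilinear.intro)
     (auto simp: cinner_add_left cinner_add_right cinner_scaleR_left cinner_scaleR_right
       intro!: exI[of _ 1] cinner_bound)

lemma bounded_bilinear_cscale: "bounded_bilinear cscale"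
  by (rule bounded_bilinear.intro)
     (auto simp: cscale_add_left cscale_add_right cscale_scaleR_left cscale_scaleR_right norm_cscale
       intro!: exI[of _ 1])

lemmas bounded_linear_cinner_left = bounded_bilinear.bounded_linear_left[OF bounded_bilinear_cinner]
lemmas continuous_on_cscale [continuous_intros] = bounded_bilinear.continuous_on[OF bounded_bilinear_cscale]
lemmas tendsto_cinner [tendsto_intros] = bounded_bilinear.tendsto[OF bounded_bilinear_cinner]
lemmas cinner_zero_left [simp] = bounded_bilinear.zero_left[OF bounded_bilinear_cinner]
lemmas cinner_diff_left = bounded_bilinear.diff_left[OF bounded_bilinear_cinner]
lemmas cinner_minus_left = bounded_bilinear.minus_left[OF bounded_bilinear_cinner]
lemmas cinner_sum_left = bounded_bilinear.sum_left[OF bounded_bilinear_cinner]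
lemmas cinner_sum_right = bounded_bilinear.sum_right[OF bounded_bilinear_cinner]

section \<open>Restriction to the domain\<close>

lemma sqint_restrict:
  assumes "sqint f"
  shows "sqint (\<lambda>x. if \<Omega> \<in> sets borel \<and> x \<in> \<Omega> then f x else 0)"
proof (cases "\<Omega> \<in> sets borel")
  case True
  have [measurable]: "f \<in> borel_measurable borel" using assms by (simp add: sqint_def)
  have "integrable lborel (\<lambda>x. indicator \<Omega> x *\<^sub>R (cmod (f x))\<^sup>2)"
    using assms True by (intro integrable_mult_indicator) (auto simp: sqint_def)
  moreover have "(\<lambda>x. indicator \<Omega> x *\<^sub>R (cmod (f x))\<^sup>2) = (\<lambda>x. (cmod (if \<Omega> \<in> sets borel \<and> x \<in> \<Omega> then f x else 0))\<^sup>2)"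
    using True by (auto simp: indicator_def)
  moreover have "(\<lambda>x. if \<Omega> \<in> sets borel \<and> x \<in> \<Omega> then f x else 0) \<in> borel_measurable lborel"
    using True by measurable
  ultimately show ?thesis by (simp add: sqint_def)
qed (use sqint_zero in simp)

text \<open>The orthogonal projection onto \<open>L2_on \<Omega>\<close> for Borel \<Omega>. As its
  set of fixed points that subspace is closed, and integrals of functions with values in it remain
  in it. For other \<Omega> the test inside the definition yields 0, which keeps the map total
  without losing measurability.\<close>

lift_definition restrict_L2 :: "(real^2) set \<Rightarrow> L2 \<Rightarrow> L2" is
  "\<lambda>\<Omega> f x. if \<Omega> \<in> sets borel \<and> x \<in> \<Omega> then f x else 0"
  by (auto intro: sqint_restrict elim: eventually_mono)

lemma restrict_L2_add: "restrict_L2 \<Omega> (u + v) = restrict_L2 \<Omega> u + restrict_L2 \<Omega> v"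
proof transfer
  fix \<Omega> :: "(real^2) set" and f h :: "real^2 \<Rightarrow> complex"
  assume "sqint f \<and> sqint f \<and> (AE x in lborel. f x = f x)" "sqint h \<and> sqint h \<and> (AE x in lborel. h x = h x)"
  then have "sqint (\<lambda>x. f x + h x)" "sqint f" "sqint h" by (auto intro: sqint_add)
  from this[THEN sqint_restrict[of _ \<Omega>]]
  show "sqint (\<lambda>x. if \<Omega> \<in> sets borel \<and> x \<in> \<Omega> then f x + h x else 0) \<and>
      sqint (\<lambda>x. (if \<Omega> \<in> sets borel \<and> x \<in> \<Omega> then f x else 0) + (if \<Omega> \<in> sets borel \<and> x \<in> \<Omega> then h x else 0)) \<and>
      (AE x in lborel. (if \<Omega> \<in> sets borel \<and> x \<in> \<Omega> then f x + h x else 0) =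
        (if \<Omega> \<in> sets borel \<and> x \<in> \<Omega> then f x else 0) + (if \<Omega> \<in> sets borel \<and> x \<in> \<Omega> then h x else 0))"
    by (auto intro!: AE_I2 sqint_add)
qed

lemma restrict_L2_cscale: "restrict_L2 \<Omega> (c *\<^sub>C u) = c *\<^sub>C restrict_L2 \<Omega> u"
proof transfer
  fix \<Omega> :: "(real^2) set" and c and f :: "real^2 \<Rightarrow> complex"
  assume "sqint f \<and> sqint f \<and> (AE x in lborel. f x = f x)"
  then have "sqint (\<lambda>x. c * f x)" "sqint f" by (auto intro: sqint_cmult)
  from this[THEN sqint_restrict[of _ \<Omega>]]
  show "sqint (\<lambda>x. if \<Omega> \<in> sets borel \<and> x \<in> \<Omega> then c * f x else 0) \<and>
      sqint (\<lambda>x. c * (if \<Omega> \<in> sets borel \<and> x \<in> \<Omega> then f x else 0)) \<and>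
      (AE x in lborel. (if \<Omega> \<in> sets borel \<and> x \<in> \<Omega> then c * f x else 0) =
        c * (if \<Omega> \<in> sets borel \<and> x \<in> \<Omega> then f x else 0))"
    by (auto intro!: AE_I2 sqint_cmult)
qed

lemma norm_restrict_L2_le: "norm (restrict_L2 \<Omega> u) \<le> norm u"
proof (rule power2_le_imp_le)
  define f where "f = rep_L2 u"
  have f: "sqint f" "abs_L2 f = u" by (simp_all add: f_def rep_L2)
  have "restrict_L2 \<Omega> u = abs_L2 (\<lambda>x. if \<Omega> \<in> sets borel \<and> x \<in> \<Omega> then f x else 0)"
    unfolding f(2)[symmetric] using f(1) by (simp add: restrict_L2.abs_eq)
  moreover have "(LINT x|lborel. (cmod (if \<Omega> \<in> sets borel \<and> x \<in> \<Omega> then f x else 0))\<^sup>2) \<le> (LINT x|lborel. (cmod (f x))\<^sup>2)"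
    using f(1) sqint_restrict[OF f(1), of \<Omega>] by (intro integral_mono) (auto simp: sqint_def)
  ultimately show "(norm (restrict_L2 \<Omega> u))\<^sup>2 \<le> (norm u)\<^sup>2"
    using f sqint_restrict[OF f(1), of \<Omega>] by (simp add: norm_abs_L2[symmetric])
qed simp

lemma bounded_linear_restrict_L2: "bounded_linear (restrict_L2 \<Omega>)"
  by (rule bounded_linear_intro[where K = 1])
     (auto simp: restrict_L2_add scaleR_L2_def restrict_L2_cscale norm_restrict_L2_le)

lemma L2_on_iff:
  assumes "\<Omega> \<in> sets borel"
  shows "u \<in> L2_on \<Omega> \<longleftrightarrow> restrict_L2 \<Omega> u = u"
  unfolding L2_on_def mem_Collect_eq using assms
proof transfer
  fix \<Omega> :: "(real^2) set" and f :: "real^2 \<Rightarrow> complex"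
  assume *: "sqint f \<and> sqint f \<and> (AE x in lborel. f x = f x)" and "\<Omega> \<in> sets borel"
  show "(AE x in lborel. x \<notin> \<Omega> \<longrightarrow> f x = 0) =
      (sqint (\<lambda>x. if \<Omega> \<in> sets borel \<and> x \<in> \<Omega> then f x else 0) \<and> sqint f \<and>
       (AE x in lborel. (if \<Omega> \<in> sets borel \<and> x \<in> \<Omega> then f x else 0) = f x))"
    using * sqint_restrict[of f \<Omega>] \<open>\<Omega> \<in> sets borel\<close> by (auto elim!: eventually_mono)
qed

lemma L2_on_add: "u \<in> L2_on \<Omega> \<Longrightarrow> v \<in> L2_on \<Omega> \<Longrightarrow> u + v \<in> L2_on \<Omega>"
  unfolding L2_on_def mem_Collect_eq by transfer (auto elim: eventually_elim2)

lemma L2_on_cscale: "u \<in> L2_on \<Omega> \<Longrightarrow> c *\<^sub>C u \<in> L2_on \<Omega>"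
  unfolding L2_on_def mem_Collect_eq by transfer (auto elim: eventually_mono)

lemma L2_on_diff: "u \<in> L2_on \<Omega> \<Longrightarrow> v \<in> L2_on \<Omega> \<Longrightarrow> u - v \<in> L2_on \<Omega>"
  by (simp add: minus_L2_def L2_on_add L2_on_cscale)

lemma closed_L2_on:
  assumes "\<Omega> \<in> sets borel"
  shows "closed (L2_on \<Omega>)"
proof -
  have "L2_on \<Omega> = {u. restrict_L2 \<Omega> u = u}" using L2_on_iff[OF assms] by auto
  then show ?thesis
    by (auto intro!: closed_Collect_eq continuous_intros linear_continuous_on bounded_linear_restrict_L2)
qed

section \<open>Orthonormal systems\<close>

definition orthonormal :: "(nat \<Rightarrow> L2) \<Rightarrow> bool" where
  "orthonormal \<phi> \<longleftrightarrow> (\<forall>i j. cinner (\<phi> i) (\<phi> j) = (if i = j then 1 else 0))"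

lemma orthonormal_cinner_sum:
  assumes "orthonormal \<phi>" "finite A"
  shows "cinner (\<Sum>j\<in>A. c j *\<^sub>C \<phi> j) (\<phi> i) = (if i \<in> A then c i else 0)"
proof -
  have "cinner (\<Sum>j\<in>A. c j *\<^sub>C \<phi> j) (\<phi> i) = (\<Sum>j\<in>A. if j = i then c j else 0)"
    unfolding cinner_sum_left cinner_cscale_left
    using assms by (intro sum.cong) (auto simp: orthonormal_def)
  then show ?thesis using assms by (simp add: sum.delta)
qed

lemma orthonormal_norm_sum:
  assumes "orthonormal \<phi>" "finite A"
  shows "(norm (\<Sum>j\<in>A. c j *\<^sub>C \<phi> j))\<^sup>2 = (\<Sum>j\<in>A. (cmod (c j))\<^sup>2)"
proof -
  have "complex_of_real ((norm (\<Sum>j\<in>A. c j *\<^sub>C \<phi> j))\<^sup>2) = (\<Sum>i\<in>A. cnj (c i) * (if i \<in> A then c i else 0))"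
    unfolding cinner_self[symmetric] cinner_sum_right cinner_cscale_right
    by (simp only: orthonormal_cinner_sum[OF assms])
  also have "\<dots> = (\<Sum>i\<in>A. of_real ((cmod (c i))\<^sup>2))"
    by (intro sum.cong) (auto simp: complex_norm_square mult.commute simp del: of_real_power)
  finally show ?thesis by (simp only: of_real_sum[symmetric] of_real_eq_iff)
qed

text \<open>By Pythagoras, blocks of the vector series have the squared norms of blocks of a
  convergent real series, so the Cauchy criterion transfers.\<close>

lemma orthonormal_summable:
  assumes "orthonormal \<phi>" "summable (\<lambda>j. (cmod (c j))\<^sup>2)"
  shows "summable (\<lambda>j. c j *\<^sub>C \<phi> j)"
  unfolding summable_Cauchy
proof (intro allI impI)
  fix e :: real assume e: "0 < e"
  then obtain N where N: "\<And>m n. N \<le> m \<Longrightarrow> norm (\<Sum>j=m..<n. (cmod (c j))\<^sup>2) < e\<^sup>2"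
    using assms(2) unfolding summable_Cauchy by (meson zero_less_power)
  have "norm (\<Sum>j=m..<n. c j *\<^sub>C \<phi> j) < e" if "N \<le> m" for m n
    using N[OF that, of n] e orthonormal_norm_sum[OF assms(1), of "{m..<n}" c]
    by (intro power2_less_imp_less[of _ e]) (auto simp: sum_nonneg)
  then show "\<exists>N. \<forall>m\<ge>N. \<forall>n. norm (\<Sum>j=m..<n. c j *\<^sub>C \<phi> j) < e" by blast
qed

lemma orthonormal_cinner_suminf:
  assumes "orthonormal \<phi>" "summable (\<lambda>j. c j *\<^sub>C \<phi> j)"
  shows "cinner (\<Sum>j. c j *\<^sub>C \<phi> j) (\<phi> i) = c i"
proof -
  have "(\<lambda>n. cinner (\<Sum>j<n. c j *\<^sub>C \<phi> j) (\<phi> i)) \<longlonglongrightarrow> cinner (\<Sum>j. c j *\<^sub>C \<phi> j) (\<phi> i)"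
    by (intro tendsto_intros summable_LIMSEQ assms)
  moreover have "\<forall>\<^sub>F n in sequentially. cinner (\<Sum>j<n. c j *\<^sub>C \<phi> j) (\<phi> i) = c i"
    using eventually_gt_at_top[of i]
    by eventually_elim (simp add: orthonormal_cinner_sum[OF assms(1)])
  ultimately show ?thesis
    using tendsto_eventually LIMSEQ_unique by metis
qed

text \<open>The partial expansion p satisfies (p, v) = |p|^2, and Cauchy-Schwarz then gives |p|
  \<le> |v|.\<close>

lemma bessel:
  assumes "orthonormal \<phi>"
  shows "summable (\<lambda>j. (cmod (cinner v (\<phi> j)))\<^sup>2)"
proof (rule summableI_nonneg_bounded)
  fix n
  define p where "p = (\<Sum>j<n. cinner v (\<phi> j) *\<^sub>C \<phi> j)"
  have "cinner p v = (\<Sum>j<n. cinner v (\<phi> j) * cnj (cinner v (\<phi> j)))"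
    unfolding p_def cinner_sum_left cinner_cscale_left by (subst (3) cinner_commute) simp
  also have "\<dots> = of_real (\<Sum>j<n. (cmod (cinner v (\<phi> j)))\<^sup>2)"
    by (simp only: of_real_sum complex_norm_square)
  also have "\<dots> = of_real ((norm p)\<^sup>2)"
    unfolding p_def by (simp add: orthonormal_norm_sum[OF assms])
  finally have "(norm p)\<^sup>2 \<le> norm p * norm v"
    using cinner_bound[of p v] by (simp add: norm_power)
  then have "norm p \<le> norm v"
    by (cases "norm p = 0") (auto simp: power2_eq_square)
  then have "(norm p)\<^sup>2 \<le> (norm v)\<^sup>2" by (intro power_mono) auto
  then show "(\<Sum>j<n. (cmod (cinner v (\<phi> j)))\<^sup>2) \<le> (norm v)\<^sup>2"
    unfolding p_def by (simp add: orthonormal_norm_sum[OF assms])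
qed simp

section \<open>The Dirichlet Laplacian in its eigenbasis\<close>

lemma pdiff_eq: "(f has_derivative f') (at x) \<Longrightarrow> pdiff i f x = f' (axis i 1)"
  by (simp add: pdiff_def frechet_derivative_at[symmetric])

lemma smoothD: "smooth f \<Longrightarrow> foldr pdiff is f differentiable (at x)"
  by (simp add: smooth_def)

lemma smooth_differentiable: "smooth f \<Longrightarrow> f differentiable (at x)"
  using smoothD[of f "[]"] by simp

lemma smooth_pdiff:
  assumes "smooth f"
  shows "smooth (pdiff i f)"
  unfolding smooth_def
proof (intro allI)
  fix "is" x
  show "foldr pdiff is (pdiff i f) differentiable (at x)"
    using smoothD[OF assms, of "is @ [i]" x] by simp
qed

lemma smooth_continuous_on: "smooth f \<Longrightarrow> continuous_on S f"
  by (intro continuous_at_imp_continuous_on ballI differentiable_imp_continuous_within smooth_differentiable)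

lemma pdiff_linear:
  assumes "f differentiable (at x)" "h differentiable (at x)"
  shows "pdiff i (\<lambda>x. c * f x + d * h x) x = c * pdiff i f x + d * pdiff i h x"
proof -
  have "((\<lambda>x. c * f x + d * h x) has_derivative
      (\<lambda>v. c * frechet_derivative f (at x) v + d * frechet_derivative h (at x) v)) (at x)"
    using assms unfolding frechet_derivative_works
    by (intro has_derivative_add has_derivative_mult_right)
  then show ?thesis by (simp add: pdiff_eq) (simp add: pdiff_def)
qed

text \<open>\<open>smooth\<close> quantifies over all iterated derivatives, so their formula is
  needed before differentiability of a linear combination can be read off.\<close>

lemma foldr_pdiff_linear:
  assumes "smooth f" "smooth h"
  shows "foldr pdiff is (\<lambda>x. c * f x + d * h x) = (\<lambda>x. c * foldr pdiff is f x + d * foldr pdiff is h x)"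
proof (induction "is")
  case (Cons i "is")
  show ?case
    unfolding foldr.simps o_apply Cons
    by (intro ext pdiff_linear smoothD assms)
qed simp

lemma smooth_linear: "smooth f \<Longrightarrow> smooth h \<Longrightarrow> smooth (\<lambda>x. c * f x + d * h x)"
  unfolding smooth_def[of "\<lambda>x. c * f x + d * h x"]
  by (auto simp: foldr_pdiff_linear intro!: differentiable_add differentiable_mult smoothD)

lemma test_functionsD:
  assumes "\<psi> \<in> test_functions \<Omega>"
  shows "smooth \<psi>" "compact (closure {x. \<psi> x \<noteq> 0})" "closure {x. \<psi> x \<noteq> 0} \<subseteq> \<Omega>"
  using assms by (auto simp: test_functions_def)

lemma test_functions_if_support_subset:
  assumes "smooth f" "compact K" "K \<subseteq> \<Omega>" "{x. f x \<noteq> 0} \<subseteq> K"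
  shows "f \<in> test_functions \<Omega>"
proof -
  have "closure {x. f x \<noteq> 0} \<subseteq> K" using assms by (simp add: closure_minimal compact_imp_closed)
  then show ?thesis using assms unfolding test_functions_def
    by (auto intro: bounded_subset[OF compact_imp_bounded])
qed

lemma test_functions_linear:
  assumes "\<psi> \<in> test_functions \<Omega>" "\<eta> \<in> test_functions \<Omega>"
  shows "(\<lambda>x. c * \<psi> x + d * \<eta> x) \<in> test_functions \<Omega>"
proof (rule test_functions_if_support_subset)
  show "smooth (\<lambda>x. c * \<psi> x + d * \<eta> x)" by (intro smooth_linear test_functionsD(1)[OF assms(1)] test_functionsD(1)[OF assms(2)])
  show "compact (closure {x. \<psi> x \<noteq> 0} \<union> closure {x. \<eta> x \<noteq> 0})"
    by (intro compact_Un test_functionsD(2)[OF assms(1)] test_functionsD(2)[OF assms(2)])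
  show "closure {x. \<psi> x \<noteq> 0} \<union> closure {x. \<eta> x \<noteq> 0} \<subseteq> \<Omega>"
    using test_functionsD(3)[OF assms(1)] test_functionsD(3)[OF assms(2)] by simp
  show "{x. c * \<psi> x + d * \<eta> x \<noteq> 0} \<subseteq> closure {x. \<psi> x \<noteq> 0} \<union> closure {x. \<eta> x \<noteq> 0}"
  proof
    fix x assume "x \<in> {x. c * \<psi> x + d * \<eta> x \<noteq> 0}"
    then have "x \<in> {x. \<psi> x \<noteq> 0} \<or> x \<in> {x. \<eta> x \<noteq> 0}" by auto
    then show "x \<in> closure {x. \<psi> x \<noteq> 0} \<union> closure {x. \<eta> x \<noteq> 0}"
      using subsetD[OF closure_subset[of "{x. \<psi> x \<noteq> 0}"]] subsetD[OF closure_subset[of "{x. \<eta> x \<noteq> 0}"]] by blast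
  qed
qed

lemma pdiff_support: "{x. pdiff i f x \<noteq> 0} \<subseteq> closure {x. f x \<noteq> 0}"
proof
  fix x assume x: "x \<in> {x. pdiff i f x \<noteq> 0}"
  show "x \<in> closure {x. f x \<noteq> 0}"
  proof (rule ccontr)
    assume nx: "x \<notin> closure {x. f x \<noteq> 0}"
    have "((\<lambda>_. 0) has_derivative (\<lambda>_. 0)) (at x)" by simp
    then have "(f has_derivative (\<lambda>_. 0)) (at x)"
      by (rule has_derivative_transform_within_open[of _ _ _ _ "- closure {x. f x \<noteq> 0}"])
         (use nx closure_subset[of "{x. f x \<noteq> 0}"] in auto)
    then show False using x by (simp add: pdiff_eq)
  qed
qed

lemma test_functions_pdiff: "\<psi> \<in> test_functions \<Omega> \<Longrightarrow> pdiff i \<psi> \<in> test_functions \<Omega>"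
  by (rule test_functions_if_support_subset[OF smooth_pdiff _ _ pdiff_support]) (auto dest: test_functionsD)

lemma sqint_if_compact_support:
  assumes "continuous_on UNIV f" "compact (closure {x. f x \<noteq> 0})"
  shows "sqint f"
proof -
  let ?K = "closure {x. f x \<noteq> 0}"
  have "integrable lborel (\<lambda>x. indicator ?K x *\<^sub>R (cmod (f x))\<^sup>2)"
    by (rule borel_integrable_compact[OF assms(2)])
       (intro continuous_intros continuous_on_subset[OF assms(1)] subset_UNIV)
  moreover have "(\<lambda>x. indicator ?K x *\<^sub>R (cmod (f x))\<^sup>2) = (\<lambda>x. (cmod (f x))\<^sup>2)"
    using closure_subset[of "{x. f x \<noteq> 0}"] by (auto simp: indicator_def fun_eq_iff)
  ultimately show ?thesis
    using assms(1) by (simp add: sqint_def borel_measurable_continuous_onI)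
qed

lemma sqint_test_function: "\<psi> \<in> test_functions \<Omega> \<Longrightarrow> sqint \<psi>"
  by (intro sqint_if_compact_support smooth_continuous_on) (auto dest: test_functionsD)

lemma abs_L2_test_function_in_L2_on:
  assumes "\<psi> \<in> test_functions \<Omega>"
  shows "abs_L2 \<psi> \<in> L2_on \<Omega>"
proof -
  have "{x. \<psi> x \<noteq> 0} \<subseteq> \<Omega>" using subset_trans[OF closure_subset test_functionsD(3)[OF assms]] .
  then have "AE x in lborel. x \<notin> \<Omega> \<longrightarrow> \<psi> x = 0" by auto
  then show ?thesis
    using sqint_test_function[OF assms] by (simp add: L2_on_def vanishes_outside.abs_eq)
qed

text \<open>The integral of the difference quotient vanishes by translation invariance.\<close>

lemma integral_directional_derivative_eq_0:
  fixes F :: "'a::euclidean_space \<Rightarrow> 'b::euclidean_space"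
  assumes F: "\<And>x. (F has_derivative F' x) (at x)" and cont: "continuous_on UNIV (\<lambda>x. F' x e)"
    and K: "bounded K" "\<And>x. x \<notin> K \<Longrightarrow> F x = 0" "\<And>x. x \<notin> K \<Longrightarrow> F' x e = 0"
  shows "(LINT x|lborel. F' x e) = 0"
proof -
  define h :: "nat \<Rightarrow> real" where "h n = 1 / real (Suc n)" for n
  have h: "0 < h n" "h n \<le> 1" for n by (auto simp: h_def)
  have h0: "h \<longlonglongrightarrow> 0" unfolding h_def by (rule lim_1_over_n[THEN LIMSEQ_Suc])
  define q where "q n x = (1 / h n) *\<^sub>R (F (h n *\<^sub>R e + x) - F x)" for n x
  obtain R0 where R0: "\<And>x. x \<in> K \<Longrightarrow> norm x \<le> R0" using K(1) by (auto simp: bounded_iff)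
  \<comment> \<open>Because h n \<le> 1, a point outside the ball of radius R stays outside K also
    after translation by h n times e.\<close>
  define R where "R = R0 + norm e"
  have contF: "continuous_on S F" for S
    by (meson F continuous_at_imp_continuous_on has_derivative_continuous)
  have outside: "x \<notin> K" "h n *\<^sub>R e + x \<notin> K" if "x \<notin> cball 0 R" for x n
  proof -
    have nx: "R < norm x" using that by simp
    have "norm (h n *\<^sub>R e) \<le> norm e" using h[of n] by (simp add: mult_left_le_one_le)
    then have "norm x \<le> norm (h n *\<^sub>R e + x) + norm e"
      using norm_triangle_ineq4[of "h n *\<^sub>R e + x" "h n *\<^sub>R e"] by simp
    then show "h n *\<^sub>R e + x \<notin> K" using nx R0[of "h n *\<^sub>R e + x"] by (auto simp: R_def)
    show "x \<notin> K" using nx R0[of x] norm_ge_zero[of e] unfolding R_def by (metis add_increasing2 not_less)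
  qed
  have "compact ((\<lambda>x. F' x e) ` cball 0 (R + norm e))"
    by (intro compact_continuous_image continuous_on_subset[OF cont]) auto
  then have "bounded ((\<lambda>x. F' x e) ` cball 0 (R + norm e))" by (rule compact_imp_bounded)
  then obtain M0 where "\<forall>y\<in>(\<lambda>x. F' x e) ` cball 0 (R + norm e). norm y \<le> M0"
    unfolding bounded_iff by blast
  then have M0: "norm (F' x e) \<le> M0" if "norm x \<le> R + norm e" for x
    using that by simp
  have FM: "norm (F' x e) \<le> \<bar>M0\<bar>" for x
  proof (cases "norm x \<le> R + norm e")
    case False
    then have "\<not> norm x \<le> R" using norm_ge_zero[of e] by linarith
    then have "x \<notin> K" using outside(1)[of x] by simp
    then show ?thesis using K(3) by simp
  qed (use M0 in force)
  \<comment> \<open>The majorant for dominated convergence: the mean value inequality along the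
    segment bounds the quotient by the bound M0 of the directional derivative, and outside the ball
    both values of F vanish.\<close>
  have qle: "norm (q n x) \<le> \<bar>M0\<bar> * indicator (cball 0 R) x" for n x
  proof (cases "x \<in> cball 0 R")
    case True
    have "norm (F (h n *\<^sub>R e + x) - F (0 *\<^sub>R e + x)) \<le> \<bar>M0\<bar> * norm (h n - 0)"
    proof (rule differentiable_bound[where S = UNIV and f' = "\<lambda>s d. d *\<^sub>R F' (s *\<^sub>R e + x) e"])
      fix s :: real
      have "((\<lambda>s. s *\<^sub>R e + x) has_derivative (\<lambda>d. d *\<^sub>R e)) (at s)"
        by (auto intro!: derivative_eq_intros)
      from has_derivative_compose[OF this F]
      have "((\<lambda>s. F (s *\<^sub>R e + x)) has_derivative (\<lambda>d. F' (s *\<^sub>R e + x) (d *\<^sub>R e))) (at s)" .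
      moreover have "F' (s *\<^sub>R e + x) (d *\<^sub>R e) = d *\<^sub>R F' (s *\<^sub>R e + x) e" for d
        by (simp add: linear_cmul[OF has_derivative_linear[OF F]])
      ultimately show "((\<lambda>s. F (s *\<^sub>R e + x)) has_derivative (\<lambda>d. d *\<^sub>R F' (s *\<^sub>R e + x) e)) (at s within UNIV)" by simp
      show "onorm (\<lambda>d. d *\<^sub>R F' (s *\<^sub>R e + x) e) \<le> \<bar>M0\<bar>"
      proof (rule onorm_bound)
        fix d :: real
        have "\<bar>d\<bar> * norm (F' (s *\<^sub>R e + x) e) \<le> \<bar>d\<bar> * \<bar>M0\<bar>" by (intro mult_left_mono FM) simp
        then show "norm (d *\<^sub>R F' (s *\<^sub>R e + x) e) \<le> \<bar>M0\<bar> * norm d" by (simp add: mult.commute)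
      qed simp
    qed auto
    moreover have "norm (q n x) = norm (F (h n *\<^sub>R e + x) - F x) / h n"
      unfolding q_def norm_scaleR using h[of n] by simp
    ultimately show ?thesis using True h[of n] by (simp add: divide_le_eq)
  next
    case False
    then have "q n x = 0" unfolding q_def using K(2) outside by simp
    then show ?thesis by simp
  qed
  have intF: "integrable lborel F"
  proof -
    have "integrable lborel (\<lambda>x. indicator (cball 0 R) x *\<^sub>R F x)"
      by (rule borel_integrable_compact[OF compact_cball contF])
    moreover have "(\<lambda>x. indicator (cball 0 R) x *\<^sub>R F x) = F"
      using K(2) outside(1) by (force simp: indicator_def fun_eq_iff)
    ultimately show ?thesis by simp
  qed
  have shift: "integrable lborel (\<lambda>x. F (c + x))" "(LINT x|lborel. F (c + x)) = (LINT x|lborel. F x)" for c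
  proof -
    have [measurable]: "F \<in> borel_measurable borel" by (rule borel_measurable_continuous_onI[OF contF])
    have D: "distr lborel borel ((+) c) = (lborel :: 'a measure)" by (rule lborel_distr_plus)
    have "integrable (distr lborel borel ((+) c)) F" unfolding D by (rule intF)
    then show "integrable lborel (\<lambda>x. F (c + x))"
      by (subst (asm) integrable_distr_eq) auto
    have "(LINT x|distr lborel borel ((+) c). F x) = (LINT x|lborel. F (c + x))"
      by (rule integral_distr) auto
    then show "(LINT x|lborel. F (c + x)) = (LINT x|lborel. F x)" unfolding D by simp
  qed
  have "(LINT x|lborel. q n x) = 0" for n
    unfolding q_def by (simp add: shift intF Bochner_Integration.integral_diff)
  moreover have "(\<lambda>n. LINT x|lborel. q n x) \<longlonglongrightarrow> (LINT x|lborel. F' x e)"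
  proof (rule integral_dominated_convergence)
    show "(\<lambda>x. F' x e) \<in> borel_measurable lborel"
      using borel_measurable_continuous_onI[OF cont] by simp
    show "q n \<in> borel_measurable lborel" for n
      unfolding q_def using shift(1)[of "h n *\<^sub>R e"] intF
      by (intro borel_measurable_scaleR borel_measurable_diff) auto
    show "integrable lborel (\<lambda>x. \<bar>M0\<bar> * indicator (cball 0 R) x)"
      using borel_integrable_compact[OF compact_cball, of 0 R "\<lambda>_. \<bar>M0\<bar>"] by (simp add: mult.commute)
    show "AE x in lborel. norm (q n x) \<le> \<bar>M0\<bar> * indicator (cball 0 R) x" for n
      using qle by simp
    show "AE x in lborel. (\<lambda>n. q n x) \<longlonglongrightarrow> F' x e"
    proof (rule AE_I2)
      fix x
      have "((\<lambda>s. s *\<^sub>R e + x) has_derivative (\<lambda>d. d *\<^sub>R e)) (at 0)"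
        by (auto intro!: derivative_eq_intros)
      from has_derivative_compose[OF this, of F "F' x"] F[of x]
      have "((\<lambda>s. F (s *\<^sub>R e + x)) has_derivative (\<lambda>d. F' x (d *\<^sub>R e))) (at 0)" by simp
      then have "((\<lambda>s. F (s *\<^sub>R e + x)) has_vector_derivative F' x e) (at 0)"
        by (simp add: has_vector_derivative_def linear_cmul[OF has_derivative_linear[OF F]])
      then have "((\<lambda>s. norm (F (s *\<^sub>R e + x) - F x - s *\<^sub>R F' x e) / norm s) \<longlongrightarrow> 0) (at 0)"
        by (simp add: has_vector_derivative_def has_derivative_at)
      moreover have "\<forall>\<^sub>F s in at 0. norm (F (s *\<^sub>R e + x) - F x - s *\<^sub>R F' x e) / norm s =
          norm ((F (s *\<^sub>R e + x) - F x) /\<^sub>R s - F' x e)"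
        unfolding eventually_at_filter
      proof (intro always_eventually allI impI)
        fix s :: real assume "s \<noteq> 0"
        then have "(F (s *\<^sub>R e + x) - F x) /\<^sub>R s - F' x e = (F (s *\<^sub>R e + x) - F x - s *\<^sub>R F' x e) /\<^sub>R s"
          by (simp add: scaleR_diff_right)
        then show "norm (F (s *\<^sub>R e + x) - F x - s *\<^sub>R F' x e) / norm s =
          norm ((F (s *\<^sub>R e + x) - F x) /\<^sub>R s - F' x e)" by (simp add: divide_inverse mult.commute)
      qed
      ultimately have "((\<lambda>s. norm ((F (s *\<^sub>R e + x) - F x) /\<^sub>R s - F' x e)) \<longlongrightarrow> 0) (at 0)"
        by (rule Lim_transform_eventually)
      then have "((\<lambda>s. (F (s *\<^sub>R e + x) - F x) /\<^sub>R s) \<longlongrightarrow> F' x e) (at 0)"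
        by (rule LIM_zero_cancel[OF tendsto_norm_zero_cancel])
      moreover have "filterlim h (at 0) sequentially"
        unfolding filterlim_at using h0 h(1) by (auto intro!: always_eventually simp: less_imp_neq[THEN not_sym])
      ultimately have "(\<lambda>n. (F (h n *\<^sub>R e + x) - F x) /\<^sub>R h n) \<longlonglongrightarrow> F' x e"
        by (rule filterlim_compose)
      then show "(\<lambda>n. q n x) \<longlonglongrightarrow> F' x e"
        by (simp add: q_def inverse_eq_divide)
    qed
  qed
  ultimately show ?thesis by (simp add: LIMSEQ_const_iff)
qed


text \<open>The product rule for \<psi> times the conjugate of \<eta>, integrated over the whole
  plane; compact support leaves no boundary term.\<close>

lemma test_function_bilinear_ibp:
  assumes \<psi>: "\<psi> \<in> test_functions \<Omega>" and \<eta>: "\<eta> \<in> test_functions \<Omega>"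
  shows "cinner (abs_L2 \<psi>) (abs_L2 (pdiff i \<eta>)) = - cinner (abs_L2 (pdiff i \<psi>)) (abs_L2 \<eta>)"
proof -
  note sm = test_functionsD(1)[OF \<psi>] test_functionsD(1)[OF \<eta>]
  note sq = sqint_test_function[OF \<psi>] sqint_test_function[OF \<eta>]
    sqint_test_function[OF test_functions_pdiff[OF \<psi>, of i]] sqint_test_function[OF test_functions_pdiff[OF \<eta>, of i]]
  define F' where "F' x v = \<psi> x * cnj (frechet_derivative \<eta> (at x) v) + frechet_derivative \<psi> (at x) v * cnj (\<eta> x)" for x v
  have F'e: "F' x (axis i 1) = \<psi> x * cnj (pdiff i \<eta> x) + pdiff i \<psi> x * cnj (\<eta> x)" for x
    by (simp add: F'_def pdiff_def)
  have "(LINT x|lborel. F' x (axis i 1)) = 0"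
  proof (rule integral_directional_derivative_eq_0)
    fix x
    have "(\<psi> has_derivative frechet_derivative \<psi> (at x)) (at x)" "(\<eta> has_derivative frechet_derivative \<eta> (at x)) (at x)"
      using sm[THEN smooth_differentiable] by (simp_all add: frechet_derivative_works)
    then show "((\<lambda>x. \<psi> x * cnj (\<eta> x)) has_derivative F' x) (at x)"
      unfolding F'_def by (intro has_derivative_mult bounded_linear.has_derivative[OF bounded_linear_cnj])
  next
    show "continuous_on UNIV (\<lambda>x. F' x (axis i 1))"
      unfolding F'e by (intro continuous_intros smooth_continuous_on smooth_pdiff sm)
    show "bounded (closure {x. \<psi> x \<noteq> 0})"
      using test_functionsD(2)[OF \<psi>] by (rule compact_imp_bounded)
    fix x assume x: "x \<notin> closure {x. \<psi> x \<noteq> 0}"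
    have "\<psi> x = 0" "pdiff i \<psi> x = 0"
      using x closure_subset[of "{x. \<psi> x \<noteq> 0}"] pdiff_support[of i \<psi>] by auto
    then show "\<psi> x * cnj (\<eta> x) = 0" "F' x (axis i 1) = 0" by (simp_all add: F'e)
  qed
  then have "(LINT x|lborel. \<psi> x * cnj (pdiff i \<eta> x)) + (LINT x|lborel. pdiff i \<psi> x * cnj (\<eta> x)) = 0"
    unfolding F'e using sq by (simp add: sqint_mult_cnj)
  then show ?thesis using sq by (simp add: cinner_abs_L2 add_eq_0_iff)
qed

lemma has_weak_deriv_test_function:
  "\<psi> \<in> test_functions \<Omega> \<Longrightarrow> has_weak_deriv \<Omega> i (abs_L2 \<psi>) (abs_L2 (pdiff i \<psi>))"
  unfolding has_weak_deriv_def
  by (auto intro: abs_L2_test_function_in_L2_on test_functions_pdiff test_function_bilinear_ibp)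

lemma has_weak_deriv_add:
  "has_weak_deriv \<Omega> i u g \<Longrightarrow> has_weak_deriv \<Omega> i v h \<Longrightarrow> has_weak_deriv \<Omega> i (u + v) (g + h)"
  by (simp add: has_weak_deriv_def L2_on_add cinner_add_left)

lemma has_weak_deriv_cscale:
  "has_weak_deriv \<Omega> i u g \<Longrightarrow> has_weak_deriv \<Omega> i (c *\<^sub>C u) (c *\<^sub>C g)"
  by (simp add: has_weak_deriv_def L2_on_cscale cinner_cscale_left)

lemma has_weak_deriv_diff:
  "has_weak_deriv \<Omega> i u g \<Longrightarrow> has_weak_deriv \<Omega> i v h \<Longrightarrow> has_weak_deriv \<Omega> i (u - v) (g - h)"
  unfolding minus_L2_def by (intro has_weak_deriv_add has_weak_deriv_cscale)

text \<open>For each fixed test function both sides of the defining identity are continuous in the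
  function and in its derivative.\<close>

lemma has_weak_deriv_closed:
  assumes "\<Omega> \<in> sets borel" "\<And>n. has_weak_deriv \<Omega> i (u n) (g n)" "u \<longlonglongrightarrow> u'" "g \<longlonglongrightarrow> g'"
  shows "has_weak_deriv \<Omega> i u' g'"
  unfolding has_weak_deriv_def
proof (intro conjI ballI)
  show "g' \<in> L2_on \<Omega>"
    by (rule closed_sequentially[OF closed_L2_on[OF assms(1)] _ assms(4)])
       (use assms(2) in \<open>simp add: has_weak_deriv_def\<close>)
  fix \<psi> assume \<psi>: "\<psi> \<in> test_functions \<Omega>"
  have "(\<lambda>n. cinner (u n) (abs_L2 (pdiff i \<psi>))) \<longlonglongrightarrow> cinner u' (abs_L2 (pdiff i \<psi>))"
    by (intro tendsto_intros assms)
  moreover have "(\<lambda>n. - cinner (g n) (abs_L2 \<psi>)) \<longlonglongrightarrow> - cinner g' (abs_L2 \<psi>)"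
    by (intro tendsto_intros assms)
  moreover have "cinner (u n) (abs_L2 (pdiff i \<psi>)) = - cinner (g n) (abs_L2 \<psi>)" for n
    using assms(2)[of n] \<psi> by (simp add: has_weak_deriv_def)
  ultimately show "cinner u' (abs_L2 (pdiff i \<psi>)) = - cinner g' (abs_L2 \<psi>)"
    using LIMSEQ_unique by simp
qed

section \<open>Weak derivatives, the space H^1_0 and the operator A\<close>

locale dirichlet_eigensystem =
  fixes \<Omega> :: "(real^2) set" and lam :: "nat \<Rightarrow> real" and \<phi> :: "nat \<Rightarrow> L2"
  assumes \<Omega>_borel: "\<Omega> \<in> sets borel" and eigensystem: "eigensystem \<Omega> lam \<phi>"
begin

abbreviation coeff :: "L2 \<Rightarrow> nat \<Rightarrow> complex" where "coeff v j \<equiv> cinner v (\<phi> j)"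

abbreviation D :: "2 \<Rightarrow> L2 \<Rightarrow> L2" where "D \<equiv> weak_deriv \<Omega>"

lemma orthonormal_\<phi>: "orthonormal \<phi>"
  using eigensystem by (simp add: eigensystem_def orthonormal_def)

lemma complete_\<phi>: "v \<in> L2_on \<Omega> \<Longrightarrow> (\<And>j. coeff v j = 0) \<Longrightarrow> v = 0"
  using eigensystem by (simp add: eigensystem_def)

lemma \<phi>_H10: "\<phi> j \<in> H10 \<Omega>"
  using eigensystem by (auto simp: eigensystem_def dom_A_def weak_poisson_def)

lemma H10_subset: "u \<in> H10 \<Omega> \<Longrightarrow> u \<in> L2_on \<Omega>"
  by (simp add: H10_def H1_def)

lemma norm_le_H1_norm: "norm u \<le> H1_norm \<Omega> u"
  unfolding H1_norm_def by (intro real_le_rsqrt) (simp add: sum_nonneg)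

text \<open>The eigenfunctions are \<open>L\<^sup>2\<close>-limits of test functions, so their completeness yields the
  density of the test functions.\<close>

lemma test_functions_separate:
  assumes "g \<in> L2_on \<Omega>" "\<And>\<psi>. \<psi> \<in> test_functions \<Omega> \<Longrightarrow> cinner g (abs_L2 \<psi>) = 0"
  shows "g = 0"
proof (rule complete_\<phi>[OF assms(1)])
  fix j
  obtain \<psi> where \<psi>: "\<And>n::nat. \<psi> n \<in> test_functions \<Omega>" "(\<lambda>n. H1_norm \<Omega> (\<phi> j - abs_L2 (\<psi> n))) \<longlonglongrightarrow> 0"
    using \<phi>_H10[of j] by (auto simp: H10_def)
  have "(\<lambda>n. norm (\<phi> j - abs_L2 (\<psi> n))) \<longlonglongrightarrow> 0"
    by (rule tendsto_sandwich[OF _ _ tendsto_const \<psi>(2)]) (auto intro!: always_eventually norm_le_H1_norm)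
  then have "(\<lambda>n. \<phi> j - abs_L2 (\<psi> n)) \<longlonglongrightarrow> 0" by (rule tendsto_norm_zero_cancel)
  from tendsto_diff[OF tendsto_const[of "\<phi> j"] this]
  have "(\<lambda>n. abs_L2 (\<psi> n)) \<longlonglongrightarrow> \<phi> j" by simp
  then have "(\<lambda>n. cinner g (abs_L2 (\<psi> n))) \<longlonglongrightarrow> coeff g j"
    by (intro tendsto_intros)
  then show "coeff g j = 0"
    using assms(2)[OF \<psi>(1)] by (simp add: LIMSEQ_const_iff)
qed

text \<open>This resolves the definite description: the difference of two weak derivatives
  annihilates every test function, and test functions separate
  \<open>L2_on \<Omega>\<close>.\<close>

lemma weak_deriv_eq:
  assumes "has_weak_deriv \<Omega> i u g"
  shows "D i u = g"
  unfolding weak_deriv_def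
proof (rule the_equality, fact assms)
  fix h assume "has_weak_deriv \<Omega> i u h"
  then have "has_weak_deriv \<Omega> i (u - u) (h - g)" using assms by (rule has_weak_deriv_diff)
  then have "h - g = 0" by (intro test_functions_separate) (auto simp: has_weak_deriv_def)
  then show "h = g" by simp
qed

lemma has_weak_deriv_weak_deriv: "u \<in> H1 \<Omega> \<Longrightarrow> has_weak_deriv \<Omega> i u (D i u)"
  by (auto simp: H1_def weak_deriv_eq) (metis weak_deriv_eq)

text \<open>Approximating sequences in \<open>H1_norm\<close> are replaced by a single test function
  for each \<epsilon>, with the function and its two derivatives controlled separately. Closure
  under linear combinations and limits is proved in this form.\<close>

lemma H10_iff:
  "u \<in> H10 \<Omega> \<longleftrightarrow> u \<in> H1 \<Omega> \<and> (\<forall>\<epsilon>>0. \<exists>\<psi>\<in>test_functions \<Omega>.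
     norm (u - abs_L2 \<psi>) < \<epsilon> \<and> (\<forall>i. norm (D i u - abs_L2 (pdiff i \<psi>)) < \<epsilon>))"
  (is "_ \<longleftrightarrow> u \<in> H1 \<Omega> \<and> ?approx")
proof (cases "u \<in> H1 \<Omega>")
  case u: True
  have wd: "D i (u - abs_L2 \<psi>) = D i u - abs_L2 (pdiff i \<psi>)"
    if "\<psi> \<in> test_functions \<Omega>" for i \<psi>
    by (intro weak_deriv_eq has_weak_deriv_diff has_weak_deriv_weak_deriv u has_weak_deriv_test_function that)
  have le: "norm (D i w) \<le> H1_norm \<Omega> w" for i w
    unfolding H1_norm_def
    by (intro real_le_rsqrt) (simp add: member_le_sum[of i UNIV "\<lambda>i. (norm (D i w))\<^sup>2"] add_increasing)
  show ?thesis
  proof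
    assume "u \<in> H10 \<Omega>"
    then obtain \<psi> where \<psi>: "\<And>n::nat. \<psi> n \<in> test_functions \<Omega>" "(\<lambda>n. H1_norm \<Omega> (u - abs_L2 (\<psi> n))) \<longlonglongrightarrow> 0"
      by (auto simp: H10_def)
    have ?approx
    proof (intro allI impI)
      fix \<epsilon> :: real assume "0 < \<epsilon>"
      then obtain n where n: "H1_norm \<Omega> (u - abs_L2 (\<psi> n)) < \<epsilon>"
        using order_tendstoD(2)[OF \<psi>(2)] by (auto simp: eventually_sequentially)
      then show "\<exists>\<psi>\<in>test_functions \<Omega>. norm (u - abs_L2 \<psi>) < \<epsilon> \<and> (\<forall>i. norm (D i u - abs_L2 (pdiff i \<psi>)) < \<epsilon>)"
        using \<psi>(1)[of n] le_less_trans[OF norm_le_H1_norm n] le_less_trans[OF le n] wd[OF \<psi>(1)[of n]] by auto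
    qed
    then show "u \<in> H1 \<Omega> \<and> ?approx" using u by simp
  next
    assume "u \<in> H1 \<Omega> \<and> ?approx"
    then have "\<forall>n. \<exists>\<psi>\<in>test_functions \<Omega>. norm (u - abs_L2 \<psi>) < 1 / real (Suc n) \<and>
        (\<forall>i. norm (D i u - abs_L2 (pdiff i \<psi>)) < 1 / real (Suc n))" by simp
    then obtain \<psi> where \<psi>: "\<And>n. \<psi> n \<in> test_functions \<Omega>" "\<And>n. norm (u - abs_L2 (\<psi> n)) < 1 / real (Suc n)"
        "\<And>n i. norm (D i u - abs_L2 (pdiff i (\<psi> n))) < 1 / real (Suc n)"
      by metis
    have 0: "(\<lambda>n. 1 / real (Suc n)) \<longlonglongrightarrow> 0" by (rule lim_1_over_n[THEN LIMSEQ_Suc])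
    have 1: "(\<lambda>n. norm (u - abs_L2 (\<psi> n))) \<longlonglongrightarrow> 0"
      by (rule tendsto_sandwich[OF _ _ tendsto_const 0]) (auto intro!: always_eventually less_imp_le \<psi> simp del: of_nat_Suc)
    have 2: "(\<lambda>n. norm (D i (u - abs_L2 (\<psi> n)))) \<longlonglongrightarrow> 0" for i
      unfolding wd[OF \<psi>(1)]
      by (rule tendsto_sandwich[OF _ _ tendsto_const 0]) (auto intro!: always_eventually less_imp_le \<psi> simp del: of_nat_Suc)
    have "(\<lambda>n. H1_norm \<Omega> (u - abs_L2 (\<psi> n))) \<longlonglongrightarrow> sqrt (0\<^sup>2 + (\<Sum>i\<in>(UNIV :: 2 set). 0\<^sup>2))"
      unfolding H1_norm_def by (intro tendsto_intros 1 2)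
    then show "u \<in> H10 \<Omega>" using u \<psi>(1) by (auto simp: H10_def)
  qed
qed (simp add: H10_def)

lemma H1_add: "u \<in> H1 \<Omega> \<Longrightarrow> v \<in> H1 \<Omega> \<Longrightarrow> u + v \<in> H1 \<Omega>"
  unfolding H1_def by (auto intro: L2_on_add has_weak_deriv_add) (metis has_weak_deriv_add)

lemma H1_cscale: "u \<in> H1 \<Omega> \<Longrightarrow> c *\<^sub>C u \<in> H1 \<Omega>"
  unfolding H1_def by (auto intro: L2_on_cscale) (metis has_weak_deriv_cscale)

lemma weak_deriv_add: "u \<in> H1 \<Omega> \<Longrightarrow> v \<in> H1 \<Omega> \<Longrightarrow> D i (u + v) = D i u + D i v"
  by (intro weak_deriv_eq has_weak_deriv_add has_weak_deriv_weak_deriv)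

lemma weak_deriv_cscale: "u \<in> H1 \<Omega> \<Longrightarrow> D i (c *\<^sub>C u) = c *\<^sub>C D i u"
  by (intro weak_deriv_eq has_weak_deriv_cscale has_weak_deriv_weak_deriv)

lemma H10_H1: "u \<in> H10 \<Omega> \<Longrightarrow> u \<in> H1 \<Omega>"
  by (simp add: H10_def)

lemma H10_linear:
  assumes "u \<in> H10 \<Omega>" "v \<in> H10 \<Omega>"
  shows "c *\<^sub>C u + d *\<^sub>C v \<in> H10 \<Omega>"
  unfolding H10_iff[of "c *\<^sub>C u + d *\<^sub>C v"]
proof (intro conjI allI impI)
  note H1 = assms[THEN H10_H1]
  show "c *\<^sub>C u + d *\<^sub>C v \<in> H1 \<Omega>" by (intro H1_add H1_cscale H1)
  fix \<epsilon> :: real assume \<epsilon>: "0 < \<epsilon>"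
  \<comment> \<open>The + 1 keeps the denominator positive when c = d = 0 and makes the final
    inequality strict.\<close>
  define \<epsilon>' where "\<epsilon>' = \<epsilon> / (cmod c + cmod d + 1)"
  have \<epsilon>': "0 < \<epsilon>'" "(cmod c + cmod d) * \<epsilon>' < \<epsilon>"
  proof -
    have S: "0 < cmod c + cmod d + 1" by (simp add: add_nonneg_pos)
    then show "0 < \<epsilon>'" using \<epsilon> by (simp add: \<epsilon>'_def)
    then have "(cmod c + cmod d) * \<epsilon>' < (cmod c + cmod d + 1) * \<epsilon>'" by (intro mult_strict_right_mono) auto
    also have "\<dots> = \<epsilon>" using S by (simp add: \<epsilon>'_def)
    finally show "(cmod c + cmod d) * \<epsilon>' < \<epsilon>" .
  qed
  obtain \<psi> where \<psi>: "\<psi> \<in> test_functions \<Omega>" "norm (u - abs_L2 \<psi>) < \<epsilon>'"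
      "\<And>i. norm (D i u - abs_L2 (pdiff i \<psi>)) < \<epsilon>'"
    using assms(1) \<epsilon>'(1) unfolding H10_iff by blast
  obtain \<eta> where \<eta>: "\<eta> \<in> test_functions \<Omega>" "norm (v - abs_L2 \<eta>) < \<epsilon>'"
      "\<And>i. norm (D i v - abs_L2 (pdiff i \<eta>)) < \<epsilon>'"
    using assms(2) \<epsilon>'(1) unfolding H10_iff by blast
  have est: "norm (c *\<^sub>C p + d *\<^sub>C q - (c *\<^sub>C p' + d *\<^sub>C q')) < \<epsilon>"
    if "norm (p - p') < \<epsilon>'" "norm (q - q') < \<epsilon>'" for p p' q q'
  proof -
    have "c *\<^sub>C p + d *\<^sub>C q - (c *\<^sub>C p' + d *\<^sub>C q') = c *\<^sub>C (p - p') + d *\<^sub>C (q - q')"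
      by (simp add: cscale_diff_right)
    also have "norm \<dots> \<le> cmod c * norm (p - p') + cmod d * norm (q - q')"
      by (rule norm_triangle_le) (simp add: norm_cscale)
    also have "\<dots> \<le> cmod c * \<epsilon>' + cmod d * \<epsilon>'"
      using that by (intro add_mono mult_left_mono) auto
    finally show ?thesis using \<epsilon>'(2) by (simp add: distrib_right)
  qed
  have lin: "abs_L2 (\<lambda>x. c * f x + d * h x) = c *\<^sub>C abs_L2 f + d *\<^sub>C abs_L2 h" if "sqint f" "sqint h" for f h
    using that by (simp add: abs_L2_cscale abs_L2_add sqint_cmult)
  show "\<exists>\<psi>\<in>test_functions \<Omega>. norm (c *\<^sub>C u + d *\<^sub>C v - abs_L2 \<psi>) < \<epsilon> \<and>
      (\<forall>i. norm (D i (c *\<^sub>C u + d *\<^sub>C v) - abs_L2 (pdiff i \<psi>)) < \<epsilon>)"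
  proof (intro bexI conjI allI)
    show "(\<lambda>x. c * \<psi> x + d * \<eta> x) \<in> test_functions \<Omega>" by (intro test_functions_linear \<psi> \<eta>)
    show "norm (c *\<^sub>C u + d *\<^sub>C v - abs_L2 (\<lambda>x. c * \<psi> x + d * \<eta> x)) < \<epsilon>"
      using est[OF \<psi>(2) \<eta>(2)] by (simp add: lin sqint_test_function[OF \<psi>(1)] sqint_test_function[OF \<eta>(1)])
    fix i
    have "pdiff i (\<lambda>x. c * \<psi> x + d * \<eta> x) = (\<lambda>x. c * pdiff i \<psi> x + d * pdiff i \<eta> x)"
      by (intro ext pdiff_linear smooth_differentiable test_functionsD(1)[OF \<psi>(1)] test_functionsD(1)[OF \<eta>(1)])
    then show "norm (D i (c *\<^sub>C u + d *\<^sub>C v) - abs_L2 (pdiff i (\<lambda>x. c * \<psi> x + d * \<eta> x))) < \<epsilon>"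
      using est[OF \<psi>(3) \<eta>(3), of i i] H1 sqint_test_function[OF test_functions_pdiff[OF \<psi>(1)]]
        sqint_test_function[OF test_functions_pdiff[OF \<eta>(1)]]
      by (simp add: lin weak_deriv_add weak_deriv_cscale H1_cscale)
  qed
qed

text \<open>The limits g i are the weak derivatives of u' by closedness of weak differentiation. One
  member of the sequence close to u', followed by a test function close to that member, gives the
  approximation.\<close>

lemma H10_closed:
  assumes u: "\<And>n. u n \<in> H10 \<Omega>" "u \<longlonglongrightarrow> u'" and g: "\<And>i. (\<lambda>n. D i (u n)) \<longlonglongrightarrow> g i"
  shows "u' \<in> H10 \<Omega>" "D i u' = g i"
proof -
  have w: "has_weak_deriv \<Omega> i u' (g i)" for i
    by (rule has_weak_deriv_closed[OF \<Omega>_borel has_weak_deriv_weak_deriv[OF H10_H1[OF u(1)]] u(2) g])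
  show wd: "D i u' = g i" for i by (rule weak_deriv_eq[OF w])
  have "u' \<in> L2_on \<Omega>"
    by (rule closed_sequentially[OF closed_L2_on[OF \<Omega>_borel] _ u(2)]) (rule H10_subset[OF u(1)])
  then have H1: "u' \<in> H1 \<Omega>" using w by (auto simp: H1_def)
  show "u' \<in> H10 \<Omega>"
    unfolding H10_iff
  proof (intro conjI allI impI H1)
    fix \<epsilon> :: real assume \<epsilon>: "0 < \<epsilon>"
    have "\<forall>\<^sub>F n in sequentially. dist (u n) u' < \<epsilon> / 2 \<and> (\<forall>i. dist (D i (u n)) (g i) < \<epsilon> / 2)"
      using \<epsilon> by (intro eventually_conj tendstoD[OF u(2)] eventually_all_finite tendstoD[OF g]) auto
    then obtain n where n: "dist (u n) u' < \<epsilon> / 2" "\<And>i. dist (D i (u n)) (g i) < \<epsilon> / 2"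
      by (auto simp: eventually_sequentially)
    have "0 < \<epsilon> / 2" using \<epsilon> by simp
    note approx = u(1)[of n, unfolded H10_iff, THEN conjunct2, rule_format, OF this]
    obtain \<psi> where \<psi>: "\<psi> \<in> test_functions \<Omega>" "norm (u n - abs_L2 \<psi>) < \<epsilon> / 2"
        "\<And>i. norm (D i (u n) - abs_L2 (pdiff i \<psi>)) < \<epsilon> / 2"
      using approx by blast
    have "dist u' (abs_L2 \<psi>) < \<epsilon>"
      by (rule dist_triangle_half_r[OF n(1)]) (unfold dist_norm, rule \<psi>(2))
    moreover have "dist (g i) (abs_L2 (pdiff i \<psi>)) < \<epsilon>" for i
      by (rule dist_triangle_half_r[OF n(2)[of i]]) (unfold dist_norm, rule \<psi>(3))
    ultimately show "\<exists>\<psi>\<in>test_functions \<Omega>. norm (u' - abs_L2 \<psi>) < \<epsilon> \<and>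
        (\<forall>i. norm (D i u' - abs_L2 (pdiff i \<psi>)) < \<epsilon>)"
      using \<psi>(1) by (auto simp: wd dist_norm)
  qed
qed

text \<open>Two right-hand sides have the same pairing with every element of
  \<open>H10 \<Omega>\<close>, in particular with every eigenfunction, so completeness identifies
  them.\<close>

lemma op_A_eq:
  assumes "weak_poisson \<Omega> u f"
  shows "op_A \<Omega> u = f"
  unfolding op_A_def
proof (rule the_equality, fact assms)
  fix h assume h: "weak_poisson \<Omega> u h"
  have "h - f = 0"
  proof (rule complete_\<phi>)
    show "h - f \<in> L2_on \<Omega>" using h assms by (intro L2_on_diff) (auto simp: weak_poisson_def)
    fix j
    have "coeff h j = coeff f j"
      using h assms \<phi>_H10[of j] unfolding weak_poisson_def by metis
    then show "coeff (h - f) j = 0" by (simp add: cinner_diff_left)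
  qed
  then show "h = f" by simp
qed

lemma weak_poisson_op_A: "u \<in> dom_A \<Omega> \<Longrightarrow> weak_poisson \<Omega> u (op_A \<Omega> u)"
  by (auto simp: dom_A_def op_A_eq)

lemma weak_poisson_\<phi>: "weak_poisson \<Omega> (\<phi> j) (lam j *\<^sub>R \<phi> j)"
  using eigensystem weak_poisson_op_A[of "\<phi> j"] by (simp add: eigensystem_def)

lemma weak_poisson_linear:
  assumes "weak_poisson \<Omega> u f" "weak_poisson \<Omega> v h"
  shows "weak_poisson \<Omega> (c *\<^sub>C u + d *\<^sub>C v) (c *\<^sub>C f + d *\<^sub>C h)"
proof -
  have H: "u \<in> H10 \<Omega>" "v \<in> H10 \<Omega>" using assms by (auto simp: weak_poisson_def)
  note H1 = H[THEN H10_H1]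
  show ?thesis
    unfolding weak_poisson_def
  proof (intro conjI ballI)
    show "c *\<^sub>C u + d *\<^sub>C v \<in> H10 \<Omega>" by (rule H10_linear[OF H])
    show "c *\<^sub>C f + d *\<^sub>C h \<in> L2_on \<Omega>"
      using assms by (intro L2_on_add L2_on_cscale) (auto simp: weak_poisson_def)
    fix w assume w: "w \<in> H10 \<Omega>"
    have "(\<Sum>i\<in>UNIV. cinner (D i (c *\<^sub>C u + d *\<^sub>C v)) (D i w)) =
        c * (\<Sum>i\<in>UNIV. cinner (D i u) (D i w)) +
        d * (\<Sum>i\<in>UNIV. cinner (D i v) (D i w))"
      by (simp add: weak_deriv_add weak_deriv_cscale H1 H1_cscale cinner_add_left cinner_cscale_left
          sum.distrib sum_distrib_left)
    also have "\<dots> = cinner (c *\<^sub>C f + d *\<^sub>C h) w"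
      using assms w by (simp add: weak_poisson_def cinner_add_left cinner_cscale_left)
    finally show "(\<Sum>i\<in>UNIV. cinner (D i (c *\<^sub>C u + d *\<^sub>C v)) (D i w)) =
        cinner (c *\<^sub>C f + d *\<^sub>C h) w" .
  qed
qed

text \<open>Testing the equation with u itself. It converts convergence of u and f in L^2 into
  convergence of the gradients.\<close>

lemma weak_poisson_energy:
  assumes "weak_poisson \<Omega> u f"
  shows "(norm (D i u))\<^sup>2 \<le> norm f * norm u"
proof -
  have "of_real (\<Sum>i\<in>UNIV. (norm (D i u))\<^sup>2) = (\<Sum>i\<in>UNIV. cinner (D i u) (D i u))"
    by (simp only: cinner_self of_real_sum)
  also have "\<dots> = cinner f u" using assms by (simp add: weak_poisson_def)
  finally have "cinner f u = of_real (\<Sum>i\<in>UNIV. (norm (D i u))\<^sup>2)" ..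
  then have "\<bar>\<Sum>i\<in>UNIV. (norm (D i u))\<^sup>2\<bar> \<le> norm f * norm u"
    using cinner_bound[of f u] by (simp only: norm_of_real)
  moreover have "(norm (D i u))\<^sup>2 \<le> (\<Sum>i\<in>UNIV. (norm (D i u))\<^sup>2)"
    by (rule member_le_sum) auto
  ultimately show ?thesis by linarith
qed

text \<open>The graph of A is closed: the energy estimate for differences of members, with u bounded
  and f Cauchy, makes the gradients Cauchy, and then both sides of the weak equation pass to the
  limit.\<close>

lemma weak_poisson_closed:
  assumes p: "\<And>n. weak_poisson \<Omega> (u n) (f n)" and u: "u \<longlonglongrightarrow> u'" and f: "f \<longlonglongrightarrow> f'"
  shows "weak_poisson \<Omega> u' f'"
proof -
  have H: "u n \<in> H10 \<Omega>" for n using p by (simp add: weak_poisson_def)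
  have diff: "weak_poisson \<Omega> (u m - u n) (f m - f n)" for m n
    using weak_poisson_linear[OF p[of m] p[of n], of 1 "-1"] by (simp add: minus_L2_def)
  obtain B where B: "\<And>m. norm (u m) \<le> B" "0 < B"
    using convergent_imp_Bseq[of u] u by (auto simp: convergent_def Bseq_def)
  have "\<exists>g. (\<lambda>n. D i (u n)) \<longlonglongrightarrow> g" for i
  proof -
    have "Cauchy (\<lambda>n. D i (u n))"
      unfolding Cauchy_iff
    proof (intro allI impI)
      fix e :: real assume e: "0 < e"
      have "Cauchy f" using f by (rule LIMSEQ_imp_Cauchy)
      then obtain M where M: "\<And>m n. M \<le> m \<Longrightarrow> M \<le> n \<Longrightarrow> norm (f m - f n) < e\<^sup>2 / (2 * B)"
        using e B(2) unfolding Cauchy_iff by (meson divide_pos_pos mult_pos_pos zero_less_numeral zero_less_power)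
      have "norm (D i (u m) - D i (u n)) < e" if "M \<le> m" "M \<le> n" for m n
      proof (rule power2_less_imp_less)
        have "D i (u m) - D i (u n) = D i (u m - u n)"
          by (rule weak_deriv_eq[symmetric]) (intro has_weak_deriv_diff has_weak_deriv_weak_deriv H10_H1 H)
        then have "(norm (D i (u m) - D i (u n)))\<^sup>2 \<le> norm (f m - f n) * norm (u m - u n)"
          using weak_poisson_energy[OF diff] by simp
        also have "\<dots> \<le> norm (f m - f n) * (2 * B)"
          using norm_triangle_ineq4[of "u m" "u n"] B(1)[of m] B(1)[of n] by (intro mult_left_mono) auto
        also have "\<dots> < e\<^sup>2" using M[OF that] B(2) by (simp add: field_simps)
        finally show "(norm (D i (u m) - D i (u n)))\<^sup>2 < e\<^sup>2" .
      qed (use e in auto)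
      then show "\<exists>M. \<forall>m\<ge>M. \<forall>n\<ge>M. norm (D i (u m) - D i (u n)) < e" by blast
    qed
    then show ?thesis using Cauchy_convergent convergentD by blast
  qed
  then obtain g where g: "\<And>i. (\<lambda>n. D i (u n)) \<longlonglongrightarrow> g i" by metis
  note closed = H10_closed[OF H u g]
  show ?thesis
    unfolding weak_poisson_def
  proof (intro conjI ballI)
    show "u' \<in> H10 \<Omega>" by (rule closed(1))
    show "f' \<in> L2_on \<Omega>"
      by (rule closed_sequentially[OF closed_L2_on[OF \<Omega>_borel] _ f]) (use p in \<open>simp add: weak_poisson_def\<close>)
    fix w assume w: "w \<in> H10 \<Omega>"
    have "(\<lambda>n. \<Sum>i\<in>UNIV. cinner (D i (u n)) (D i w)) \<longlonglongrightarrow>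
        (\<Sum>i\<in>UNIV. cinner (g i) (D i w))"
      by (intro tendsto_intros g)
    moreover have "(\<lambda>n. cinner (f n) w) \<longlonglongrightarrow> cinner f' w" by (intro tendsto_intros f)
    moreover have "(\<Sum>i\<in>UNIV. cinner (D i (u n)) (D i w)) = cinner (f n) w" for n
      using p[of n] w by (simp add: weak_poisson_def)
    ultimately show "(\<Sum>i\<in>UNIV. cinner (D i u') (D i w)) = cinner f' w"
      unfolding closed(2) using LIMSEQ_unique by simp
  qed
qed

lemma weak_poisson_symmetric:
  assumes "weak_poisson \<Omega> u f" "weak_poisson \<Omega> w h"
  shows "cinner f w = cinner u h"
proof -
  have "cinner f w = (\<Sum>i\<in>UNIV. cinner (D i u) (D i w))"
    using assms by (simp add: weak_poisson_def)
  also have "\<dots> = cnj (\<Sum>i\<in>UNIV. cinner (D i w) (D i u))"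
    unfolding cnj_sum by (intro sum.cong refl cinner_commute)
  also have "\<dots> = cnj (cinner h u)" using assms by (simp add: weak_poisson_def)
  finally show ?thesis using cinner_commute[of u h] by simp
qed

text \<open>Testing the eigenvalue equation with the normalised eigenfunction exhibits the
  eigenvalue as its Dirichlet energy.\<close>

lemma lam_nonneg: "0 \<le> lam j"
proof -
  have "coeff (\<phi> j) j = 1" using orthonormal_\<phi> by (simp add: orthonormal_def)
  then have "of_real (lam j) = coeff (lam j *\<^sub>R \<phi> j) j"
    by (simp add: cinner_scaleR_left scaleR_conv_of_real)
  also have "\<dots> = (\<Sum>i\<in>UNIV. cinner (D i (\<phi> j)) (D i (\<phi> j)))"
    using weak_poisson_\<phi>[of j] by (simp add: weak_poisson_def)
  also have "\<dots> = of_real (\<Sum>i\<in>UNIV. (norm (D i (\<phi> j)))\<^sup>2)"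
    by (simp only: cinner_self of_real_sum)
  finally have "lam j = (\<Sum>i\<in>UNIV. (norm (D i (\<phi> j)))\<^sup>2)" by (simp only: of_real_eq_iff)
  then show ?thesis by (simp add: sum_nonneg)
qed

lemma weak_poisson_sum: "weak_poisson \<Omega> (\<Sum>j<n. c j *\<^sub>C \<phi> j) (\<Sum>j<n. (of_real (lam j) * c j) *\<^sub>C \<phi> j)"
proof (induction n)
  case 0
  show ?case using weak_poisson_linear[OF weak_poisson_\<phi>[of 0] weak_poisson_\<phi>[of 0], of 0 0] by simp
next
  case (Suc n)
  show ?case
    using weak_poisson_linear[OF Suc weak_poisson_\<phi>[of n], of 1 "c n"]
    by (simp add: scaleR_L2_def mult.commute)
qed

section \<open>Eigenfunction expansions and the resolvent\<close>

definition synth :: "(nat \<Rightarrow> complex) \<Rightarrow> L2" where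
  "synth c = (\<Sum>j. c j *\<^sub>C \<phi> j)"

lemma synth_sums: "summable (\<lambda>j. (cmod (c j))\<^sup>2) \<Longrightarrow> (\<lambda>n. \<Sum>j<n. c j *\<^sub>C \<phi> j) \<longlonglongrightarrow> synth c"
  unfolding synth_def by (intro summable_LIMSEQ orthonormal_summable orthonormal_\<phi>)

lemma synth_coeff: "summable (\<lambda>j. (cmod (c j))\<^sup>2) \<Longrightarrow> coeff (synth c) j = c j"
  unfolding synth_def by (intro orthonormal_cinner_suminf orthonormal_summable orthonormal_\<phi>)

lemma synth_in_L2_on:
  assumes "summable (\<lambda>j. (cmod (c j))\<^sup>2)"
  shows "synth c \<in> L2_on \<Omega>"
proof (rule closed_sequentially[OF closed_L2_on[OF \<Omega>_borel] _ synth_sums[OF assms]])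
  show "(\<Sum>j<n. c j *\<^sub>C \<phi> j) \<in> L2_on \<Omega>" for n
    using weak_poisson_sum[of c n] H10_subset by (simp add: weak_poisson_def)
qed

lemma L2_on_eqI:
  assumes "u \<in> L2_on \<Omega>" "v \<in> L2_on \<Omega>" "\<And>j. coeff u j = coeff v j"
  shows "u = v"
  using complete_\<phi>[OF L2_on_diff[OF assms(1,2)]] assms(3) by (simp add: cinner_diff_left)

lemma synth_coeffs:
  assumes "v \<in> L2_on \<Omega>"
  shows "synth (coeff v) = v"
  by (intro L2_on_eqI synth_in_L2_on assms synth_coeff bessel orthonormal_\<phi>)

lemma parseval:
  assumes "v \<in> L2_on \<Omega>"
  shows "(\<lambda>j. (cmod (coeff v j))\<^sup>2) sums (norm v)\<^sup>2"
proof -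
  have "(\<lambda>n. (norm (\<Sum>j<n. coeff v j *\<^sub>C \<phi> j))\<^sup>2) \<longlonglongrightarrow> (norm v)\<^sup>2"
    using synth_sums[OF bessel[OF orthonormal_\<phi>], of v] by (intro tendsto_intros) (simp add: synth_coeffs[OF assms])
  then show ?thesis
    unfolding sums_def by (simp add: orthonormal_norm_sum[OF orthonormal_\<phi>])
qed

text \<open>Parseval is applied to both sides. Besides the final estimates this also yields
  continuity of the resolvent on the contour and the Taylor remainder in norm.\<close>

lemma norm_le_if_coeff_le:
  assumes "u \<in> L2_on \<Omega>" "v \<in> L2_on \<Omega>" "0 \<le> B"
    and le: "\<And>j. cmod (coeff u j) \<le> B * cmod (coeff v j)"
  shows "norm u \<le> B * norm v"
proof (rule power2_le_imp_le)
  have B: "(\<lambda>j. B\<^sup>2 * (cmod (coeff v j))\<^sup>2) sums (B\<^sup>2 * (norm v)\<^sup>2)"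
    by (intro sums_mult parseval assms)
  have "(cmod (coeff u j))\<^sup>2 \<le> B\<^sup>2 * (cmod (coeff v j))\<^sup>2" for j
    using power_mono[OF le norm_ge_zero, of j 2] by (simp add: power_mult_distrib)
  from sums_le[OF this parseval[OF assms(1)] B] show "(norm u)\<^sup>2 \<le> (B * norm v)\<^sup>2"
    by (simp add: power_mult_distrib)
qed (use assms in auto)

text \<open>Finite partial sums lie in the domain, and they converge together with their images, so
  closedness of the graph applies.\<close>

lemma op_A_synth:
  assumes "summable (\<lambda>j. (cmod (c j))\<^sup>2)" "summable (\<lambda>j. (cmod (of_real (lam j) * c j))\<^sup>2)"
  shows "synth c \<in> dom_A \<Omega>" "op_A \<Omega> (synth c) = synth (\<lambda>j. of_real (lam j) * c j)"
proof -
  have "weak_poisson \<Omega> (synth c) (synth (\<lambda>j. of_real (lam j) * c j))"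
    by (rule weak_poisson_closed[OF weak_poisson_sum synth_sums[OF assms(1)] synth_sums[OF assms(2)]])
  then show "synth c \<in> dom_A \<Omega>" "op_A \<Omega> (synth c) = synth (\<lambda>j. of_real (lam j) * c j)"
    by (auto simp: dom_A_def op_A_eq)
qed

lemma dom_A_L2_on:
  assumes "u \<in> dom_A \<Omega>"
  shows "u \<in> L2_on \<Omega>" "op_A \<Omega> u \<in> L2_on \<Omega>"
  using weak_poisson_op_A[OF assms] H10_subset by (auto simp: weak_poisson_def)

lemma op_A_coeff:
  assumes "u \<in> dom_A \<Omega>"
  shows "coeff (op_A \<Omega> u) j = of_real (lam j) * coeff u j"
  using weak_poisson_symmetric[OF weak_poisson_op_A[OF assms] weak_poisson_\<phi>]
  by (simp add: cinner_scaleR_right scaleR_conv_of_real)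

text \<open>Since u equals its own expansion, \<open>op_A_synth\<close> turns summability of the
  weighted coefficients into membership in the domain.\<close>

lemma dom_A_I:
  assumes "u \<in> L2_on \<Omega>" "summable (\<lambda>j. (lam j * cmod (coeff u j))\<^sup>2)"
  shows "u \<in> dom_A \<Omega>"
  using op_A_synth(1)[of "\<lambda>j. coeff u j"] assms(2) bessel[OF orthonormal_\<phi>, of u] lam_nonneg
  by (simp add: synth_coeffs[OF assms(1)] norm_mult)

lemma Hdot_2_subset: "v \<in> Hdot \<Omega> lam \<phi> 2 \<Longrightarrow> v \<in> dom_A \<Omega>"
  using lam_nonneg by (intro dom_A_I) (auto simp: Hdot_def power_mult_distrib)

text \<open>The bound with K controls 1 / |s + \<lambda>| and \<lambda> / |s + \<lambda>| together,
  so the candidate and its image under A are both square summable. Any other solution has the same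
  coefficients, because A acts on them by multiplication.\<close>

lemma resolvent_eq:
  assumes v: "v \<in> L2_on \<Omega>" and s: "\<And>j. s + of_real (lam j) \<noteq> 0"
    and K: "\<And>j. 1 + lam j \<le> K * cmod (s + of_real (lam j))"
  shows "resolvent \<Omega> s v = synth (\<lambda>j. coeff v j / (s + of_real (lam j)))"
    and "summable (\<lambda>j. (cmod (coeff v j / (s + of_real (lam j))))\<^sup>2)"
proof -
  define c where "c j = coeff v j / (s + of_real (lam j))" for j
  have le: "cmod (c j) \<le> K * cmod (coeff v j)" "cmod (of_real (lam j) * c j) \<le> K * cmod (coeff v j)" for j
  proof -
    have pos: "0 < cmod (s + of_real (lam j))" using s by simp
    have "cmod (coeff v j) * (1 + lam j) \<le> cmod (coeff v j) * (K * cmod (s + of_real (lam j)))"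
      by (intro mult_left_mono K) simp
    then have "(1 + lam j) * cmod (c j) \<le> K * cmod (coeff v j)"
      using pos by (simp add: c_def norm_divide field_simps)
    then have "cmod (c j) + lam j * cmod (c j) \<le> K * cmod (coeff v j)" by (simp add: distrib_right)
    moreover have "0 \<le> lam j * cmod (c j)" using lam_nonneg by simp
    moreover have "cmod (of_real (lam j) * c j) = lam j * cmod (c j)" using lam_nonneg[of j] by (simp add: norm_mult)
    ultimately show "cmod (c j) \<le> K * cmod (coeff v j)" "cmod (of_real (lam j) * c j) \<le> K * cmod (coeff v j)"
      using norm_ge_zero[of "c j"] by linarith+
  qed
  have sm: "summable (\<lambda>j. (cmod (d j))\<^sup>2)" if "\<And>j. cmod (d j) \<le> K * cmod (coeff v j)" for d :: "nat \<Rightarrow> complex"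
  proof (rule summable_comparison_test')
    show "summable (\<lambda>j. K\<^sup>2 * (cmod (coeff v j))\<^sup>2)"
      by (intro summable_mult bessel orthonormal_\<phi>)
    show "norm ((cmod (d j))\<^sup>2) \<le> K\<^sup>2 * (cmod (coeff v j))\<^sup>2" for j
      using power_mono[OF that norm_ge_zero, of j 2] by (simp add: power_mult_distrib)
  qed
  note s1 = sm[of c, OF le(1)] and s2 = sm[of "\<lambda>j. of_real (lam j) * c j", OF le(2)]
  show "summable (\<lambda>j. (cmod (coeff v j / (s + of_real (lam j))))\<^sup>2)" using s1 by (simp add: c_def)
  note A = op_A_synth[OF s1 s2]
  have "resolvent \<Omega> s v = synth c"
    unfolding resolvent_def
  proof (rule the_equality)
    have "s *\<^sub>C synth c + op_A \<Omega> (synth c) = v"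
    proof (rule L2_on_eqI)
      show "s *\<^sub>C synth c + op_A \<Omega> (synth c) \<in> L2_on \<Omega>"
        by (intro L2_on_add L2_on_cscale dom_A_L2_on A)
      fix j
      have "coeff (s *\<^sub>C synth c + op_A \<Omega> (synth c)) j = (s + of_real (lam j)) * c j"
        unfolding A(2) by (simp add: cinner_add_left cinner_cscale_left synth_coeff s1 s2 distrib_right)
      then show "coeff (s *\<^sub>C synth c + op_A \<Omega> (synth c)) j = coeff v j"
        using s by (simp add: c_def)
    qed (rule v)
    then show "synth c \<in> dom_A \<Omega> \<and> s *\<^sub>C synth c + op_A \<Omega> (synth c) = v" using A by simp
  next
    fix u assume u: "u \<in> dom_A \<Omega> \<and> s *\<^sub>C u + op_A \<Omega> u = v"
    show "u = synth c"
    proof (rule L2_on_eqI)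
      show "u \<in> L2_on \<Omega>" using u dom_A_L2_on by blast
      show "synth c \<in> L2_on \<Omega>" by (rule synth_in_L2_on[OF s1])
      fix j
      have "coeff v j = (s + of_real (lam j)) * coeff u j"
        using u op_A_coeff[of u j] by (auto simp: cinner_add_left cinner_cscale_left distrib_right)
      then show "coeff u j = coeff (synth c) j"
        using s by (simp add: synth_coeff[OF s1] c_def)
    qed
  qed
  then show "resolvent \<Omega> s v = synth (\<lambda>j. coeff v j / (s + of_real (lam j)))"
    by (simp add: c_def[abs_def])
qed

end

section \<open>The solution operator in the eigenbasis\<close>

lemma hankel_cong:
  assumes "0 \<le> \<theta>" "\<And>z. z \<in> hankel_contour \<theta> \<delta> \<Longrightarrow> h z = k z"
  shows "hankel \<theta> \<delta> h = hankel \<theta> \<delta> k"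
  unfolding hankel_def
  by (intro arg_cong2[where f = "(+)"] arg_cong[where f = uminus] Henstock_Kurzweil_Integration.integral_cong)
     (auto intro!: assms hankel_contour_ray hankel_contour_arc)

lemma hankel_integral_integrable:
  fixes F :: "complex \<Rightarrow> L2"
  assumes F: "hankel_dominated \<theta> \<delta> c B F" and "0 \<le> \<theta>" "0 < \<delta>" "0 < c"
  shows "(\<lambda>\<rho>. cis (- \<theta>) *\<^sub>C F (of_real \<rho> * cis (- \<theta>))) integrable_on {\<delta>..}"
    and "(\<lambda>\<psi>. (\<i> * of_real \<delta> * cis \<psi>) *\<^sub>C F (of_real \<delta> * cis \<psi>)) integrable_on {- \<theta>..\<theta>}"
    and "(\<lambda>\<rho>. cis \<theta> *\<^sub>C F (of_real \<rho> * cis \<theta>)) integrable_on {\<delta>..}"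
proof -
  have c: "continuous_on {\<delta>..} (\<lambda>\<rho>. cis \<psi> *\<^sub>C F (of_real \<rho> * cis \<psi>))"
    and b: "\<And>\<rho>. \<delta> \<le> \<rho> \<Longrightarrow> norm (cis \<psi> *\<^sub>C F (of_real \<rho> * cis \<psi>)) \<le> B * exp (- c * \<rho>)"
    if "\<bar>\<psi>\<bar> = \<theta>" for \<psi>
    using hankel_dominated_rays[OF assms that] by (auto intro!: continuous_intros simp: norm_cscale)
  have "(\<lambda>\<rho>. cis \<psi> *\<^sub>C F (of_real \<rho> * cis \<psi>)) integrable_on {\<delta>..}" if "\<bar>\<psi>\<bar> = \<theta>" for \<psi>
    by (rule exp_dominated_integral(1)[OF c[OF that] \<open>0 < c\<close> b[OF that]])
  then show "(\<lambda>\<rho>. cis (- \<theta>) *\<^sub>C F (of_real \<rho> * cis (- \<theta>))) integrable_on {\<delta>..}"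
    "(\<lambda>\<rho>. cis \<theta> *\<^sub>C F (of_real \<rho> * cis \<theta>)) integrable_on {\<delta>..}"
    using assms(2) by auto
  show "(\<lambda>\<psi>. (\<i> * of_real \<delta> * cis \<psi>) *\<^sub>C F (of_real \<delta> * cis \<psi>)) integrable_on {- \<theta>..\<theta>}"
    by (intro integrable_continuous_real continuous_intros hankel_dominated_arc(1)[OF assms])
qed

text \<open>Pairing with a fixed vector is bounded and linear, hence commutes with each of the three
  integrals.\<close>

lemma cinner_hankel_integral:
  assumes "hankel_dominated \<theta> \<delta> c B F" "0 \<le> \<theta>" "0 < \<delta>" "0 < c"
  shows "cinner (hankel_integral \<theta> \<delta> F) w = hankel \<theta> \<delta> (\<lambda>z. cinner (F z) w)"
proof -
  have *: "cinner (integral S G) w = integral S (\<lambda>x. cinner (G x) w)" if "G integrable_on S" for S :: "real set" and G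
    using integral_linear[OF that bounded_linear_cinner_left[of w]] by (simp add: o_def)
  show ?thesis
    unfolding hankel_integral_def hankel_def
    by (simp add: cinner_add_left cinner_diff_left cinner_minus_left hankel_integral_integrable[OF assms] * cinner_cscale_left)
qed

text \<open>The projection \<open>restrict_L2\<close> commutes with the integral and fixes every
  value of the integrand.\<close>

lemma integral_in_L2_on:
  fixes G :: "real \<Rightarrow> L2"
  assumes "\<Omega> \<in> sets borel" "G integrable_on S" "\<And>x. x \<in> S \<Longrightarrow> G x \<in> L2_on \<Omega>"
  shows "integral S G \<in> L2_on \<Omega>"
proof -
  have "restrict_L2 \<Omega> (integral S G) = integral S (\<lambda>x. restrict_L2 \<Omega> (G x))"
    using integral_linear[OF assms(2) bounded_linear_restrict_L2[of \<Omega>]] by (simp add: o_def)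
  also have "\<dots> = integral S G"
    using assms(3) by (intro Henstock_Kurzweil_Integration.integral_cong) (simp add: L2_on_iff[OF assms(1)])
  finally show ?thesis by (simp add: L2_on_iff[OF assms(1)])
qed

lemma hankel_integral_in_L2_on:
  assumes "hankel_dominated \<theta> \<delta> c B F" "0 \<le> \<theta>" "0 < \<delta>" "0 < c" "\<Omega> \<in> sets borel"
    and "\<And>z. z \<in> hankel_contour \<theta> \<delta> \<Longrightarrow> F z \<in> L2_on \<Omega>"
  shows "hankel_integral \<theta> \<delta> F \<in> L2_on \<Omega>"
proof -
  have neg: "- u \<in> L2_on \<Omega>" if "u \<in> L2_on \<Omega>" for u
    using L2_on_cscale[OF that, of "-1"] by (simp add: cscale_minus_one)
  show ?thesis
    unfolding hankel_integral_def
    by (intro L2_on_add neg integral_in_L2_on[OF assms(5)] hankel_integral_integrable[OF assms(1-4)] L2_on_cscale assms(6))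
       (use assms(2) in auto)
qed

section \<open>The solution operator and its derivatives as multipliers\<close>

locale oldroyd_dirichlet = oldroyd \<alpha> \<beta> \<mu> a b + dirichlet_eigensystem \<Omega> lam \<phi>
  for \<alpha> \<beta> \<mu> a b \<Omega> lam \<phi> +
  fixes \<theta> \<delta> :: real
  assumes \<theta>: "pi / 2 < \<theta>" "\<theta> < \<Theta>" and \<delta>: "0 < \<delta>"
begin

abbreviation \<Gamma> :: "complex set" where "\<Gamma> \<equiv> hankel_contour \<theta> \<delta>"

abbreviation R :: "complex \<Rightarrow> L2 \<Rightarrow> L2" where "R \<equiv> E_hat \<Omega> g"

abbreviation E :: "nat \<Rightarrow> real \<Rightarrow> L2 \<Rightarrow> L2" where "E \<equiv> sol_op_deriv \<Omega> g \<theta> \<delta>"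

lemma \<theta>_nonneg: "0 \<le> \<theta>" and \<theta>_less_pi: "\<theta> < pi" and cos_\<theta>: "cos \<theta> < 0"
proof -
  show "0 \<le> \<theta>" using \<theta> pi_gt_zero by linarith
  show *: "\<theta> < pi" using \<theta> \<Theta>_bounds by linarith
  show "cos \<theta> < 0" using cos_neg[OF \<theta>(1)] * by simp
qed

lemma E_hat_props:
  assumes v: "v \<in> L2_on \<Omega>" and z: "z \<in> \<Gamma>"
  shows "R z v \<in> L2_on \<Omega>"
    and "coeff (R z v) j = symb (lam j) z * coeff v j"
    and "norm (symb (lam j) z) \<le> sector_const \<theta> / \<delta>"
proof -
  note zs = hankel_contour_sector[OF z \<theta>_nonneg \<delta>]
  note n = norm_g_add_ge[OF zs(1) \<theta>(2) lam_nonneg]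
  \<comment> \<open>Expanding (1 + 1 / |g|) (|g| + \<lambda>) produces 1 + \<lambda> plus
    nonnegative terms. This K depends on z, which is harmless: it only places the candidate in the
    domain and does not enter the norm bound.\<close>
  define K where "K = (1 + 1 / norm (g z)) * sector_const \<theta>"
  have K: "1 + lam j \<le> K * cmod (g z + of_real (lam j))" for j
  proof -
    have "1 + lam j \<le> (1 + 1 / norm (g z)) * (norm (g z) + lam j)"
      using n(2) lam_nonneg[of j] by (simp add: algebra_simps)
    also have "\<dots> \<le> (1 + 1 / norm (g z)) * (sector_const \<theta> * cmod (g z + of_real (lam j)))"
      by (intro mult_left_mono n(1)) simp
    finally show ?thesis by (simp add: K_def mult.assoc)
  qed
  note res = resolvent_eq[OF v n(3) K]
  show "R z v \<in> L2_on \<Omega>"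
    unfolding E_hat_def res(1) by (intro L2_on_cscale synth_in_L2_on res(2))
  show "coeff (R z v) j = symb (lam j) z * coeff v j"
    unfolding E_hat_def res(1) cinner_cscale_left synth_coeff[OF res(2)] by (simp add: symb_def)
  have "norm (symb (lam j) z) \<le> sector_const \<theta> / cmod z"
    by (rule norm_symb_le(1)[OF zs(1) \<theta>(2) lam_nonneg])
  also have "\<dots> \<le> sector_const \<theta> / \<delta>"
    using zs(2) sector_const_pos(2)[OF \<theta>_nonneg \<theta>(2)] \<delta>
    by (intro frac_le) auto
  finally show "norm (symb (lam j) z) \<le> sector_const \<theta> / \<delta>" .
qed

lemma E_hat_norm_le:
  assumes v: "v \<in> L2_on \<Omega>" and z: "z \<in> \<Gamma>"
  shows "norm (R z v) \<le> sector_const \<theta> / \<delta> * norm v"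
proof (rule norm_le_if_coeff_le[OF E_hat_props(1)[OF v z] v])
  show "0 \<le> sector_const \<theta> / \<delta>" using sector_const_pos(2)[OF \<theta>_nonneg \<theta>(2)] \<delta> by simp
  show "cmod (coeff (R z v) j) \<le> sector_const \<theta> / \<delta> * cmod (coeff v j)" for j
    unfolding E_hat_props(2)[OF v z] norm_mult by (intro mult_right_mono E_hat_props(3)[OF v z]) simp
qed

text \<open>Finite sums over the eigenbasis are continuous in z and converge uniformly on the
  contour: the coefficients of the error are those of \<open>w n - v\<close> multiplied by a symbol
  bounded independently of z. Continuity is what makes the contour integrals exist.\<close>

lemma E_hat_continuous:
  assumes v: "v \<in> L2_on \<Omega>"
  shows "continuous_on \<Gamma> (\<lambda>z. R z v)"
proof (rule uniform_limit_theorem)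
  let ?c = "\<lambda>j. coeff v j"
  define f where "f n z = (\<Sum>j<n. (symb (lam j) z * ?c j) *\<^sub>C \<phi> j)" for n z
  define w where "w n = (\<Sum>j<n. ?c j *\<^sub>C \<phi> j)" for n
  define M where "M = sector_const \<theta> / \<delta>"
  have M: "0 < M" using sector_const_pos(2)[OF \<theta>_nonneg \<theta>(2)] \<delta> by (simp add: M_def)
  show "\<forall>\<^sub>F n in sequentially. continuous_on \<Gamma> (f n)"
    unfolding f_def
    by (intro always_eventually allI continuous_intros symb_continuous lam_nonneg \<delta> \<theta>_nonneg \<theta>(2))
  have in_L2: "(\<Sum>j<n. d j *\<^sub>C \<phi> j) \<in> L2_on \<Omega>" for n d
    using weak_poisson_sum[of d n] H10_subset by (simp add: weak_poisson_def)
  have le: "norm (f n z - R z v) \<le> M * norm (w n - v)" if z: "z \<in> \<Gamma>" for n z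
  proof (rule norm_le_if_coeff_le)
    show "f n z - R z v \<in> L2_on \<Omega>" "w n - v \<in> L2_on \<Omega>"
      unfolding f_def w_def by (intro L2_on_diff in_L2 E_hat_props(1)[OF v z] v)+
    fix j
    have "coeff (f n z - R z v) j = symb (lam j) z * coeff (w n - v) j"
      unfolding f_def w_def cinner_diff_left E_hat_props(2)[OF v z]
      by (simp add: orthonormal_cinner_sum[OF orthonormal_\<phi>])
    then show "cmod (coeff (f n z - R z v) j) \<le> M * cmod (coeff (w n - v) j)"
      unfolding M_def by (simp only: norm_mult) (intro mult_right_mono E_hat_props(3)[OF v z] norm_ge_zero)
  qed (use M in simp)
  have "w \<longlonglongrightarrow> v"
    using synth_sums[OF bessel[OF orthonormal_\<phi>], of v] by (simp add: synth_coeffs[OF v] w_def[abs_def])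
  show "uniform_limit \<Gamma> f (\<lambda>z. R z v) sequentially"
  proof (rule uniform_limitI)
    fix e :: real assume e: "0 < e"
    have "\<forall>\<^sub>F n in sequentially. dist (w n) v < e / M"
      by (rule tendstoD[OF \<open>w \<longlonglongrightarrow> v\<close>]) (use e M in simp)
    then show "\<forall>\<^sub>F n in sequentially. \<forall>z\<in>\<Gamma>. dist (f n z) (R z v) < e"
    proof eventually_elim
      case (elim n)
      then have "M * norm (w n - v) < e" using M by (simp add: dist_norm field_simps)
      then show ?case using le[of _ n] by (auto simp: dist_norm intro: le_less_trans)
    qed
  qed
qed simp

lemma sol_op_integrand_dominated:
  assumes v: "v \<in> L2_on \<Omega>" and t: "0 < t"
  obtains B c where "0 < c" "hankel_dominated \<theta> \<delta> c B (\<lambda>z. exp (z * of_real t) *\<^sub>C R z v)"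
proof
  show "0 < - cos \<theta> * t" using cos_\<theta> t by (simp add: mult_neg_pos)
  show "hankel_dominated \<theta> \<delta> (- cos \<theta> * t) (exp (2 * t * \<delta>) * (sector_const \<theta> / \<delta> * norm v))
      (\<lambda>z. exp (z * of_real t) *\<^sub>C R z v)"
    unfolding hankel_dominated_def
  proof (intro conjI ballI)
    show "continuous_on \<Gamma> (\<lambda>z. exp (z * of_real t) *\<^sub>C R z v)"
      by (intro continuous_intros E_hat_continuous[OF v])
    fix z assume z: "z \<in> \<Gamma>"
    have "norm (exp (z * of_real t) *\<^sub>C R z v) \<le>
        (exp (2 * t * \<delta>) * exp (cos \<theta> * t * cmod z)) * (sector_const \<theta> / \<delta> * norm v)"
      unfolding norm_cscale using \<theta>_less_pi t
      by (intro mult_mono norm_exp_hankel_contour[OF z \<theta>_nonneg _ \<delta>] E_hat_norm_le[OF v z]) auto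
    then show "norm (exp (z * of_real t) *\<^sub>C R z v) \<le>
        exp (2 * t * \<delta>) * (sector_const \<theta> / \<delta> * norm v) * exp (- (- cos \<theta> * t) * cmod z)"
      by (simp add: mult_ac)
  qed
qed

lemma sol_op_props:
  assumes v: "v \<in> L2_on \<Omega>" and t: "0 < t"
  shows "sol_op \<Omega> g \<theta> \<delta> t v \<in> L2_on \<Omega>"
    and "coeff (sol_op \<Omega> g \<theta> \<delta> t v) j = evol \<theta> \<delta> 0 (lam j) t * coeff v j"
proof -
  obtain B c where d: "0 < c" "hankel_dominated \<theta> \<delta> c B (\<lambda>z. exp (z * of_real t) *\<^sub>C R z v)"
    using sol_op_integrand_dominated[OF v t] by blast
  show "sol_op \<Omega> g \<theta> \<delta> t v \<in> L2_on \<Omega>"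
    unfolding sol_op_def
    by (intro L2_on_cscale hankel_integral_in_L2_on[OF d(2) \<theta>_nonneg \<delta> d(1) \<Omega>_borel] E_hat_props(1)[OF v])
  have "hankel \<theta> \<delta> (\<lambda>z. coeff (exp (z * of_real t) *\<^sub>C R z v) j) =
      hankel \<theta> \<delta> (\<lambda>z. coeff v j * (exp (z * of_real t) * (z ^ 0 * symb (lam j) z)))"
    by (intro hankel_cong \<theta>_nonneg) (simp add: cinner_cscale_left E_hat_props(2)[OF v])
  then show "coeff (sol_op \<Omega> g \<theta> \<delta> t v) j = evol \<theta> \<delta> 0 (lam j) t * coeff v j"
    unfolding sol_op_def cinner_cscale_left cinner_hankel_integral[OF d(2) \<theta>_nonneg \<delta> d(1)]
    by (simp add: evol_def hankel_cmult)
qed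

text \<open>The candidate for the k-th derivative, available as a multiplier before
  differentiability is known.\<close>

definition evol_op :: "nat \<Rightarrow> real \<Rightarrow> L2 \<Rightarrow> L2" where
  "evol_op k t v = synth (\<lambda>j. evol \<theta> \<delta> k (lam j) t * coeff v j)"

lemma summable_mult_coeff:
  assumes "\<And>j. cmod (d j) \<le> B"
  shows "summable (\<lambda>j. (cmod (d j * coeff v j))\<^sup>2)"
proof (rule summable_comparison_test')
  show "summable (\<lambda>j. B\<^sup>2 * (cmod (coeff v j))\<^sup>2)"
    by (intro summable_mult bessel orthonormal_\<phi>)
  show "norm ((cmod (d j * coeff v j))\<^sup>2) \<le> B\<^sup>2 * (cmod (coeff v j))\<^sup>2" for j
    using mult_right_mono[OF power_mono[OF assms[of j] norm_ge_zero, of 2], of "(cmod (coeff v j))\<^sup>2"]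
    by (simp add: norm_mult power_mult_distrib)
qed

lemma evol_op_props:
  assumes "0 < t"
  shows "evol_op k t v \<in> L2_on \<Omega>"
    and "coeff (evol_op k t v) j = evol \<theta> \<delta> k (lam j) t * coeff v j"
proof -
  obtain C where C: "\<And>l. 0 \<le> l \<Longrightarrow> norm (evol \<theta> \<delta> k l t) \<le> C"
    using evol_bound[of k] \<theta> \<delta> assms by metis
  have "summable (\<lambda>j. (cmod (evol \<theta> \<delta> k (lam j) t * coeff v j))\<^sup>2)"
    by (rule summable_mult_coeff[OF C[OF lam_nonneg]])
  then show "evol_op k t v \<in> L2_on \<Omega>"
    and "coeff (evol_op k t v) j = evol \<theta> \<delta> k (lam j) t * coeff v j"
    by (simp_all add: evol_op_def synth_in_L2_on synth_coeff)
qed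

lemma sol_op_eq: "v \<in> L2_on \<Omega> \<Longrightarrow> 0 < t \<Longrightarrow> sol_op \<Omega> g \<theta> \<delta> t v = evol_op 0 t v"
  by (intro L2_on_eqI) (simp_all add: sol_op_props evol_op_props)

text \<open>The scalar Taylor remainder has one constant for all eigenvalues, so Parseval turns it
  into a quadratic remainder in norm.\<close>

lemma evol_op_has_vector_derivative:
  assumes v: "v \<in> L2_on \<Omega>" and t: "0 < t"
  shows "((\<lambda>s. evol_op k s v) has_vector_derivative evol_op (Suc k) t v) (at t)"
proof -
  obtain C \<epsilon> where C: "0 \<le> C" "0 < \<epsilon>" "\<epsilon> < t"
    "\<And>l s. 0 \<le> l \<Longrightarrow> \<bar>s - t\<bar> \<le> \<epsilon> \<Longrightarrow>
       norm (evol \<theta> \<delta> k l s - evol \<theta> \<delta> k l t - of_real (s - t) * evol \<theta> \<delta> (Suc k) l t) \<le> C * (s - t)\<^sup>2"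
    using evol_taylor[OF \<theta> \<delta> t, of k] by metis
  let ?r = "\<lambda>s. evol_op k s v - evol_op k t v - (s - t) *\<^sub>R evol_op (Suc k) t v"
  have le: "norm (?r s) \<le> (C * (s - t)\<^sup>2) * norm v" if s: "\<bar>s - t\<bar> \<le> \<epsilon>" for s
  proof (rule norm_le_if_coeff_le[OF _ v])
    have s0: "0 < s" using s C by linarith
    show "?r s \<in> L2_on \<Omega>"
      unfolding scaleR_L2_def by (intro L2_on_diff L2_on_cscale evol_op_props s0 t)
    show "0 \<le> C * (s - t)\<^sup>2" using C by simp
    fix j
    have "coeff (?r s) j =
        (evol \<theta> \<delta> k (lam j) s - evol \<theta> \<delta> k (lam j) t - of_real (s - t) * evol \<theta> \<delta> (Suc k) (lam j) t) * coeff v j"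
      unfolding cinner_diff_left cinner_scaleR_left evol_op_props(2)[OF s0] evol_op_props(2)[OF t]
      by (simp add: scaleR_conv_of_real algebra_simps)
    then show "cmod (coeff (?r s) j) \<le> C * (s - t)\<^sup>2 * cmod (coeff v j)"
      unfolding norm_mult by (simp only: norm_mult) (intro mult_right_mono C(4) lam_nonneg s norm_ge_zero)
  qed
  have "((\<lambda>s. norm (?r s) / norm (s - t)) \<longlongrightarrow> 0) (at t)"
  proof (rule Lim_null_comparison)
    have "((\<lambda>s. C * \<bar>s - t\<bar> * norm v) \<longlongrightarrow> C * \<bar>t - t\<bar> * norm v) (at t)"
      by (intro tendsto_intros)
    then show "((\<lambda>s. C * \<bar>s - t\<bar> * norm v) \<longlongrightarrow> 0) (at t)" by simp
    show "\<forall>\<^sub>F s in at t. norm (norm (?r s) / norm (s - t)) \<le> C * \<bar>s - t\<bar> * norm v"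
      unfolding eventually_at
    proof (intro exI[of _ \<epsilon>] conjI ballI impI C(2))
      fix s assume s: "s \<noteq> t \<and> dist s t < \<epsilon>"
      then have "norm (?r s) \<le> (C * (s - t)\<^sup>2) * norm v" by (intro le) (simp add: dist_real_def)
      also have "\<dots> = (C * \<bar>s - t\<bar> * norm v) * \<bar>s - t\<bar>"
        by (simp add: power2_eq_square mult_ac flip: abs_mult)
      finally show "norm (norm (?r s) / norm (s - t)) \<le> C * \<bar>s - t\<bar> * norm v"
        using s by (simp add: divide_le_eq)
    qed
  qed
  then show ?thesis
    unfolding has_vector_derivative_def has_derivative_iff_norm
    by (intro conjI bounded_linear_scaleR_left)
qed

text \<open>A derivative at t depends on nearby values, so the induction on k carries the equality
  on the whole open half line and not only at the given t.\<close>

lemma sol_op_deriv_eq: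
  assumes v: "v \<in> L2_on \<Omega>" and "0 < t"
  shows "E k t v = evol_op k t v"
    and "((\<lambda>s. E k s v) has_vector_derivative evol_op (Suc k) t v) (at t)"
proof -
  have deriv: "((\<lambda>s. E k s v) has_vector_derivative evol_op (Suc k) t v) (at t)"
    if eq: "\<And>s. 0 < s \<Longrightarrow> E k s v = evol_op k s v" and t: "0 < t" for k t
    by (rule has_vector_derivative_transform_within_open[OF evol_op_has_vector_derivative[OF v t], of "{0<..}"])
       (use t eq in auto)
  have eq: "0 < t \<Longrightarrow> E k t v = evol_op k t v" for k t
  proof (induction k arbitrary: t)
    case 0
    then show ?case by (simp add: sol_op_deriv_def sol_op_eq[OF v])
  next
    case (Suc k)
    have "E (Suc k) t v = vector_derivative (\<lambda>s. E k s v) (at t)"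
      by (simp add: sol_op_deriv_def)
    also have "\<dots> = evol_op (Suc k) t v"
      by (rule vector_derivative_at[OF deriv[OF Suc.IH Suc.prems]])
    finally show ?case .
  qed
  show "E k t v = evol_op k t v" by (rule eq[OF \<open>0 < t\<close>])
  show "((\<lambda>s. E k s v) has_vector_derivative evol_op (Suc k) t v) (at t)"
    by (rule deriv[OF eq \<open>0 < t\<close>])
qed

lemma evol_op_in_dom_A:
  assumes t: "0 < t"
  shows "evol_op k t v \<in> dom_A \<Omega>"
proof (rule dom_A_I[OF evol_op_props(1)[OF t]])
  \<comment> \<open>The time t itself is used as the bound T; only the finiteness of C matters for
    membership in the domain.\<close>
  obtain C where C: "\<And>l. 0 \<le> l \<Longrightarrow> l * norm (evol \<theta> \<delta> k l t) \<le> C"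
    using evol_smoothing_bound[OF t, of k] \<theta> \<delta> t by (metis order_refl)
  have "cmod (of_real (lam j) * evol \<theta> \<delta> k (lam j) t) \<le> C" for j
    using C[OF lam_nonneg, of j] lam_nonneg[of j] by (simp add: norm_mult)
  from summable_mult_coeff[OF this, where v = v]
  show "summable (\<lambda>j. (lam j * cmod (coeff (evol_op k t v) j))\<^sup>2)"
    using lam_nonneg by (simp add: evol_op_props(2)[OF t] norm_mult mult.assoc)
qed

lemma op_A_evol_op_coeff:
  assumes "0 < t"
  shows "cmod (coeff (op_A \<Omega> (evol_op k t v)) j) = lam j * norm (evol \<theta> \<delta> k (lam j) t) * cmod (coeff v j)"
  using lam_nonneg[of j]
  by (simp add: op_A_coeff evol_op_in_dom_A evol_op_props assms norm_mult)

text \<open>The four combinations of \<nu> with data in L^2 or in the domain, each reduced to one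
  multiplier bound. In the last one A and the multiplier commute, so the eigenvalue is charged to
  v.\<close>

lemma evol_op_bounds:
  assumes t: "0 < t" and v: "v \<in> L2_on \<Omega>" and K: "0 \<le> K"
  shows "(\<And>j. norm (evol \<theta> \<delta> k (lam j) t) \<le> K) \<Longrightarrow> norm (evol_op k t v) \<le> K * norm v"
    and "(\<And>j. lam j * norm (evol \<theta> \<delta> k (lam j) t) \<le> K) \<Longrightarrow> norm (op_A \<Omega> (evol_op k t v)) \<le> K * norm v"
    and "v \<in> dom_A \<Omega> \<Longrightarrow> (\<And>j. norm (evol \<theta> \<delta> k (lam j) t) \<le> K * lam j) \<Longrightarrow> norm (evol_op k t v) \<le> K * norm (op_A \<Omega> v)"
    and "v \<in> dom_A \<Omega> \<Longrightarrow> (\<And>j. norm (evol \<theta> \<delta> k (lam j) t) \<le> K) \<Longrightarrow> norm (op_A \<Omega> (evol_op k t v)) \<le> K * norm (op_A \<Omega> v)"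
proof -
  note U = evol_op_props(1)[OF t, of k v] dom_A_L2_on(2)[OF evol_op_in_dom_A[OF t, of k v]]
  have A: "cmod (coeff (op_A \<Omega> v) j) = lam j * cmod (coeff v j)" if "v \<in> dom_A \<Omega>" for j
    using op_A_coeff[OF that] lam_nonneg[of j] by (simp add: norm_mult)
  show "norm (evol_op k t v) \<le> K * norm v" if "\<And>j. norm (evol \<theta> \<delta> k (lam j) t) \<le> K"
    by (rule norm_le_if_coeff_le[OF U(1) v K])
       (use that in \<open>simp add: evol_op_props(2)[OF t] norm_mult mult_right_mono\<close>)
  show "norm (op_A \<Omega> (evol_op k t v)) \<le> K * norm v" if "\<And>j. lam j * norm (evol \<theta> \<delta> k (lam j) t) \<le> K"
    by (rule norm_le_if_coeff_le[OF U(2) v K])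
       (use that in \<open>simp add: op_A_evol_op_coeff[OF t] mult_right_mono\<close>)
  show "norm (evol_op k t v) \<le> K * norm (op_A \<Omega> v)"
    if d: "v \<in> dom_A \<Omega>" and le: "\<And>j. norm (evol \<theta> \<delta> k (lam j) t) \<le> K * lam j"
    by (rule norm_le_if_coeff_le[OF U(1) dom_A_L2_on(2)[OF d] K])
       (use le in \<open>simp add: evol_op_props(2)[OF t] A[OF d] norm_mult mult_right_mono flip: mult.assoc\<close>)
  show "norm (op_A \<Omega> (evol_op k t v)) \<le> K * norm (op_A \<Omega> v)"
    if d: "v \<in> dom_A \<Omega>" and le: "\<And>j. norm (evol \<theta> \<delta> k (lam j) t) \<le> K"
  proof (rule norm_le_if_coeff_le[OF U(2) dom_A_L2_on(2)[OF d] K])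
    fix j
    have "norm (evol \<theta> \<delta> k (lam j) t) * (lam j * cmod (coeff v j)) \<le> K * (lam j * cmod (coeff v j))"
      using lam_nonneg by (intro mult_right_mono le) simp
    then show "cmod (coeff (op_A \<Omega> (evol_op k t v)) j) \<le> K * cmod (coeff (op_A \<Omega> v) j)"
      by (simp add: op_A_evol_op_coeff[OF t] A[OF d] mult_ac)
  qed
qed

end

theorem theorem2p1:
  fixes \<alpha> \<beta> \<mu> a b T :: real and m :: nat
  assumes "0 < \<alpha>" "\<alpha> < 1" "0 < \<beta>" "\<beta> < 1" "0 < \<mu>" "0 < a" "0 < b" "0 < T"
  shows "\<exists>C::real. \<forall>\<Omega> lam \<phi> \<theta> \<delta>.
    convex_polygonal_domain \<Omega> \<longrightarrow> eigensystem \<Omega> lam \<phi> \<longrightarrow>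
    pi / 2 < \<theta> \<longrightarrow> \<theta> < pi / (1 + \<alpha>) \<longrightarrow> 0 < \<delta> \<longrightarrow>
    (let A = op_A \<Omega>; E = sol_op_deriv \<Omega> (oldroyd_g \<alpha> \<beta> \<mu> a b) \<theta> \<delta> in
      (\<forall>t\<in>{0<..T}. \<forall>v\<in>L2_on \<Omega>.
         (\<forall>k<m. (\<lambda>s. E k s v) differentiable (at t)) \<and> E m t v \<in> dom_A \<Omega>) \<and>
      (\<forall>t\<in>{0<..T}. \<forall>\<nu>\<in>{0, 1::nat}.
         (\<forall>v\<in>L2_on \<Omega>.
            norm ((A ^^ \<nu>) (E m t v)) \<le> C * t powr (- real m - real \<nu> * (\<alpha> - \<beta> + 1)) * norm v) \<and>
         (\<nu> + m \<ge> 1 \<longrightarrow> (\<forall>v\<in>Hdot \<Omega> lam \<phi> 2.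
            norm ((A ^^ \<nu>) (E m t v))
              \<le> C * t powr (- real m + (1 - real \<nu>) * (\<alpha> - \<beta> + 1)) * norm (A v)))))"
proof -
  interpret oldroyd \<alpha> \<beta> \<mu> a b using assms by unfold_locales
  obtain C1 where C1: "0 < C1"
    "\<And>\<theta> \<delta> l t. pi / 2 < \<theta> \<Longrightarrow> \<theta> < \<Theta> \<Longrightarrow> 0 < \<delta> \<Longrightarrow> 0 \<le> l \<Longrightarrow> 0 < t \<Longrightarrow>
       norm (evol \<theta> \<delta> m l t) \<le> C1 * t powr (- real m)"
    by (rule evol_bound[of m]) blast
  obtain C2 where C2: "0 < C2"
    "\<And>\<theta> \<delta> l t. pi / 2 < \<theta> \<Longrightarrow> \<theta> < \<Theta> \<Longrightarrow> 0 < \<delta> \<Longrightarrow> 0 \<le> l \<Longrightarrow> 0 < t \<Longrightarrow> t \<le> T \<Longrightarrow>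
       l * norm (evol \<theta> \<delta> m l t) \<le> C2 * t powr (- real m - (\<alpha> - \<beta> + 1))"
    by (rule evol_smoothing_bound[OF assms(8), of m]) blast
  \<comment> \<open>The condition 1 \<le> m is placed inside the property so that a constant exists
    in every case; for m = 0 the property is vacuous and 1 is an arbitrary positive choice.\<close>
  obtain C3 where C3: "0 < C3"
    "\<And>\<theta> \<delta> l t. 1 \<le> m \<Longrightarrow> pi / 2 < \<theta> \<Longrightarrow> \<theta> < \<Theta> \<Longrightarrow> 0 < \<delta> \<Longrightarrow> 0 \<le> l \<Longrightarrow> 0 < t \<Longrightarrow> t \<le> T \<Longrightarrow>
       norm (evol \<theta> \<delta> m l t) \<le> C3 * l * t powr (- real m + (\<alpha> - \<beta> + 1))"
  proof (cases "1 \<le> m")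
    case True
    show thesis by (rule evol_decay_bound[OF assms(8) True]) (rule that, auto)
  next
    case False
    then show thesis using that[of 1] by simp
  qed
  define C where "C = C1 + C2 + C3"
  have C: "C1 \<le> C" "C2 \<le> C" "C3 \<le> C" using C1(1) C2(1) C3(1) by (auto simp: C_def)
  have mono: "x \<le> D * t powr p \<Longrightarrow> D \<le> C \<Longrightarrow> x \<le> C * t powr p" for x D t p
    by (erule order_trans) (rule mult_right_mono, auto)
  show ?thesis
  proof (intro exI[of _ C] allI impI, unfold Let_def, intro conjI ballI impI allI)
    fix \<Omega> lam \<phi> and \<theta> \<delta> t :: real and v :: L2 and k :: nat
    assume \<Omega>: "convex_polygonal_domain \<Omega>" "eigensystem \<Omega> lam \<phi>" and *: "pi / 2 < \<theta>" "\<theta> < pi / (1 + \<alpha>)" "0 < \<delta>"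
    have "\<Omega> \<in> sets borel" using \<Omega>(1) by (auto simp: convex_polygonal_domain_def)
    then interpret oldroyd_dirichlet \<alpha> \<beta> \<mu> a b \<Omega> lam \<phi> \<theta> \<delta>
      using \<Omega>(2) * by unfold_locales (auto simp: \<Theta>_def)
    assume t: "t \<in> {0<..T}"
    then have t0: "0 < t" "t \<le> T" by auto
    show "sol_op_deriv \<Omega> g \<theta> \<delta> m t v \<in> dom_A \<Omega>" if "v \<in> L2_on \<Omega>"
      by (simp add: sol_op_deriv_eq(1)[OF that t0(1)] evol_op_in_dom_A[OF t0(1)])
    show "(\<lambda>s. sol_op_deriv \<Omega> g \<theta> \<delta> k s v) differentiable at t" if "v \<in> L2_on \<Omega>"
      using sol_op_deriv_eq(2)[OF that t0(1)] by (rule differentiableI_vector)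
    fix \<nu> :: nat assume \<nu>: "\<nu> \<in> {0, 1}"
    have pos: "0 \<le> C * t powr p" for p using C1(1) C2(1) C3(1) by (simp add: C_def)
    note b1 = mono[OF C1(2)[OF \<theta> \<delta> lam_nonneg t0(1)] C(1)]
    note b2 = mono[OF C2(2)[OF \<theta> \<delta> lam_nonneg t0] C(2)]
    show "norm ((op_A \<Omega> ^^ \<nu>) (sol_op_deriv \<Omega> g \<theta> \<delta> m t v)) \<le>
        C * t powr (- real m - real \<nu> * (\<alpha> - \<beta> + 1)) * norm v" if v: "v \<in> L2_on \<Omega>"
      using \<nu> evol_op_bounds(1)[OF t0(1) v pos b1] evol_op_bounds(2)[OF t0(1) v pos b2]
      by (auto simp: sol_op_deriv_eq(1)[OF v t0(1)])
    show "norm ((op_A \<Omega> ^^ \<nu>) (sol_op_deriv \<Omega> g \<theta> \<delta> m t v)) \<le>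
        C * t powr (- real m + (1 - real \<nu>) * (\<alpha> - \<beta> + 1)) * norm (op_A \<Omega> v)"
      if \<nu>m: "1 \<le> \<nu> + m" and vH: "v \<in> Hdot \<Omega> lam \<phi> 2"
    proof -
      have d: "v \<in> dom_A \<Omega>" using vH by (rule Hdot_2_subset)
      note v = dom_A_L2_on(1)[OF d]
      \<comment> \<open>For \<nu> = 1 the operator A is moved onto v, and the bound without any
        eigenvalue suffices. Only \<nu> = 0 needs the cancellation of 1 / z, and there \<nu> + m
        \<ge> 1 forces m \<ge> 1.\<close>
      consider "\<nu> = 1" | "\<nu> = 0" "1 \<le> m" using \<nu> \<nu>m by auto
      then show ?thesis
      proof cases
        case 1
        then show ?thesis
          using evol_op_bounds(4)[OF t0(1) v pos d b1] by (simp add: sol_op_deriv_eq(1)[OF v t0(1)])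
      next
        case 2
        have "norm (evol \<theta> \<delta> m (lam j) t) \<le> C * t powr (- real m + (\<alpha> - \<beta> + 1)) * lam j" for j
        proof -
          have "C3 * (lam j * t powr (- real m + (\<alpha> - \<beta> + 1))) \<le> C * (lam j * t powr (- real m + (\<alpha> - \<beta> + 1)))"
            using lam_nonneg[of j] by (intro mult_right_mono C(3)) simp
          then show ?thesis
            using C3(2)[OF 2(2) \<theta> \<delta> lam_nonneg t0, of j] by (simp add: mult_ac)
        qed
        from evol_op_bounds(3)[OF t0(1) v pos d this] 2 show ?thesis
          by (simp add: sol_op_deriv_eq(1)[OF v t0(1)])
      qed
    qed
  qed
qed

end
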